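(* Let $\delta=(\delta_1,\delta_2)$ and $\epsilon=(\epsilon_1,\epsilon_2)$ be partitions with at most two parts, and let $d=\delta_1-\delta_2$, $e=\epsilon_1-\epsilon_2$. Let $\lambda,\mu$ be partitions with $\ell(\lambda)\le d+1$ and $\ell(\mu)\le e+1$. Then: (1) $\mathbb{S}_\lambda(\mathbb{S}_\delta(\mathbb{C}^2))\simeq\mathbb{S}_\mu(\mathbb{S}_\epsilon(\mathbb{C}^2))$ as $\mathrm{SL}(2,\mathbb{C})$-modules if and only if $P^d_\lambda=P^e_\mu$, and in this case $|\lambda|d-|\mu|e$ is even. (2) $\mathbb{S}_\lambda(\mathbb{S}_\delta(\mathbb{C}^2))\simeq\mathbb{S}_\mu(\mathbb{S}_\epsilon(\mathbb{C}^2))$ as $\mathrm{GL}(2,\mathbb{C})$-modules if and only if, in addition to $P^d_\lambda=P^e_\mu$, it also holds that $|\delta||\lambda|=|\epsilon||\mu|$.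
   Context: A partition is a weakly decreasing sequence of nonnegative integers with finite sum; $|\lambda|$ is the sum of the parts of $\lambda$ and $\ell(\lambda)$ is its number of nonzero parts. $\mathbb{S}_\lambda$ denotes the Schur functor on complex vector spaces (image of $V^{\otimes|\lambda|}$ under the Young symmetrizer of $\lambda$), so that $\mathbb{S}_{(n)}(V)\simeq\mathrm{Sym}^n(V)$, $\mathbb{S}_{(1^n)}(V)\simeq\Lambda^n(V)$. For a natural number $a$, $[a]_q=\frac{1-q^a}{1-q}=1+q+\cdots+q^{a-1}$. For a box $u=(i,j)$ (row $i$, column $j$) of the Young diagram $Y(\lambda)$, the content is $c(u)=j-i$ and the hook length $h(u)$ is the number of boxes directly below or directly to the right of $u$, including $u$ once. Define $$\mathbf{h}_\lambda(q)=\prod_{u\in Y(\lambda)}[h(u)]_q,\qquad \mathbf{c}^d_\lambda(q)=\prod_{u\in Y(\lambda)}[d+1+c(u)]_q,\qquad P^d_\lambda(q)=\frac{\mathbf{c}^d_\lambda(q)}{\mathbf{h}_\lambda(q)},$$ regarded as rational functions of $q$. *)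

theory Defs
  imports
    "HOL-Analysis.Analysis"
    "HOL-Combinatorics.Permutations"
    "HOL-Computational_Algebra.Fraction_Field"
    "HOL-Computational_Algebra.Polynomial"
    "HOL-Library.Function_Algebras"
begin

text \<open>Parts are indexed from 0, so \<open>lam 0\<close> is the first part.\<close>

definition is_partition :: "(nat \<Rightarrow> nat) \<Rightarrow> bool" where
  "is_partition lam \<longleftrightarrow> antimono lam \<and> finite {i. lam i \<noteq> 0}"

definition part_size :: "(nat \<Rightarrow> nat) \<Rightarrow> nat" where
  "part_size lam = (\<Sum>i | lam i \<noteq> 0. lam i)"

definition part_length :: "(nat \<Rightarrow> nat) \<Rightarrow> nat" where
  "part_length lam = card {i. lam i \<noteq> 0}"

definition young_diagram :: "(nat \<Rightarrow> nat) \<Rightarrow> (nat \<times> nat) set" where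
  "young_diagram lam = {(i, j). j < lam i}"

definition box_content :: "nat \<times> nat \<Rightarrow> int" where
  "box_content u = int (snd u) - int (fst u)"

definition hook_length :: "(nat \<Rightarrow> nat) \<Rightarrow> nat \<times> nat \<Rightarrow> nat" where
  "hook_length lam u = card {v \<in> young_diagram lam.
     (fst v = fst u \<and> snd u \<le> snd v) \<or> (snd v = snd u \<and> fst u \<le> fst v)}"

definition qint :: "nat \<Rightarrow> rat poly" where
  "qint a = (\<Sum>k<a. monom 1 k)"

definition hook_poly :: "(nat \<Rightarrow> nat) \<Rightarrow> rat poly" where
  "hook_poly lam = (\<Prod>u\<in>young_diagram lam. qint (hook_length lam u))"

text \<open>If the partition has at most \<open>d + 1\<close> parts, all the integers \<open>d + 1 + box_content u\<close> are
  positive, so that the truncation by \<^const>\<open>nat\<close> has no effect.\<close>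

definition content_poly :: "nat \<Rightarrow> (nat \<Rightarrow> nat) \<Rightarrow> rat poly" where
  "content_poly d lam = (\<Prod>u\<in>young_diagram lam. qint (nat (int d + 1 + box_content u)))"

definition P_frac :: "nat \<Rightarrow> (nat \<Rightarrow> nat) \<Rightarrow> rat poly fract" where
  "P_frac d lam = Fraction_Field.Fract (content_poly d lam) (hook_poly lam)"

text \<open>Vector spaces are represented as linear subspaces \<open>V\<close> of the space of finitely supported
  functions \<open>'i \<Rightarrow> complex\<close>, that is, of the complex vector space with basis \<open>'i\<close>. The tensor
  power \<open>V\<^sup>\<otimes>\<^sup>n\<close> is then a subspace of the space with basis the lists over \<open>'i\<close> of length \<open>n\<close>.\<close>

definition fscale :: "complex \<Rightarrow> ('i \<Rightarrow> complex) \<Rightarrow> 'i \<Rightarrow> complex" where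
  "fscale c x = (\<lambda>i. c * x i)"

global_interpretation fun_space: vector_space fscale
  by unfold_locales (auto simp: fscale_def fun_eq_iff algebra_simps)

definition pure_tensor :: "('i \<Rightarrow> complex) list \<Rightarrow> 'i list \<Rightarrow> complex" where
  "pure_tensor vs = (\<lambda>is. if length is = length vs
     then (\<Prod>k<length vs. (vs ! k) (is ! k)) else 0)"

definition tensor_power :: "nat \<Rightarrow> ('i \<Rightarrow> complex) set \<Rightarrow> ('i list \<Rightarrow> complex) set" where
  "tensor_power n V = fun_space.span {pure_tensor vs | vs. length vs = n \<and> set vs \<subseteq> V}"

text \<open>A linear endomorphism is given by its matrix with respect to the basis \<open>'i\<close>. The sum below
  is finite because it is only used for finitely supported \<open>x\<close>.\<close>

definition mat_app :: "('i \<Rightarrow> 'i \<Rightarrow> complex) \<Rightarrow> ('i \<Rightarrow> complex) \<Rightarrow> 'i \<Rightarrow> complex" where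
  "mat_app A x = (\<lambda>i. \<Sum>j | x j \<noteq> 0. A i j * x j)"

definition tensor_mat :: "nat \<Rightarrow> ('i \<Rightarrow> 'i \<Rightarrow> complex) \<Rightarrow> 'i list \<Rightarrow> 'i list \<Rightarrow> complex" where
  "tensor_mat n A = (\<lambda>is js. if length is = n \<and> length js = n
     then (\<Prod>k<n. A (is ! k) (js ! k)) else 0)"

lemma sum_listset_prod:
  fixes f :: "nat \<Rightarrow> 'i \<Rightarrow> complex"
  assumes "\<And>S. S \<in> set Ss \<Longrightarrow> finite S"
  shows "(\<Sum>js\<in>listset Ss. \<Prod>k<length Ss. f k (js ! k)) = (\<Prod>k<length Ss. \<Sum>j\<in>Ss ! k. f k j)"
  using assms
proof (induction Ss arbitrary: f)
  case (Cons S Ss)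
  have eq: "listset (S # Ss) = (\<lambda>(j, js). j # js) ` (S \<times> listset Ss)"
    by (auto simp: set_Cons_def)
  have "(\<Sum>js\<in>listset (S # Ss). \<Prod>k<length (S # Ss). f k (js ! k)) =
        (\<Sum>(j, js)\<in>S \<times> listset Ss. \<Prod>k<Suc (length Ss). f k ((j # js) ! k))"
    unfolding eq by (subst sum.reindex) (auto simp: inj_on_def case_prod_unfold)
  also have "\<dots> = (\<Sum>(j, js)\<in>S \<times> listset Ss. f 0 j * (\<Prod>k<length Ss. f (Suc k) (js ! k)))"
    by (simp add: prod.lessThan_Suc_shift del: prod.lessThan_Suc)
  also have "\<dots> = (\<Sum>j\<in>S. f 0 j) * (\<Sum>js\<in>listset Ss. \<Prod>k<length Ss. f (Suc k) (js ! k))"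
    by (simp add: sum.cartesian_product[symmetric] sum_product)
  also have "\<dots> = (\<Sum>j\<in>S. f 0 j) * (\<Prod>k<length Ss. \<Sum>j\<in>Ss ! k. f (Suc k) j)"
    using Cons.IH[of "\<lambda>k. f (Suc k)"] Cons.prems by simp
  also have "\<dots> = (\<Prod>k<length (S # Ss). \<Sum>j\<in>(S # Ss) ! k. f k j)"
    by (simp add: prod.lessThan_Suc_shift del: prod.lessThan_Suc)
  finally show ?case .
qed simp

lemma in_listset_iff:
  "js \<in> listset Ss \<longleftrightarrow> length js = length Ss \<and> (\<forall>k<length Ss. js ! k \<in> Ss ! k)"
proof (induction Ss arbitrary: js)
  case (Cons S Ss)
  show ?case
    by (cases js) (auto simp: set_Cons_def Cons.IH less_Suc_eq_0_disj)
qed auto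

lemma mat_app_tensor_mat_pure_tensor:
  assumes "\<And>v. v \<in> set vs \<Longrightarrow> finite {i. v i \<noteq> 0}"
  shows "mat_app (tensor_mat (length vs) A) (pure_tensor vs) = pure_tensor (map (mat_app A) vs)"
proof
  fix "is"
  let ?Ss = "map (\<lambda>v. {j. v j \<noteq> 0}) vs"
  have supp: "{js. pure_tensor vs js \<noteq> 0} = listset ?Ss"
    by (auto simp: pure_tensor_def in_listset_iff)
  show "mat_app (tensor_mat (length vs) A) (pure_tensor vs) is = pure_tensor (map (mat_app A) vs) is"
  proof (cases "length is = length vs")
    case True
    have "mat_app (tensor_mat (length vs) A) (pure_tensor vs) is =
       (\<Sum>js\<in>listset ?Ss. \<Prod>k<length ?Ss. A (is ! k) (js ! k) * (vs ! k) (js ! k))"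
      unfolding mat_app_def supp using True
      by (intro sum.cong) (auto simp: in_listset_iff tensor_mat_def pure_tensor_def prod.distrib)
    also have "\<dots> = (\<Prod>k<length ?Ss. \<Sum>j\<in>?Ss ! k. A (is ! k) j * (vs ! k) j)"
      by (rule sum_listset_prod) (use assms in auto)
    also have "\<dots> = pure_tensor (map (mat_app A) vs) is"
      using True by (simp add: pure_tensor_def mat_app_def)
    finally show ?thesis .
  qed (simp add: mat_app_def tensor_mat_def pure_tensor_def)
qed

text \<open>The boxes of the Young diagram are numbered from 0 row by row; box number \<open>k\<close> corresponds to
  the tensor factor at position \<open>k\<close>.\<close>

definition box_row :: "(nat \<Rightarrow> nat) \<Rightarrow> nat \<Rightarrow> nat" where
  "box_row lam k = (LEAST i. k < (\<Sum>i'\<le>i. lam i'))"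

definition box_col :: "(nat \<Rightarrow> nat) \<Rightarrow> nat \<Rightarrow> nat" where
  "box_col lam k = k - (\<Sum>i'<box_row lam k. lam i')"

definition row_group :: "(nat \<Rightarrow> nat) \<Rightarrow> (nat \<Rightarrow> nat) set" where
  "row_group lam = {p. p permutes {..<part_size lam} \<and>
     (\<forall>k<part_size lam. box_row lam (p k) = box_row lam k)}"

definition col_group :: "(nat \<Rightarrow> nat) \<Rightarrow> (nat \<Rightarrow> nat) set" where
  "col_group lam = {p. p permutes {..<part_size lam} \<and>
     (\<forall>k<part_size lam. box_col lam (p k) = box_col lam k)}"

text \<open>A permutation \<open>p\<close> acts on the left on tensors by \<open>(p x) is = x (permute_list p is)\<close>, that is,
  it moves the factor at position \<open>k\<close> to position \<open>p k\<close>.\<close>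

definition young_symmetrizer :: "(nat \<Rightarrow> nat) \<Rightarrow> ('i list \<Rightarrow> complex) \<Rightarrow> 'i list \<Rightarrow> complex" where
  "young_symmetrizer lam x = (\<lambda>is. \<Sum>p\<in>row_group lam. \<Sum>q\<in>col_group lam.
     of_int (sign q) * x (permute_list (p \<circ> q) is))"

definition schur :: "(nat \<Rightarrow> nat) \<Rightarrow> ('i \<Rightarrow> complex) set \<Rightarrow> ('i list \<Rightarrow> complex) set" where
  "schur lam V = young_symmetrizer lam ` tensor_power (part_size lam) V"

text \<open>If the endomorphism with matrix \<open>A\<close> maps \<open>V\<close> to itself, then the endomorphism of
  \<open>schur lam V\<close> induced by functoriality is the restriction of the one with the following matrix.\<close>

definition schur_mat :: "(nat \<Rightarrow> nat) \<Rightarrow> ('i \<Rightarrow> 'i \<Rightarrow> complex) \<Rightarrow> 'i list \<Rightarrow> 'i list \<Rightarrow> complex" where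
  "schur_mat lam A = tensor_mat (part_size lam) A"

definition GL2 :: "(complex^2^2) set" where
  "GL2 = {g. invertible g}"

definition SL2 :: "(complex^2^2) set" where
  "SL2 = {g. det g = 1}"

definition std_space :: "(2 \<Rightarrow> complex) set" where
  "std_space = UNIV"

definition std_mat :: "complex^2^2 \<Rightarrow> 2 \<Rightarrow> 2 \<Rightarrow> complex" where
  "std_mat g = (\<lambda>i j. g $ i $ j)"

definition plethysm_space :: "(nat \<Rightarrow> nat) \<Rightarrow> (nat \<Rightarrow> nat) \<Rightarrow> (2 list list \<Rightarrow> complex) set" where
  "plethysm_space lam delta = schur lam (schur delta std_space)"

definition plethysm_action ::
  "(nat \<Rightarrow> nat) \<Rightarrow> (nat \<Rightarrow> nat) \<Rightarrow> complex^2^2 \<Rightarrow> (2 list list \<Rightarrow> complex) \<Rightarrow> 2 list list \<Rightarrow> complex" where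
  "plethysm_action lam delta g = mat_app (schur_mat lam (schur_mat delta (std_mat g)))"

definition module_iso :: "'g set \<Rightarrow>
    ('i \<Rightarrow> complex) set \<Rightarrow> ('g \<Rightarrow> ('i \<Rightarrow> complex) \<Rightarrow> 'i \<Rightarrow> complex) \<Rightarrow>
    ('j \<Rightarrow> complex) set \<Rightarrow> ('g \<Rightarrow> ('j \<Rightarrow> complex) \<Rightarrow> 'j \<Rightarrow> complex) \<Rightarrow> bool" where
  "module_iso G V \<rho> W \<sigma> \<longleftrightarrow> (\<exists>\<phi>. bij_betw \<phi> V W \<and>
     (\<forall>x\<in>V. \<forall>y\<in>V. \<phi> (x + y) = \<phi> x + \<phi> y) \<and>
     (\<forall>c. \<forall>x\<in>V. \<phi> (fscale c x) = fscale c (\<phi> x)) \<and>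
     (\<forall>g\<in>G. \<forall>x\<in>V. \<phi> (\<rho> g x) = \<sigma> g (\<phi> x)))"

definition plethysm_iso :: "(complex^2^2) set \<Rightarrow>
    (nat \<Rightarrow> nat) \<Rightarrow> (nat \<Rightarrow> nat) \<Rightarrow> (nat \<Rightarrow> nat) \<Rightarrow> (nat \<Rightarrow> nat) \<Rightarrow> bool" where
  "plethysm_iso G lam delta mu eps \<longleftrightarrow>
     module_iso G (plethysm_space lam delta) (plethysm_action lam delta)
                  (plethysm_space mu eps) (plethysm_action mu eps)"

end

theory Submission
  imports Defs "Jordan_Normal_Form.Determinant"
begin

text \<open>Both modules are determined by their weights. The images of the Young symmetrizer on fillings of
  the diagram satisfy Garnir relations, which rewrite every filling in terms of semistandard tableaux;
  evaluation at tableaux is triangular, so the semistandard tableaux give a basis of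
  \<open>schur lam V\<close> consisting of weight vectors. For \<open>V = schur \<delta> \<complex>\<^sup>2\<close> the weights are therefore counted by
  the principal specialization \<open>s_lam(1, q, ..., q^d)\<close>, which by branching and a Vandermonde determinant
  equals \<open>q^n(lam) P(q)\<close>; since \<open>deg P + 2 n(lam) = |lam| d\<close>, the weights and \<open>P\<close> determine each other.

  That the weight multiplicities determine the \<open>SL(2)\<close>-module is shown without Lie algebras: the modules
  are stable under adjoints, and for a unit vector \<open>p\<close> of highest weight \<open>n\<close> the matrix coefficient
  \<open>\<langle>g p, p\<rangle>\<close> is \<open>a^n\<close> with \<open>a\<close> the upper left entry of \<open>g\<close>. Hence two such vectors generate isometric
  submodules, and one proceeds with the orthogonal complements. The group \<open>GL(2)\<close> only adds the
  scalar matrices, which act by the total degree.\<close>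

section \<open>Vandermonde determinants\<close>

text \<open>The setup is shaped by applying the Schur functor twice. For the outer functor,
  independence needs a basis of \<open>schur \<delta> std_space\<close> together with index lists at
  which the basis vectors take the values 0 and 1; such points are available because the weights of
  the inner module have multiplicity one. Only the ambient tensor powers are treated as
  representations, with orthonormal coordinates, and the Schur modules sit in them as submodules.
  This makes adjoints available: the adjoint of a tensor power of a matrix is the tensor power of
  its adjoint.

  The factor \<open>q ^ n(lam)\<close> is not determined by \<open>P\<close>. It disappears because
  weights are centred: the exponent \<open>m\<close> of the generating function belongs to the
  weight \<open>2 m - |lam| d\<close>, and the degree equation puts the exponents that occur
  symmetrically about weight 0.

  The formula for matrix coefficients comes from factoring a matrix as lower unipotent times
  diagonal times upper unipotent, which requires \<open>a \<noteq> 0\<close>; the matrices with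
  \<open>a = 0\<close> are reached by continuity.\<close>

definition vandermonde :: "nat \<Rightarrow> (nat \<Rightarrow> 'a::comm_ring_1) \<Rightarrow> 'a" where
  "vandermonde n y = (\<Prod>j<n. \<Prod>i<j. y i - y j)"

abbreviation power_mat :: "nat \<Rightarrow> (nat \<Rightarrow> 'a::comm_ring_1) \<Rightarrow> 'a mat" where
  "power_mat n y \<equiv> mat n n (\<lambda>(i, k). y i ^ k)"



lemma det_mat_leibniz:
  "Determinant.det (mat n n f) = (\<Sum>p | p permutes {..<n}. signof p * (\<Prod>i<n. f (i, p i)))"
proof -
  have "Determinant.det (mat n n f) = (\<Sum>p | p permutes {..<n}. signof p * (\<Prod>i<n. mat n n f $$ (i, p i)))"
    by (subst det_def'[where n = n]) (auto simp: atLeast0LessThan)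
  also have "\<dots> = (\<Sum>p | p permutes {..<n}. signof p * (\<Prod>i<n. f (i, p i)))"
    by (intro sum.cong refl arg_cong2[where f = "(*)"] prod.cong) (use permutes_in_image in fastforce)
  finally show ?thesis .
qed

text \<open>Multiplication by this matrix from the left adds \<open>a\<close> times the next row to
  each row, from the right \<open>a\<close> times the preceding column to each column. Both
  recursions for the power matrix below are such operations, so they leave the determinant
  unchanged.\<close>

lemma det_bidiagonal:
  fixes a :: "'a :: comm_ring_1"
  shows "Determinant.det (mat n n (\<lambda>(i, j). if i = j then 1 else if j = Suc i then a else 0)) = 1"
  by (subst det_upper_triangular[where n = n])
     (auto simp: upper_triangular_def diag_mat_def map_idI simp flip: prod.distinct_set_conv_list)

lemma bidiagonal_mult:
  fixes A :: "'a :: comm_ring_1 mat"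
  assumes "A \<in> carrier_mat n n" "i < n" "k < n"
  shows "(mat n n (\<lambda>(i, j). if i = j then 1 else if j = Suc i then a else 0) * A) $$ (i, k) =
    A $$ (i, k) + (if Suc i < n then a * A $$ (Suc i, k) else 0)"
proof -
  have "(mat n n (\<lambda>(i, j). if i = j then 1 else if j = Suc i then a else 0) * A) $$ (i, k) =
    (\<Sum>j<n. (if i = j then 1 else if j = Suc i then a else 0) * A $$ (j, k))"
    using assms by (simp add: scalar_prod_def atLeast0LessThan)
  also have "\<dots> = (\<Sum>j<n. (if j = i then A $$ (i, k) else 0) + (if j = Suc i then a * A $$ (Suc i, k) else 0))"
    by (intro sum.cong) auto
  also have "\<dots> = A $$ (i, k) + (if Suc i < n then a * A $$ (Suc i, k) else 0)"
    using assms by (simp add: sum.distrib sum.delta)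
  finally show ?thesis .
qed

lemma mult_bidiagonal:
  fixes A :: "'a :: comm_ring_1 mat"
  assumes "A \<in> carrier_mat n n" "i < n" "k < n"
  shows "(A * mat n n (\<lambda>(i, j). if i = j then 1 else if j = Suc i then a else 0)) $$ (i, k) =
    A $$ (i, k) + (if k = 0 then 0 else a * A $$ (i, k - 1))"
proof -
  have "(A * mat n n (\<lambda>(i, j). if i = j then 1 else if j = Suc i then a else 0)) $$ (i, k) =
    (\<Sum>j<n. A $$ (i, j) * (if j = k then 1 else if k = Suc j then a else 0))"
    using assms by (simp add: scalar_prod_def atLeast0LessThan)
  also have "\<dots> = (\<Sum>j<n. (if j = k then A $$ (i, k) else 0) +
      (if j = k - 1 then if k = 0 then 0 else a * A $$ (i, k - 1) else 0))"
    by (intro sum.cong) auto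
  also have "\<dots> = A $$ (i, k) + (if k = 0 then 0 else a * A $$ (i, k - 1))"
    using assms by (auto simp: sum.distrib sum.delta)
  finally show ?thesis .
qed

text \<open>Subtracting from each row the next one clears the first column except for its last entry
  1. Geometric sums produce exactly the remaining differences, so in this form a sum over
  interlacing exponents can be recognised as a Vandermonde determinant.\<close>

lemma det_power_mat_differences:
  fixes y :: "nat \<Rightarrow> 'a :: comm_ring_1"
  shows "Determinant.det (power_mat (Suc n) y) =
    (-1) ^ n * Determinant.det (mat n n (\<lambda>(i, k). y i ^ Suc k - y (Suc i) ^ Suc k))"
proof -
  let ?L = "mat (Suc n) (Suc n) (\<lambda>(i, j). if i = j then 1 else if j = Suc i then -1 else 0) :: 'a mat"
  define B where "B = ?L * power_mat (Suc n) y"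
  have B: "B \<in> carrier_mat (Suc n) (Suc n)" by (auto simp: B_def)
  have Bi: "B $$ (i, k) = y i ^ k - (if i < n then y (Suc i) ^ k else 0)" if "i < Suc n" "k < Suc n" for i k
    using that unfolding B_def by (subst bidiagonal_mult) auto
  have "Determinant.det (power_mat (Suc n) y) = Determinant.det B"
    unfolding B_def by (subst det_mult[of _ "Suc n"]) (auto simp: det_bidiagonal)
  also have "\<dots> = (\<Sum>i<Suc n. B $$ (i, 0) * cofactor B i 0)"
    by (rule laplace_expansion_column[OF B]) simp
  also have "\<dots> = (\<Sum>i<Suc n. if i = n then cofactor B i 0 else 0)"
    by (intro sum.cong) (auto simp: Bi)
  also have "\<dots> = cofactor B n 0" by simp
  finally have *: "Determinant.det (power_mat (Suc n) y) = cofactor B n 0" .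
  have "mat_delete B n 0 = mat n n (\<lambda>(i, k). y i ^ Suc k - y (Suc i) ^ Suc k)"
    by (rule eq_matI) (auto simp: mat_delete_def Bi B[THEN carrier_matD(1)] B[THEN carrier_matD(2)] simp del: power_Suc)
  then have "cofactor B n 0 = (-1) ^ n * Determinant.det (mat n n (\<lambda>(i, k). y i ^ Suc k - y (Suc i) ^ Suc k))"
    by (simp add: cofactor_def)
  with * show ?thesis by simp
qed

text \<open>Subtracting \<open>y n\<close> times the preceding column from each column turns the
  last row into \<open>(1, 0, ..., 0)\<close> and makes \<open>y i - y n\<close> a common factor of
  row \<open>i\<close> apart from its first entry.\<close>

lemma det_power_mat_Suc:
  fixes y :: "nat \<Rightarrow> 'a :: comm_ring_1"
  shows "Determinant.det (power_mat (Suc n) y) =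
    (-1) ^ n * (\<Prod>i<n. y i - y n) * Determinant.det (power_mat n y)"
proof -
  let ?U = "mat (Suc n) (Suc n) (\<lambda>(i, j). if i = j then 1 else if j = Suc i then - y n else 0) :: 'a mat"
  define B where "B = power_mat (Suc n) y * ?U"
  have B: "B \<in> carrier_mat (Suc n) (Suc n)" by (auto simp: B_def)
  have Bi: "B $$ (i, k) = (if k = 0 then 1 else y i ^ (k - 1) * (y i - y n))" if "i < Suc n" "k < Suc n" for i k
    using that unfolding B_def by (subst mult_bidiagonal) (auto simp: algebra_simps simp flip: power_Suc)
  have "Determinant.det (power_mat (Suc n) y) = Determinant.det B"
    unfolding B_def by (subst det_mult[of _ "Suc n"]) (auto simp: det_bidiagonal)
  also have "\<dots> = (\<Sum>k<Suc n. B $$ (n, k) * cofactor B n k)"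
    by (rule laplace_expansion_row[OF B]) simp
  also have "\<dots> = (\<Sum>k<Suc n. if k = 0 then cofactor B n k else 0)"
    by (intro sum.cong) (auto simp: Bi)
  also have "\<dots> = cofactor B n 0" by simp
  finally have *: "Determinant.det (power_mat (Suc n) y) = cofactor B n 0" .
  have "mat_delete B n 0 = mat n n (\<lambda>(i, k). (y i - y n) * y i ^ k)"
    by (rule eq_matI) (auto simp: mat_delete_def Bi B[THEN carrier_matD(1)] B[THEN carrier_matD(2)] simp del: power_Suc)
  also have "Determinant.det (mat n n (\<lambda>(i, k). (y i - y n) * y i ^ k)) =
     (\<Prod>i<n. y i - y n) * Determinant.det (power_mat n y)"
    by (simp add: det_mat_leibniz prod.distrib sum_distrib_left ac_simps)
  finally show ?thesis using * by (simp add: cofactor_def ac_simps)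
qed

text \<open>The sign compensates for \<open>vandermonde\<close> subtracting the later argument from
  the earlier one, the order that suits powers of \<open>q\<close> with decreasing
  exponents.\<close>

lemma det_power_mat:
  fixes y :: "nat \<Rightarrow> 'a :: comm_ring_1"
  shows "Determinant.det (power_mat n y) = (\<Prod>m<n. (-1) ^ m) * vandermonde n y"
proof (induction n)
  case (Suc n)
  show ?case
    unfolding det_power_mat_Suc Suc.IH by (simp add: vandermonde_def ac_simps)
qed (simp add: vandermonde_def)

lemma sum_powers_telescope:
  fixes q :: "'a :: comm_ring_1"
  assumes "a \<le> b"
  shows "(q ^ k - 1) * (\<Sum>m=a..<b. (q ^ m) ^ k) = (q ^ b) ^ k - (q ^ a) ^ k"
  using assms by (induction rule: dec_induct) (auto simp: algebra_simps simp flip: power_mult power_add)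

text \<open>In the Leibniz expansion the sum over the box of exponents factors into one geometric
  sum per row. The denominators \<open>q ^ Suc (p i) - 1\<close> have the same product for every
  permutation \<open>p\<close>, hence the common factor in front. The extra factors
  \<open>q ^ m i\<close> shift the column exponents from \<open>0, ..., n - 1\<close> to
  \<open>1, ..., n\<close>, as the matrix of differences demands.\<close>

lemma vandermonde_interlacing_sum:
  fixes q :: "'a :: idom" and l :: "nat \<Rightarrow> nat"
  assumes "\<And>i. i < n \<Longrightarrow> l (Suc i) \<le> l i"
  shows "(\<Prod>k<n. q ^ Suc k - 1) *
      (\<Sum>m\<in>PiE {..<n} (\<lambda>i. {l (Suc i)..<l i}). (\<Prod>i<n. q ^ m i) * vandermonde n (\<lambda>i. q ^ m i)) =
    vandermonde (Suc n) (\<lambda>i. q ^ l i)"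
proof -
  let ?P = "PiE {..<n} (\<lambda>i. {l (Suc i)..<l i})" and ?e = "(\<Prod>m<n. (-1) ^ m) :: 'a"
  let ?D = "mat n n (\<lambda>(i, k). (q ^ l i) ^ Suc k - (q ^ l (Suc i)) ^ Suc k)"
  have e: "?e * ?e = 1"
    by (simp flip: prod.distrib power_mult_distrib)
  have "?e * ((\<Prod>k<n. q ^ Suc k - 1) * (\<Sum>m\<in>?P. (\<Prod>i<n. q ^ m i) * vandermonde n (\<lambda>i. q ^ m i))) =
     (\<Prod>k<n. q ^ Suc k - 1) * (\<Sum>m\<in>?P. (\<Prod>i<n. q ^ m i) * Determinant.det (power_mat n (\<lambda>i. q ^ m i)))"
    by (simp add: det_power_mat sum_distrib_left ac_simps)
  also have "\<dots> = (\<Prod>k<n. q ^ Suc k - 1) * (\<Sum>m\<in>?P. (\<Prod>i<n. q ^ m i) * (\<Sum>p | p permutes {..<n}. signof p * (\<Prod>i<n. (q ^ m i) ^ p i)))"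
    by (simp only: det_mat_leibniz prod.case)
  also have "\<dots> = (\<Sum>p | p permutes {..<n}. signof p * ((\<Prod>k<n. q ^ Suc k - 1) * (\<Sum>m\<in>?P. \<Prod>i<n. (q ^ m i) ^ Suc (p i))))"
    by (simp add: sum_distrib_left sum.swap[of _ ?P] prod.distrib ac_simps)
  also have "\<dots> = (\<Sum>p | p permutes {..<n}. signof p * (\<Prod>i<n. (q ^ l i) ^ Suc (p i) - (q ^ l (Suc i)) ^ Suc (p i)))"
  proof (intro sum.cong refl arg_cong2[where f = "(*)"])
    fix p assume "p \<in> {p. p permutes {..<n}}"
    then have p: "p permutes {..<n}" by simp
    \<comment> \<open>Reindexing the product along \<open>p\<close> brings each factor to the row
      whose geometric sum has it as denominator.\<close>
    have "(\<Prod>k<n. q ^ Suc k - 1) * (\<Sum>m\<in>?P. \<Prod>i<n. (q ^ m i) ^ Suc (p i)) =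
      (\<Prod>i<n. q ^ Suc (p i) - 1) * (\<Prod>i<n. \<Sum>m=l (Suc i)..<l i. (q ^ m) ^ Suc (p i))"
      by (subst prod.permute[OF p]) (simp add: prod_sum_PiE o_def)
    also have "\<dots> = (\<Prod>i<n. (q ^ l i) ^ Suc (p i) - (q ^ l (Suc i)) ^ Suc (p i))"
      unfolding prod.distrib[symmetric]
      by (intro prod.cong refl sum_powers_telescope) (use assms in auto)
    finally show "(\<Prod>k<n. q ^ Suc k - 1) * (\<Sum>m\<in>?P. \<Prod>i<n. (q ^ m i) ^ Suc (p i)) =
       (\<Prod>i<n. (q ^ l i) ^ Suc (p i) - (q ^ l (Suc i)) ^ Suc (p i))" .
  qed
  also have "\<dots> = Determinant.det ?D"
    by (simp only: det_mat_leibniz prod.case)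
  also have "\<dots> = ?e * vandermonde (Suc n) (\<lambda>i. q ^ l i)"
    using det_power_mat_differences[of n "\<lambda>i. q ^ l i"] unfolding det_power_mat
    by (simp add: ac_simps)
  finally show ?thesis using e by auto
qed

section \<open>The generating function of semistandard tableaux\<close>

lemma in_young_diagram [simp]: "(i, j) \<in> young_diagram lam \<longleftrightarrow> j < lam i"
  by (simp add: young_diagram_def)

lemma young_diagram_eq_Sigma:
  assumes "\<And>i. i \<ge> N \<Longrightarrow> lam i = 0"
  shows "young_diagram lam = (SIGMA i:{..<N}. {..<lam i})"
proof -
  have "i < N" if "j < lam i" for i j
    using assms[of i] that by (cases "N \<le> i") auto
  then show ?thesis by (auto simp: young_diagram_def)
qed

lemma vandermonde_scale:
  "vandermonde n (\<lambda>i. c * y i) = c ^ (\<Sum>j<n. j) * vandermonde n y"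
  by (simp add: vandermonde_def power_sum prod.distrib flip: right_diff_distrib)

definition ssyt :: "(nat \<Rightarrow> nat) \<Rightarrow> nat \<Rightarrow> (nat \<times> nat \<Rightarrow> nat) set" where
  "ssyt lam N = {T \<in> young_diagram lam \<rightarrow>\<^sub>E {..<N}.
     (\<forall>i j j'. j \<le> j' \<longrightarrow> j' < lam i \<longrightarrow> T (i, j) \<le> T (i, j')) \<and>
     (\<forall>i i' j. i < i' \<longrightarrow> j < lam i' \<longrightarrow> T (i, j) < T (i', j))}"

text \<open>For \<open>lam\<close> with at most \<open>N + 1\<close> rows these are the shapes
  \<open>nu\<close> such that \<open>lam / nu\<close> is a horizontal strip: the possible shapes of
  the part of a tableau with entries below \<open>N\<close>.\<close>

definition interlacing :: "(nat \<Rightarrow> nat) \<Rightarrow> nat \<Rightarrow> (nat \<Rightarrow> nat) set" where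
  "interlacing lam N = {nu. (\<forall>i<N. lam (Suc i) \<le> nu i \<and> nu i \<le> lam i) \<and> (\<forall>i\<ge>N. nu i = 0)}"

text \<open>The principal specialization of the Schur polynomial, with the variables in the order
  \<open>q ^ (N - 1), ..., q, 1\<close>. In this order the largest entry has weight 1, so removing
  it costs nothing, and lowering \<open>N\<close> by one divides the weight by \<open>q\<close> for
  each remaining box.\<close>

definition ssyt_gf :: "'a::comm_ring_1 \<Rightarrow> (nat \<Rightarrow> nat) \<Rightarrow> nat \<Rightarrow> 'a" where
  "ssyt_gf q lam N = (\<Sum>T\<in>ssyt lam N. \<Prod>u\<in>young_diagram lam. q ^ (N - 1 - T u))"

lemma ssytD:
  assumes "T \<in> ssyt lam N"
  shows "j < lam i \<Longrightarrow> T (i, j) < N"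
    and "j \<le> j' \<Longrightarrow> j' < lam i \<Longrightarrow> T (i, j) \<le> T (i, j')"
    and "i < i' \<Longrightarrow> j < lam i' \<Longrightarrow> T (i, j) < T (i', j)"
    and "\<not> j < lam i \<Longrightarrow> T (i, j) = undefined"
  using assms by (auto simp: ssyt_def PiE_iff extensional_def)

lemma finite_ssyt:
  assumes "\<And>i. i \<ge> N \<Longrightarrow> lam i = 0"
  shows "finite (ssyt lam M)"
proof (rule finite_subset)
  show "ssyt lam M \<subseteq> young_diagram lam \<rightarrow>\<^sub>E {..<M}" by (auto simp: ssyt_def)
  show "finite (young_diagram lam \<rightarrow>\<^sub>E {..<M})"
    using young_diagram_eq_Sigma[OF assms] by (auto intro!: finite_PiE)
qed

lemma ssyt_row_le:
  assumes T: "T \<in> ssyt lam N" and "antimono lam" "j < lam i"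
  shows "i \<le> T (i, j)"
  using \<open>j < lam i\<close>
proof (induction i)
  case (Suc i)
  have "lam (Suc i) \<le> lam i" using \<open>antimono lam\<close> by (simp add: antimono_def)
  with Suc have "i \<le> T (i, j)" by simp
  also have "T (i, j) < T (Suc i, j)" using Suc.prems by (intro ssytD(3)[OF T]) auto
  finally show ?case by simp
qed simp

definition entries_below :: "(nat \<Rightarrow> nat) \<Rightarrow> nat \<Rightarrow> (nat \<times> nat \<Rightarrow> nat) \<Rightarrow> nat \<Rightarrow> nat" where
  "entries_below lam N T i = card {j. j < lam i \<and> T (i, j) < N}"

lemma down_closed_eq_lessThan:
  fixes S :: "nat set"
  assumes "finite S" "\<And>a b. b \<in> S \<Longrightarrow> a \<le> b \<Longrightarrow> a \<in> S"
  shows "S = {..<card S}"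
proof (cases "S = {}")
  case False
  have S: "S = {..Max S}"
  proof
    show "S \<subseteq> {..Max S}" using Max_ge[OF assms(1)] by auto
    show "{..Max S} \<subseteq> S" using assms(2)[OF Max_in[OF assms(1) False]] by auto
  qed
  have "card S = Suc (Max S)" by (subst S) (rule card_atMost)
  then show ?thesis by (subst S) (simp only: lessThan_Suc_atMost)
qed simp

lemma less_entries_below_iff:
  assumes T: "T \<in> ssyt lam M"
  shows "j < entries_below lam N T i \<longleftrightarrow> j < lam i \<and> T (i, j) < N"
proof -
  let ?S = "{j. j < lam i \<and> T (i, j) < N}"
  have "?S = {..<card ?S}"
  proof (rule down_closed_eq_lessThan)
    show "a \<in> ?S" if "b \<in> ?S" "a \<le> b" for a b
      using that ssytD(2)[OF T, of a b i] by simp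
  qed simp
  then have "j \<in> ?S \<longleftrightarrow> j \<in> {..<card ?S}" by blast
  then show ?thesis by (simp add: entries_below_def)
qed

text \<open>A box of row \<open>i\<close> with a box of \<open>lam\<close> below it cannot hold the
  largest entry \<open>N\<close>, because the entry below is strictly larger; this gives the lower
  bound. Since the entries of row \<open>i\<close> are at least \<open>i\<close>, the rows from
  \<open>N\<close> on contain no entry below \<open>N\<close>.\<close>

lemma entries_below_interlacing:
  assumes T: "T \<in> ssyt lam (Suc N)" and lam: "antimono lam" 
  shows "entries_below lam N T \<in> interlacing lam N"
  unfolding interlacing_def
proof (intro CollectI conjI allI impI)
  fix i
  show "entries_below lam N T i \<le> lam i"
    using less_entries_below_iff[OF T, of "lam i" N i] by (simp add: not_less)
  show "lam (Suc i) \<le> entries_below lam N T i"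
  proof (rule ccontr)
    assume "\<not> ?thesis"
    then have *: "entries_below lam N T i < lam (Suc i)" (is "?j < _") by simp
    have "lam (Suc i) \<le> lam i" using lam by (simp add: antimono_def)
    then have "T (i, ?j) \<ge> N" using less_entries_below_iff[OF T, of ?j N i] * by simp
    moreover have "T (i, ?j) < T (Suc i, ?j)" using * by (intro ssytD(3)[OF T]) auto
    moreover have "T (Suc i, ?j) < Suc N" using * by (intro ssytD(1)[OF T])
    ultimately show False by simp
  qed
next
  fix i assume "N \<le> i"
  show "entries_below lam N T i = 0"
  proof (rule ccontr)
    assume "entries_below lam N T i \<noteq> 0"
    then have "0 < lam i" "T (i, 0) < N" using less_entries_below_iff[OF T, of 0 N i] by auto
    then show False using ssyt_row_le[OF T lam, of 0 i] \<open>N \<le> i\<close> by simp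
  qed
qed

lemma interlacingD:
  assumes "nu \<in> interlacing lam N" "antimono lam"
  shows "nu i \<le> lam i" and "i < N \<Longrightarrow> lam (Suc i) \<le> nu i" and "N \<le> i \<Longrightarrow> nu i = 0" and "antimono nu"
proof -
  show *: "i < N \<Longrightarrow> lam (Suc i) \<le> nu i" "N \<le> i \<Longrightarrow> nu i = 0" for i
    using assms by (auto simp: interlacing_def)
  show **: "nu i \<le> lam i" for i
    using assms(1) by (cases "i < N") (auto simp: interlacing_def not_less)
  show "antimono nu"
    unfolding decseq_Suc_iff
  proof
    fix i
    show "nu (Suc i) \<le> nu i"
      using *[of i] *(2)[of "Suc i"] **[of "Suc i"] by (cases "i < N") auto
  qed
qed

text \<open>Deleting the boxes with entry \<open>N\<close> is a bijection from tableaux of shape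
  \<open>lam\<close> to pairs of an interlacing shape and a tableau of that shape. Deleted boxes
  have exponent 0, and each remaining box loses one from its exponent, which accounts for the
  product of the \<open>q ^ nu i\<close>.\<close>

lemma ssyt_gf_branching:
  assumes lam: "antimono lam" "\<And>i. i \<ge> Suc N \<Longrightarrow> lam i = 0"
  shows "ssyt_gf q lam (Suc N) =
    (\<Sum>nu\<in>interlacing lam N. (\<Prod>i<N. q ^ nu i) * ssyt_gf q nu N)"
proof -
  let ?Y = "young_diagram"
  \<comment> \<open>The inverse of the restriction: the boxes of \<open>lam\<close> outside
    \<open>nu\<close> receive the largest entry, and \<open>undefined\<close> outside
    \<open>lam\<close> keeps the function extensional.\<close>
  let ?ext = "\<lambda>nu T (u :: nat \<times> nat). if u \<in> ?Y nu then T u else if u \<in> ?Y lam then N else undefined :: nat"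
  have fin: "finite (?Y lam)"
    using young_diagram_eq_Sigma[OF lam(2)] by simp
  have fin_int: "finite (interlacing lam N)"
  proof (rule finite_subset)
    show "interlacing lam N \<subseteq> (\<lambda>f i. if i < N then f i else 0) ` ({..<N} \<rightarrow>\<^sub>E {..lam 0})"
    proof
      fix nu assume nu: "nu \<in> interlacing lam N"
      have "nu = (\<lambda>i. if i < N then restrict nu {..<N} i else 0)"
        using interlacingD(3)[OF nu lam(1)] by (auto simp: fun_eq_iff)
      moreover have "nu i \<le> lam 0" for i
        using interlacingD(1)[OF nu lam(1), of i] antimonoD[OF lam(1), of 0 i] by simp
      then have "restrict nu {..<N} \<in> {..<N} \<rightarrow>\<^sub>E {..lam 0}" by auto
      ultimately show "nu \<in> (\<lambda>f i. if i < N then f i else 0) ` ({..<N} \<rightarrow>\<^sub>E {..lam 0})" by blast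
    qed
  qed (auto intro!: finite_PiE)
  have ext_ssyt: "?ext nu T \<in> ssyt lam (Suc N)" "entries_below lam N (?ext nu T) = nu"
    "restrict (?ext nu T) (?Y nu) = T"
    if nu: "nu \<in> interlacing lam N" and T: "T \<in> ssyt nu N" for nu T
  proof -
    note nuD = interlacingD[OF nu lam(1)]
    have col: "j < nu i" if "i < i'" "j < lam i'" for i i' j
    proof -
      have "lam i' \<le> lam (Suc i)" using that lam(1) by (simp add: antimono_def)
      moreover have "i < N" using lam(2)[of i'] that by (cases "i' \<ge> Suc N") auto
      ultimately show ?thesis using nuD(2)[of i] that by simp
    qed
    have le: "j < lam i" if "j < nu i" for i j using nuD(1)[of i] that by simp
    have "?ext nu T \<in> ?Y lam \<rightarrow>\<^sub>E {..<Suc N}"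
      using ssytD(1)[OF T] le by (fastforce simp: PiE_iff extensional_def)
    moreover have "?ext nu T (i, j) \<le> ?ext nu T (i, j')" if "j \<le> j'" "j' < lam i" for i j j'
      using that ssytD(1)[OF T, of j i] ssytD(2)[OF T, of j j' i] by auto
    moreover have "?ext nu T (i, j) < ?ext nu T (i', j)" if "i < i'" "j < lam i'" for i i' j
      using that ssytD(1)[OF T, of j i] ssytD(3)[OF T, of i i' j] col[OF that] by auto
    ultimately show S: "?ext nu T \<in> ssyt lam (Suc N)" unfolding ssyt_def by blast
    show "entries_below lam N (?ext nu T) = nu"
    proof
      fix i
      have "{j. j < lam i \<and> ?ext nu T (i, j) < N} = {..<nu i}"
        using ssytD(1)[OF T, of _ i] nuD(1)[of i] by auto
      then show "entries_below lam N (?ext nu T) i = nu i" by (simp add: entries_below_def)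
    qed
    show "restrict (?ext nu T) (?Y nu) = T"
      using ssytD(4)[OF T] by (auto simp: fun_eq_iff)
  qed
  have res: "restrict T (?Y (entries_below lam N T)) \<in> ssyt (entries_below lam N T) N"
    "?ext (entries_below lam N T) (restrict T (?Y (entries_below lam N T))) = T"
    if T: "T \<in> ssyt lam (Suc N)" for T
  proof -
    note b = less_entries_below_iff[OF T]
    show "restrict T (?Y (entries_below lam N T)) \<in> ssyt (entries_below lam N T) N"
      unfolding ssyt_def
    proof (intro CollectI conjI allI impI)
      let ?nu = "entries_below lam N T"
      note nu = entries_below_interlacing[OF T lam(1), THEN interlacingD(4), OF lam(1)]
      show "restrict T (?Y ?nu) \<in> ?Y ?nu \<rightarrow>\<^sub>E {..<N}"
        by (auto simp: b)
      show "restrict T (?Y ?nu) (i, j) \<le> restrict T (?Y ?nu) (i, j')" if "j \<le> j'" "j' < ?nu i" for i j j'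
        using that ssytD(2)[OF T, of j j' i] by (auto simp: b)
      show "restrict T (?Y ?nu) (i, j) < restrict T (?Y ?nu) (i', j)" if "i < i'" "j < ?nu i'" for i i' j
      proof -
        have "j < ?nu i" using antimonoD[OF nu, of i i'] that by simp
        then show ?thesis using that ssytD(3)[OF T, of i i' j] by (auto simp: b)
      qed
    qed
    show "?ext (entries_below lam N T) (restrict T (?Y (entries_below lam N T))) = T"
    proof
      fix u :: "nat \<times> nat"
      obtain i j where u: "u = (i, j)" by (cases u)
      show "?ext (entries_below lam N T) (restrict T (?Y (entries_below lam N T))) u = T u"
        using ssytD(1,4)[OF T, of j i] by (auto simp: u b)
    qed
  qed
  have wt: "(\<Prod>u\<in>?Y lam. q ^ (Suc N - 1 - T u)) =
     (\<Prod>i<N. q ^ nu i) * (\<Prod>u\<in>?Y nu. q ^ (N - 1 - restrict T (?Y nu) u))"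
    if T: "T \<in> ssyt lam (Suc N)" and nu: "nu = entries_below lam N T" for T nu
  proof -
    note b = less_entries_below_iff[OF T]
    have sub: "?Y nu \<subseteq> ?Y lam" by (auto simp: nu b)
    have "(\<Prod>u\<in>?Y lam. q ^ (Suc N - 1 - T u)) = (\<Prod>u\<in>?Y nu. q ^ (Suc N - 1 - T u))"
    proof (rule prod.mono_neutral_right[OF fin sub], safe)
      fix i j assume "(i, j) \<in> ?Y lam" "(i, j) \<notin> ?Y nu"
      then have "T (i, j) = N" using ssytD(1)[OF T, of j i] by (auto simp: nu b)
      then show "q ^ (Suc N - 1 - T (i, j)) = 1" by simp
    qed
    also have "\<dots> = (\<Prod>u\<in>?Y nu. q * q ^ (N - 1 - restrict T (?Y nu) u))"
    proof (rule prod.cong[OF refl])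
      fix u assume "u \<in> ?Y nu"
      then have "T u < N" by (cases u) (auto simp: nu b)
      then have "Suc N - 1 - T u = Suc (N - 1 - T u)" by simp
      then show "q ^ (Suc N - 1 - T u) = q * q ^ (N - 1 - restrict T (?Y nu) u)"
        using \<open>u \<in> ?Y nu\<close> by (simp only: restrict_apply' power_Suc)
    qed
    also have "\<dots> = (\<Prod>i<N. q ^ nu i) * (\<Prod>u\<in>?Y nu. q ^ (N - 1 - restrict T (?Y nu) u))"
    proof -
      have "?Y nu = (SIGMA i:{..<N}. {..<nu i})"
        using interlacingD(3)[OF entries_below_interlacing[OF T lam(1)] lam(1)]
        by (intro young_diagram_eq_Sigma) (auto simp: nu)
      then show ?thesis by (simp add: prod.distrib prod.Sigma[symmetric] power_sum)
    qed
    finally show ?thesis .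
  qed
  have "(\<Sum>nu\<in>interlacing lam N. (\<Prod>i<N. q ^ nu i) * ssyt_gf q nu N) =
      (\<Sum>(nu, T)\<in>Sigma (interlacing lam N) (\<lambda>nu. ssyt nu N). (\<Prod>i<N. q ^ nu i) * (\<Prod>u\<in>?Y nu. q ^ (N - 1 - T u)))"
    unfolding ssyt_gf_def sum_distrib_left
  proof (rule sum.Sigma[OF fin_int])
    show "\<forall>nu\<in>interlacing lam N. finite (ssyt nu N)"
      by (intro ballI finite_ssyt[where N = N] interlacingD(3)[OF _ lam(1)])
  qed
  also have "\<dots> = (\<Sum>T\<in>ssyt lam (Suc N). \<Prod>u\<in>?Y lam. q ^ (Suc N - 1 - T u))"
  proof (rule sum.reindex_bij_witness[where
        j = "\<lambda>(nu, T). ?ext nu T" and i = "\<lambda>T. (entries_below lam N T, restrict T (?Y (entries_below lam N T)))"], goal_cases)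
    case (1 a)
    then obtain nu T where a: "a = (nu, T)" "nu \<in> interlacing lam N" "T \<in> ssyt nu N" by blast
    show ?case unfolding a(1) prod.case ext_ssyt(2,3)[OF a(2,3)] ..
  next
    case (2 a)
    then obtain nu T where a: "a = (nu, T)" "nu \<in> interlacing lam N" "T \<in> ssyt nu N" by blast
    show ?case unfolding a(1) prod.case by (rule ext_ssyt(1)[OF a(2,3)])
  next
    case (3 T)
    show ?case unfolding prod.case by (rule res(2)[OF 3])
  next
    case (4 T)
    show ?case by (intro SigmaI res(1)[OF 4] entries_below_interlacing[OF 4 lam(1)])
  next
    case (5 a)
    then obtain nu T where a: "a = (nu, T)" "nu \<in> interlacing lam N" "T \<in> ssyt nu N" by blast
    show ?case unfolding a(1) prod.case
      by (subst wt[OF ext_ssyt(1)[OF a(2,3)] ext_ssyt(2)[OF a(2,3), symmetric]])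
         (simp only: ext_ssyt(3)[OF a(2,3)])
  qed
  finally show ?thesis by (simp add: ssyt_gf_def)
qed

lemma vandermonde_Suc: "vandermonde (Suc n) y = vandermonde n y * (\<Prod>i<n. y i - y n)"
  by (simp add: vandermonde_def)

lemma vandermonde_cong: "(\<And>i. i < n \<Longrightarrow> y i = z i) \<Longrightarrow> vandermonde n y = vandermonde n z"
  by (auto simp: vandermonde_def intro!: prod.cong arg_cong2[where f = "(-)"])

text \<open>The bialternant formula at powers of \<open>q\<close>, with denominators cleared. The
  induction compares two recursions: tableaux branch over interlacing shapes, and Vandermonde
  products satisfy the same recursion after the shift \<open>m i = nu i + N - 1 - i\<close>.\<close>

lemma ssyt_gf_vandermonde:
  fixes q :: "'a :: idom"
  assumes "antimono lam" "\<And>i. i \<ge> N \<Longrightarrow> lam i = 0"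
  shows "ssyt_gf q lam N * vandermonde N (\<lambda>i. q ^ (N - 1 - i)) = vandermonde N (\<lambda>i. q ^ (lam i + N - 1 - i))"
  using assms
proof (induction N arbitrary: lam)
  case 0
  then have "lam = (\<lambda>_. 0)" by auto
  moreover from this have "young_diagram lam = {}" by auto
  ultimately show ?case by (simp add: ssyt_gf_def ssyt_def vandermonde_def)
next
  case (Suc N)
  let ?l = "\<lambda>i. lam i + N - i"
  let ?e = "\<Sum>j<N. j"
  have lam_Suc: "lam (Suc i) \<le> lam i" for i
    using Suc.prems(1) by (simp add: antimono_def)
  \<comment> \<open>The last variable is \<open>q ^ 0 = 1\<close>, and the others are
    \<open>q\<close> times the variables for \<open>N\<close>.\<close>
  have v: "vandermonde (Suc N) (\<lambda>i. q ^ (N - i)) = q ^ ?e * vandermonde N (\<lambda>i. q ^ (N - 1 - i)) * (\<Prod>k<N. q ^ Suc k - 1)"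
  proof -
    have "vandermonde N (\<lambda>i. q ^ (N - i)) = vandermonde N (\<lambda>i. q * q ^ (N - 1 - i))"
      by (rule vandermonde_cong) (simp flip: power_Suc add: Suc_diff_Suc)
    moreover have "(\<Prod>i<N. q ^ (N - i) - 1) = (\<Prod>k<N. q ^ Suc k - 1)"
      by (rule prod.reindex_bij_witness[where i = "\<lambda>k. N - Suc k" and j = "\<lambda>k. N - Suc k"])
         (auto simp: Suc_diff_Suc simp del: power_Suc)
    ultimately show ?thesis
      by (simp add: vandermonde_Suc vandermonde_scale del: power_Suc)
  qed
  have step: "(\<Prod>i<N. q ^ nu i) * (q ^ ?e * (ssyt_gf q nu N * vandermonde N (\<lambda>i. q ^ (N - 1 - i)))) =
      (\<Prod>i<N. q ^ (nu i + N - 1 - i)) * vandermonde N (\<lambda>i. q ^ (nu i + N - 1 - i))"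
    if nu: "nu \<in> interlacing lam N" for nu
  proof -
    note nuD = interlacingD[OF nu Suc.prems(1)]
    have "(\<Sum>i<N. N - 1 - i) = ?e"
      by (rule sum.reindex_bij_witness[where i = "\<lambda>k. N - Suc k" and j = "\<lambda>k. N - Suc k"]) auto
    then have "(\<Prod>i<N. q ^ nu i) * q ^ ?e = (\<Prod>i<N. q ^ nu i) * (\<Prod>i<N. q ^ (N - 1 - i))"
      by (simp flip: power_sum)
    also have "\<dots> = (\<Prod>i<N. q ^ (nu i + N - 1 - i))"
      unfolding prod.distrib[symmetric] by (intro prod.cong) (auto simp flip: power_add)
    finally have "(\<Prod>i<N. q ^ nu i) * q ^ ?e = (\<Prod>i<N. q ^ (nu i + N - 1 - i))" .
    then show ?thesis
      using Suc.IH[OF nuD(4) nuD(3)] by (simp add: mult.assoc[symmetric])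
  qed
  \<comment> \<open>The shift in \<open>?l\<close> is one larger than the shift of
    \<open>nu\<close>, so the weak inequalities \<open>lam (Suc i) \<le> nu i \<le> lam i\<close>
    become membership in half-open intervals, which is the box required for the geometric
    sums.\<close>
  have bij: "bij_betw (\<lambda>nu. restrict (\<lambda>i. nu i + N - 1 - i) {..<N}) (interlacing lam N)
     (PiE {..<N} (\<lambda>i. {?l (Suc i)..<?l i}))"
  proof (rule bij_betw_byWitness[where f' = "\<lambda>m i. if i < N then m i + Suc i - N else 0"])
    show "\<forall>nu\<in>interlacing lam N. (\<lambda>i. if i < N then restrict (\<lambda>i. nu i + N - 1 - i) {..<N} i + Suc i - N else 0) = nu"
      by (auto simp: interlacing_def fun_eq_iff)
    show "\<forall>m\<in>PiE {..<N} (\<lambda>i. {?l (Suc i)..<?l i}). restrict (\<lambda>i. (if i < N then m i + Suc i - N else 0) + N - 1 - i) {..<N} = m"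
    proof (intro ballI ext)
      fix m i assume m: "m \<in> PiE {..<N} (\<lambda>i. {?l (Suc i)..<?l i})"
      show "restrict (\<lambda>i. (if i < N then m i + Suc i - N else 0) + N - 1 - i) {..<N} i = m i"
      proof (cases "i < N")
        case True
        then have "m i \<in> {?l (Suc i)..<?l i}" using m by (auto simp: PiE_iff)
        then show ?thesis using True by auto
      qed (use m in \<open>auto simp: PiE_iff extensional_def\<close>)
    qed
    have "nu i + N - 1 - i \<in> {?l (Suc i)..<?l i}" if "i < N" "nu \<in> interlacing lam N" for nu i
    proof -
      have "lam (Suc i) \<le> nu i" "nu i \<le> lam i" using that by (auto simp: interlacing_def)
      then show ?thesis using that(1) by auto
    qed
    then show "(\<lambda>nu. restrict (\<lambda>i. nu i + N - 1 - i) {..<N}) ` interlacing lam N \<subseteq> PiE {..<N} (\<lambda>i. {?l (Suc i)..<?l i})"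
      by (intro image_subsetI) (simp only: restrict_PiE_iff lessThan_iff Ball_def, blast)
    show "(\<lambda>m i. if i < N then m i + Suc i - N else 0) ` (PiE {..<N} (\<lambda>i. {?l (Suc i)..<?l i})) \<subseteq> interlacing lam N"
    proof safe
      fix m assume m: "m \<in> PiE {..<N} (\<lambda>i. {?l (Suc i)..<?l i})"
      have "lam (Suc i) \<le> m i + Suc i - N \<and> m i + Suc i - N \<le> lam i" if "i < N" for i
      proof -
        have "m i \<in> {?l (Suc i)..<?l i}" using m that by (auto simp: PiE_iff)
        then show ?thesis using that by auto
      qed
      then show "(\<lambda>i. if i < N then m i + Suc i - N else 0) \<in> interlacing lam N"
        by (auto simp: interlacing_def)
    qed
  qed
  have "ssyt_gf q lam (Suc N) * vandermonde (Suc N) (\<lambda>i. q ^ (N - i)) =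
     (\<Prod>k<N. q ^ Suc k - 1) * (\<Sum>nu\<in>interlacing lam N.
        (\<Prod>i<N. q ^ nu i) * (q ^ ?e * (ssyt_gf q nu N * vandermonde N (\<lambda>i. q ^ (N - 1 - i)))))"
    unfolding v by (subst ssyt_gf_branching[OF Suc.prems]) (simp_all add: sum_distrib_left sum_distrib_right ac_simps)
  also have "\<dots> = (\<Prod>k<N. q ^ Suc k - 1) * (\<Sum>nu\<in>interlacing lam N.
       (\<Prod>i<N. q ^ (nu i + N - 1 - i)) * vandermonde N (\<lambda>i. q ^ (nu i + N - 1 - i)))"
    by (intro arg_cong2[where f = "(*)"] sum.cong refl step)
  also have "\<dots> = (\<Prod>k<N. q ^ Suc k - 1) * (\<Sum>m\<in>PiE {..<N} (\<lambda>i. {?l (Suc i)..<?l i}).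
       (\<Prod>i<N. q ^ m i) * vandermonde N (\<lambda>i. q ^ m i))"
    by (subst sum.reindex_bij_betw[OF bij, symmetric])
       (auto intro!: arg_cong2[where f = "(*)"] sum.cong vandermonde_cong)
  also have "\<dots> = vandermonde (Suc N) (\<lambda>i. q ^ ?l i)"
  proof (rule vandermonde_interlacing_sum)
    fix i assume "i < N"
    then show "?l (Suc i) \<le> ?l i" using lam_Suc[of i] by linarith
  qed
  finally show ?case by simp
qed

section \<open>The polynomials \<open>[a]_q\<close>\<close>

lemma qint_0 [simp]: "qint 0 = 0"
  and qint_Suc: "qint (Suc a) = qint a + monom 1 a"
  by (auto simp: qint_def)

lemma qint_mult: "(monom 1 1 - 1) * qint a = monom 1 1 ^ a - (1 :: rat poly)"
  by (induction a) (auto simp: qint_Suc algebra_simps monom_power mult_monom)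

lemma coeff_qint: "coeff (qint a) k = (if k < a then 1 else 0)"
  by (simp add: qint_def coeff_sum)

lemma qint_eq_0_iff [simp]: "qint a = 0 \<longleftrightarrow> a = 0"
  using coeff_qint[of a 0] by (auto simp: poly_eq_iff coeff_qint)

lemma degree_qint: "degree (qint a) = a - 1"
proof (cases a)
  case (Suc n)
  have "degree (qint a) \<le> n" by (rule degree_le) (auto simp: coeff_qint Suc)
  moreover have "n \<le> degree (qint a)" by (rule le_degree) (auto simp: coeff_qint Suc)
  ultimately show ?thesis using Suc by simp
qed simp

section \<open>Hook lengths and contents\<close>

lemma partition_eq_0_iff:
  assumes "is_partition lam"
  shows "lam i = 0 \<longleftrightarrow> part_length lam \<le> i"
proof -
  have "{i. lam i \<noteq> 0} = {..<part_length lam}"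
    unfolding part_length_def
  proof (rule down_closed_eq_lessThan)
    show "a \<in> {i. lam i \<noteq> 0}" if "b \<in> {i. lam i \<noteq> 0}" "a \<le> b" for a b
      using assms that antimonoD[of lam a b] by (auto simp: is_partition_def)
  qed (use assms in \<open>simp add: is_partition_def\<close>)
  then have "i \<in> {i. lam i \<noteq> 0} \<longleftrightarrow> i \<in> {..<part_length lam}" by blast
  then show ?thesis by auto
qed

lemma part_size_eq_sum:
  assumes "is_partition lam" "part_length lam \<le> N"
  shows "part_size lam = (\<Sum>i<N. lam i)"
  unfolding part_size_def using assms partition_eq_0_iff[OF assms(1)]
  by (intro sum.mono_neutral_left) auto

definition conj_part :: "(nat \<Rightarrow> nat) \<Rightarrow> nat \<Rightarrow> nat" where
  "conj_part lam j = card {i. j < lam i}"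

lemma less_conj_part_iff:
  assumes "is_partition lam"
  shows "i < conj_part lam j \<longleftrightarrow> j < lam i"
proof -
  have "{i. j < lam i} = {..<conj_part lam j}"
    unfolding conj_part_def
  proof (rule down_closed_eq_lessThan)
    show "finite {i. j < lam i}"
      by (rule finite_subset[of _ "{i. lam i \<noteq> 0}"]) (use assms in \<open>auto simp: is_partition_def\<close>)
    show "a \<in> {i. j < lam i}" if "b \<in> {i. j < lam i}" "a \<le> b" for a b
      using assms that antimonoD[of lam a b] by (auto simp: is_partition_def)
  qed
  then have "i \<in> {i. j < lam i} \<longleftrightarrow> i \<in> {..<conj_part lam j}" by blast
  then show ?thesis by auto
qed

lemma hook_length_eq:
  assumes "is_partition lam" "j < lam i"
  shows "hook_length lam (i, j) = lam i - j + (conj_part lam j - Suc i)"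
proof -
  note c = less_conj_part_iff[OF assms(1)]
  have "{v \<in> young_diagram lam. (fst v = i \<and> j \<le> snd v) \<or> (snd v = j \<and> i \<le> fst v)} =
      Pair i ` {j..<lam i} \<union> (\<lambda>i'. (i', j)) ` {Suc i..<conj_part lam j}" (is "?S = ?A \<union> ?B")
    using assms(2) by (force simp: young_diagram_def c Suc_le_eq le_less)
  moreover have "card (?A \<union> ?B) = card ?A + card ?B"
    by (rule card_Un_disjoint) auto
  moreover have "card ?A = lam i - j" "card ?B = conj_part lam j - Suc i"
    by (simp_all add: card_image inj_on_def)
  ultimately show ?thesis by (simp add: hook_length_def)
qed

context
  fixes lam :: "nat \<Rightarrow> nat" and N :: nat
  assumes lam: "is_partition lam" and len: "part_length lam \<le> N"
begin

lemma partition_antimono: "i \<le> k \<Longrightarrow> lam k \<le> lam i"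
  using lam by (auto simp: is_partition_def antimono_def)

lemma partition_eq_0: "N \<le> i \<Longrightarrow> lam i = 0"
  using partition_eq_0_iff[OF lam] len by auto

lemma young_diagram_Sigma: "young_diagram lam = (SIGMA i:{..<N}. {..<lam i})"
  by (rule young_diagram_eq_Sigma) (rule partition_eq_0)

text \<open>The hook lengths of row \<open>i\<close> and the differences \<open>l i - l k\<close>, where \<open>l i = lam i + N - 1 - i\<close>,
  together exhaust \<open>{1..l i}\<close>.\<close>

lemma row_hook_product:
  fixes f :: "nat \<Rightarrow> 'a :: comm_monoid_mult"
  assumes "i < N"
  shows "(\<Prod>j<lam i. f (hook_length lam (i, j))) *
      (\<Prod>k\<in>{i<..<N}. f (lam i + N - 1 - i - (lam k + N - 1 - k))) = (\<Prod>m\<in>{1..lam i + N - 1 - i}. f m)"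
proof -
  define h where "h = (\<lambda>j. lam i - j + (conj_part lam j - Suc i))"
  define g where "g = (\<lambda>k. lam i + N - 1 - i - (lam k + N - 1 - k))"
  note c = less_conj_part_iff[OF lam]
  have cN: "conj_part lam j \<le> N" for j
    using c[of N j] partition_eq_0[of N] by (simp add: not_less)
  have ci: "Suc i \<le> conj_part lam j" if "j < lam i" for j using c[of i j] that by simp
  have canti: "conj_part lam j' \<le> conj_part lam j" if "j \<le> j'" for j j'
    using c[of "conj_part lam j" j'] c[of "conj_part lam j" j] that by (auto simp: not_less)
  have inj_h: "inj_on h {..<lam i}"
  proof (rule linorder_inj_onI)
    fix x y assume "x < y" "x \<in> {..<lam i}" "y \<in> {..<lam i}"
    then show "h x \<noteq> h y" using canti[of x y] ci[of y] by (auto simp: h_def)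
  qed auto
  have inj_g: "inj_on g {i<..<N}"
  proof (rule linorder_inj_onI)
    fix x y assume "x < y" "x \<in> {i<..<N}" "y \<in> {i<..<N}"
    then show "g x \<noteq> g y" using partition_antimono[of x y] partition_antimono[of i x] by (auto simp: g_def)
  qed auto
  \<comment> \<open>A common value would force \<open>conj_part lam j + lam k = j + k + 1\<close>.
    But \<open>k < conj_part lam j\<close> and \<open>j < lam k\<close> are equivalent, so the left
    side is either at least \<open>j + k + 2\<close> or at most \<open>j + k\<close>.\<close>
  have disj: "h ` {..<lam i} \<inter> g ` {i<..<N} = {}"
  proof -
    have False if *: "j < lam i" "i < k" "k < N" "h j = g k" for j k
    proof -
      have "lam k \<le> lam i" using partition_antimono * by simp
      then have "conj_part lam j + lam k = j + k + 1"
        using * ci[of j] by (simp add: h_def g_def)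
      then show False using c[of k j] by linarith
    qed
    then show ?thesis by (auto simp: disjoint_iff) metis
  qed
  \<comment> \<open>By counting: \<open>lam i\<close> hooks and \<open>N - 1 - i\<close>
    differences, all distinct, fit into an interval with \<open>lam i + N - 1 - i\<close>
    elements.\<close>
  have "h ` {..<lam i} \<union> g ` {i<..<N} = {1..lam i + N - 1 - i}"
  proof (rule card_subset_eq)
    show "h ` {..<lam i} \<union> g ` {i<..<N} \<subseteq> {1..lam i + N - 1 - i}"
    proof safe
      fix j assume "j < lam i"
      then show "h j \<in> {1..lam i + N - 1 - i}" using cN[of j] ci[of j] unfolding h_def atLeastAtMost_iff by linarith
    next
      fix k assume "k \<in> {i<..<N}"
      then show "g k \<in> {1..lam i + N - 1 - i}" using partition_antimono[of i k] by (auto simp: g_def)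
    qed
    show "card (h ` {..<lam i} \<union> g ` {i<..<N}) = card {1..lam i + N - 1 - i}"
      using assms by (subst card_Un_disjoint[OF _ _ disj]) (auto simp: card_image[OF inj_h] card_image[OF inj_g])
  qed auto
  then have "(\<Prod>m\<in>{1..lam i + N - 1 - i}. f m) = (\<Prod>m\<in>h ` {..<lam i} \<union> g ` {i<..<N}. f m)" by simp
  also have "\<dots> = (\<Prod>j<lam i. f (h j)) * (\<Prod>k\<in>{i<..<N}. f (g k))"
    by (subst prod.union_disjoint[OF _ _ disj]) (auto simp: prod.reindex[OF inj_h] prod.reindex[OF inj_g])
  also have "(\<Prod>j<lam i. f (h j)) = (\<Prod>j<lam i. f (hook_length lam (i, j)))"
    by (intro prod.cong) (auto simp: hook_length_eq[OF lam] h_def)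
  finally show ?thesis by (simp add: g_def)
qed

text \<open>The counterpart of the hook identity with the same right-hand side: for
  \<open>N = d + 1\<close> the numbers \<open>N + j - i\<close> are the shifted contents of row
  \<open>i\<close>, and the differences \<open>k - i\<close> fill the gap below them.\<close>

lemma row_content_product:
  fixes f :: "nat \<Rightarrow> 'a :: comm_monoid_mult"
  assumes "i < N"
  shows "(\<Prod>j<lam i. f (N + j - i)) * (\<Prod>k\<in>{i<..<N}. f (k - i)) = (\<Prod>m\<in>{1..lam i + N - 1 - i}. f m)"
proof -
  let ?A = "(\<lambda>j. N + j - i) ` {..<lam i}" and ?B = "(\<lambda>k. k - i) ` {i<..<N}"
  have "{1..lam i + N - 1 - i} = ?A \<union> ?B"
  proof safe
    fix m assume m: "m \<in> {1..lam i + N - 1 - i}" "m \<notin> ?B"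
    then have "\<not> m + i < N" by (force intro: image_eqI[where x = "m + i"])
    with m(1) show "m \<in> ?A" using assms by (intro image_eqI[where x = "m + i - N"]) auto
  qed (use assms in auto)
  moreover have "?A \<inter> ?B = {}" using assms by auto
  moreover have "inj_on (\<lambda>j. N + j - i) {..<lam i}" "inj_on (\<lambda>k. k - i) {i<..<N}"
    using assms by (auto simp: inj_on_def)
  ultimately show ?thesis by (simp add: prod.union_disjoint prod.reindex)
qed

text \<open>Row by row both sides are the product of \<open>[m]_q\<close> over
  \<open>1 \<le> m \<le> lam i + N - 1 - i\<close>. This is the bridge between the quotient of
  Vandermonde products and the hook-content quotient.\<close>

lemma content_hook_identity:
  assumes "N = d + 1"
  shows "content_poly d lam * (\<Prod>i<N. \<Prod>k\<in>{i<..<N}. qint (k - i)) =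
    hook_poly lam * (\<Prod>i<N. \<Prod>k\<in>{i<..<N}. qint (lam i + N - 1 - i - (lam k + N - 1 - k)))"
proof -
  have "content_poly d lam = (\<Prod>i<N. \<Prod>j<lam i. qint (N + j - i))"
    unfolding content_poly_def young_diagram_Sigma
    by (subst prod.Sigma, simp, simp, intro prod.cong) (auto simp: box_content_def assms intro!: arg_cong[where f = qint])
  moreover have "hook_poly lam = (\<Prod>i<N. \<Prod>j<lam i. qint (hook_length lam (i, j)))"
    unfolding hook_poly_def young_diagram_Sigma by (subst prod.Sigma) auto
  ultimately show ?thesis
    by (simp only: prod.distrib[symmetric]) (intro prod.cong refl, simp only: row_hook_product row_content_product lessThan_iff)
qed

end

lemma prod_triangle_swap:
  fixes f :: "nat \<Rightarrow> nat \<Rightarrow> 'a :: comm_monoid_mult"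
  shows "(\<Prod>j<N. \<Prod>i<j. f i j) = (\<Prod>i<N. \<Prod>j\<in>{i<..<N}. f i j)"
proof -
  have "(\<Prod>j<N. \<Prod>i<j. f i j) = (\<Prod>(j, i)\<in>(SIGMA j:{..<N}. {..<j}). f i j)"
    by (rule prod.Sigma) auto
  also have "\<dots> = (\<Prod>(i, j)\<in>(SIGMA i:{..<N}. {i<..<N}). f i j)"
    by (rule prod.reindex_bij_witness[where i = prod.swap and j = prod.swap]) auto
  also have "\<dots> = (\<Prod>i<N. \<Prod>j\<in>{i<..<N}. f i j)"
    by (rule prod.Sigma[symmetric]) auto
  finally show ?thesis .
qed

lemma coeff_hook_poly_0: "coeff (hook_poly lam) 0 = 1" if "is_partition lam"
proof -
  have "coeff (qint (hook_length lam u)) 0 = 1" if "u \<in> young_diagram lam" for u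
    using that hook_length_eq[OF \<open>is_partition lam\<close>, of "snd u" "fst u"]
    by (cases u) (auto simp: coeff_qint)
  then show ?thesis
    by (simp add: hook_poly_def poly_0_coeff_0[symmetric] poly_prod)
qed

text \<open>Each difference \<open>q ^ l i - q ^ l j\<close> equals
  \<open>q ^ l j * (q - 1) * [l i - l j]_q\<close>. The power of \<open>q - 1\<close> depends on
  \<open>N\<close> alone and hence cancels between two such products.\<close>

lemma vandermonde_powers:
  assumes "\<And>i j. i < j \<Longrightarrow> j < N \<Longrightarrow> l j \<le> l i"
  shows "vandermonde N (\<lambda>i. monom 1 1 ^ l i) =
    monom 1 (\<Sum>j<N. j * l j) * (\<Prod>j<N. \<Prod>i<j. monom 1 1 - 1) * (\<Prod>i<N. \<Prod>k\<in>{i<..<N}. qint (l i - l k))"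
proof -
  let ?q = "monom 1 1 :: rat poly"
  have "vandermonde N (\<lambda>i. ?q ^ l i) = (\<Prod>j<N. \<Prod>i<j. ?q ^ l j * (?q - 1) * qint (l i - l j))"
    unfolding vandermonde_def
  proof (intro prod.cong refl)
    fix j i assume "j \<in> {..<N}" "i \<in> {..<j}"
    then have "l j \<le> l i" using assms by simp
    then have "?q ^ l i = ?q ^ l j * ?q ^ (l i - l j)" by (simp flip: power_add)
    moreover have "?q ^ l j * (?q - 1) * qint (l i - l j) = ?q ^ l j * (?q ^ (l i - l j) - 1)"
      by (simp only: mult.assoc qint_mult)
    ultimately show "?q ^ l i - ?q ^ l j = ?q ^ l j * (?q - 1) * qint (l i - l j)"
      by (simp add: right_diff_distrib)
  qed
  also have "\<dots> = (\<Prod>j<N. \<Prod>i<j. ?q ^ l j) * (\<Prod>j<N. \<Prod>i<j. ?q - 1) * (\<Prod>j<N. \<Prod>i<j. qint (l i - l j))"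
    by (simp only: prod.distrib)
  also have "(\<Prod>j<N. \<Prod>i<j. ?q ^ l j) = ?q ^ (\<Sum>j<N. j * l j)"
    by (simp add: power_sum power_mult[symmetric] ac_simps)
  also have "(\<Prod>j<N. \<Prod>i<j. qint (l i - l j)) = (\<Prod>i<N. \<Prod>k\<in>{i<..<N}. qint (l i - l k))"
    by (rule prod_triangle_swap)
  finally show ?thesis by (simp add: monom_power)
qed

text \<open>The powers of \<open>q - 1\<close> and the exponent \<open>?e\<close> of the denominator
  cancel in the bialternant formula. What remains of the exponent is \<open>n(lam)\<close>, the sum
  of the \<open>j * lam j\<close>.\<close>

lemma ssyt_gf_product:
  assumes lam: "is_partition lam" "part_length lam \<le> N"
  shows "ssyt_gf (monom 1 1) lam N * (\<Prod>i<N. \<Prod>k\<in>{i<..<N}. qint (k - i)) =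
    monom 1 (\<Sum>j<N. j * lam j) * (\<Prod>i<N. \<Prod>k\<in>{i<..<N}. qint (lam i + N - 1 - i - (lam k + N - 1 - k)))"
proof -
  let ?S = "ssyt_gf (monom 1 1 :: rat poly) lam N" and ?Q = "\<Prod>j<N. \<Prod>i<j. monom 1 1 - (1 :: rat poly)"
  let ?e = "\<Sum>j<N. j * (N - 1 - j)" and ?A = "\<Prod>i<N. \<Prod>k\<in>{i<..<N}. qint (k - i)"
    and ?B = "\<Prod>i<N. \<Prod>k\<in>{i<..<N}. qint (lam i + N - 1 - i - (lam k + N - 1 - k))"
  have anti: "antimono lam" using lam by (simp add: is_partition_def)
  have "?S * vandermonde N (\<lambda>i. monom 1 1 ^ (N - 1 - i)) = vandermonde N (\<lambda>i. monom 1 1 ^ (lam i + N - 1 - i))"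
    by (rule ssyt_gf_vandermonde) (use anti partition_eq_0[OF lam] in auto)
  moreover have "vandermonde N (\<lambda>i. monom 1 1 ^ (N - 1 - i)) =
      monom 1 ?e * ?Q * ?A"
    by (subst vandermonde_powers) (auto intro!: prod.cong arg_cong[where f = qint] arg_cong2[where f = "(*)"])
  moreover have "(\<Sum>j<N. j * (lam j + N - 1 - j)) = (\<Sum>j<N. j * lam j) + ?e"
  proof -
    have "j * (lam j + N - 1 - j) = j * lam j + j * (N - 1 - j)" if "j < N" for j
    proof -
      have "lam j + N - 1 - j = lam j + (N - 1 - j)" using that by simp
      then show ?thesis by (simp add: algebra_simps)
    qed
    then show ?thesis by (simp add: sum.distrib)
  qed
  moreover have "vandermonde N (\<lambda>i. monom 1 1 ^ (lam i + N - 1 - i)) =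
      monom 1 (\<Sum>j<N. j * (lam j + N - 1 - j)) * ?Q * ?B"
  proof (rule vandermonde_powers)
    fix i j assume "i < j" "j < N"
    then show "lam j + N - 1 - j \<le> lam i + N - 1 - i" using antimonoD[OF anti, of i j] by linarith
  qed
  moreover have "monom 1 ((\<Sum>j<N. j * lam j) + ?e) = monom 1 (\<Sum>j<N. j * lam j) * (monom 1 ?e :: rat poly)"
    by (simp add: mult_monom)
  ultimately have "(monom 1 ?e * ?Q) * (?S * ?A) = (monom 1 ?e * ?Q) * (monom 1 (\<Sum>j<N. j * lam j) * ?B)"
    by (simp only: ac_simps)
  moreover have "coeff (monom 1 1 - (1 :: rat poly)) 1 \<noteq> 0" by simp
  then have "monom 1 1 - (1 :: rat poly) \<noteq> 0" by (metis coeff_0)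
  then have "monom 1 ?e * ?Q \<noteq> 0" by simp
  ultimately show ?thesis by (simp only: mult_cancel_left) simp
qed

text \<open>A nonzero constant term makes \<open>H\<close> prime to the monomial. Applied to the
  hook polynomial, whose constant term is 1, this splits \<open>q ^ n(lam)\<close> off the
  generating function.\<close>

lemma monom_dvd_cancel:
  fixes S H :: "'a :: field poly"
  assumes "monom 1 n dvd S * H" "coeff H 0 \<noteq> 0"
  shows "monom 1 n dvd S"
proof -
  have "coeff S k = 0" if "k < n" for k
    using that
  proof (induction k rule: less_induct)
    case (less k)
    have "0 = coeff (S * H) k"
      using assms(1) less.prems by (simp add: monom_1_dvd_iff')
    also have "\<dots> = (\<Sum>i\<le>k. if i = k then coeff S k * coeff H 0 else 0)"
      unfolding coeff_mult using less by (intro sum.cong) auto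
    finally show ?case using assms(2) by simp
  qed
  then show ?thesis by (simp add: monom_1_dvd_iff')
qed

lemma degree_qint_triangle:
  fixes m :: "nat \<Rightarrow> nat \<Rightarrow> nat"
  assumes "\<And>i k. i < k \<Longrightarrow> k < N \<Longrightarrow> m i k > 0"
  shows "degree (\<Prod>i<N. \<Prod>k\<in>{i<..<N}. qint (m i k)) = (\<Sum>i<N. \<Sum>k\<in>{i<..<N}. m i k - 1)"
    "(\<Prod>i<N. \<Prod>k\<in>{i<..<N}. qint (m i k)) \<noteq> 0"
proof -
  have nz: "qint (m i k) \<noteq> 0" if "i < N" "k \<in> {i<..<N}" for i k
    using assms[of i k] that by auto
  then have nz': "(\<Prod>k\<in>{i<..<N}. qint (m i k)) \<noteq> 0" if "i < N" for i
    using nz[OF that] by (subst prod_zero_iff) auto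
  then show "(\<Prod>i<N. \<Prod>k\<in>{i<..<N}. qint (m i k)) \<noteq> 0"
    by (subst prod_zero_iff) auto
  show "degree (\<Prod>i<N. \<Prod>k\<in>{i<..<N}. qint (m i k)) = (\<Sum>i<N. \<Sum>k\<in>{i<..<N}. m i k - 1)"
    using nz nz' by (simp add: degree_prod_eq_sum_degree degree_qint)
qed

text \<open>In the sum over pairs, \<open>lam i\<close> occurs \<open>d - i\<close> times with a
  plus sign and \<open>i\<close> times with a minus sign, so its coefficient \<open>d - 2 i\<close>
  is completed to \<open>d\<close> by the second sum. Monotonicity makes the truncated differences
  genuine.\<close>

lemma sum_triangle_differences:
  fixes lam :: "nat \<Rightarrow> nat"
  assumes "\<And>i k. i < k \<Longrightarrow> lam k \<le> lam i"
  shows "(\<Sum>i<Suc d. \<Sum>k\<in>{i<..<Suc d}. lam i - lam k) + 2 * (\<Sum>j<Suc d. j * lam j) = (\<Sum>i<Suc d. lam i) * d"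
proof (induction d)
  case (Suc d)
  have "(\<Sum>i<Suc (Suc d). \<Sum>k\<in>{i<..<Suc (Suc d)}. lam i - lam k) =
      (\<Sum>i<Suc d. (\<Sum>k\<in>{i<..<Suc d}. lam i - lam k) + (lam i - lam (Suc d)))"
  proof -
    have "{i<..<Suc (Suc d)} = insert (Suc d) {i<..<Suc d}" if "i < Suc d" for i using that by auto
    then show ?thesis by (simp add: add.commute)
  qed
  also have "\<dots> = (\<Sum>i<Suc d. \<Sum>k\<in>{i<..<Suc d}. lam i - lam k) + (\<Sum>i<Suc d. lam i - lam (Suc d))"
    by (rule sum.distrib)
  also have "(\<Sum>i<Suc d. lam i - lam (Suc d)) = (\<Sum>i<Suc d. lam i) - Suc d * lam (Suc d)"
    by (subst sum_subtractf_nat) (use assms in auto)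
  moreover have "(\<Sum>i<Suc d. lam (Suc d)) \<le> (\<Sum>i<Suc d. lam i)"
    by (rule sum_mono) (use assms in auto)
  ultimately show ?case using Suc.IH
    by (simp add: algebra_simps)
qed simp

text \<open>Hook-content formula: the row identities replace the quotient of Vandermonde products by
  contents over hooks, which shows in particular that this quotient is a polynomial. By the degree
  equation the exponents from \<open>n\<close> to \<open>n + degree P\<close> lie symmetrically
  about half of \<open>part_size lam * d\<close>.\<close>

lemma P_frac_ssyt_gf:
  assumes lam: "is_partition lam" "part_length lam \<le> d + 1"
  obtains P :: "rat poly" and n where "ssyt_gf (monom 1 1) lam (d + 1) = monom 1 n * P"
    and "P_frac d lam = Fraction_Field.Fract P 1" and "degree P + 2 * n = part_size lam * d" and "P \<noteq> 0"
proof -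
  let ?N = "d + 1" and ?n = "\<Sum>j<d + 1. j * lam j"
  define A where "A = (\<Prod>i<?N. \<Prod>k\<in>{i<..<?N}. qint (k - i))"
  define B where "B = (\<Prod>i<?N. \<Prod>k\<in>{i<..<?N}. qint (lam i + ?N - 1 - i - (lam k + ?N - 1 - k)))"
  define S where "S = ssyt_gf (monom 1 1 :: rat poly) lam ?N"
  have anti: "lam k \<le> lam i" if "i < k" for i k
    using partition_antimono[OF lam] that by simp
  have deg_A: "degree A = (\<Sum>i<?N. \<Sum>k\<in>{i<..<?N}. k - i - 1)" and A: "A \<noteq> 0"
    unfolding A_def by (intro degree_qint_triangle; simp)+
  have pos: "lam i + ?N - 1 - i - (lam k + ?N - 1 - k) > 0" if "i < k" "k < ?N" for i k
    using anti[OF that(1)] that by simp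
  have deg_B: "degree B = (\<Sum>i<?N. \<Sum>k\<in>{i<..<?N}. lam i + ?N - 1 - i - (lam k + ?N - 1 - k) - 1)" and B: "B \<noteq> 0"
    unfolding B_def by (intro degree_qint_triangle pos; assumption)+
  have SA: "S * A = monom 1 ?n * B"
    unfolding S_def A_def B_def by (rule ssyt_gf_product[OF lam])
  have C: "content_poly d lam * A = hook_poly lam * B"
    unfolding A_def B_def by (rule content_hook_identity[OF lam refl])
  have H: "coeff (hook_poly lam) 0 \<noteq> 0" using coeff_hook_poly_0[OF lam(1)] by simp
  then have H0: "hook_poly lam \<noteq> 0" by auto
  have "(S * hook_poly lam) * A = hook_poly lam * (S * A)" by (simp only: ac_simps)
  also have "\<dots> = monom 1 ?n * (hook_poly lam * B)" unfolding SA by (simp only: ac_simps)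
  also have "\<dots> = (monom 1 ?n * content_poly d lam) * A" unfolding C[symmetric] by (simp only: ac_simps)
  finally have SH: "S * hook_poly lam = monom 1 ?n * content_poly d lam"
    using A by (simp only: mult_cancel_right) simp
  have "monom 1 ?n dvd S * hook_poly lam" unfolding SH by (rule dvd_triv_left)
  then have "monom 1 ?n dvd S" by (rule monom_dvd_cancel[OF _ H])
  then obtain P where P: "S = monom 1 ?n * P" by (rule dvdE)
  have nz: "monom 1 ?n \<noteq> (0 :: rat poly)" by simp
  have "monom 1 ?n * (P * hook_poly lam) = monom 1 ?n * content_poly d lam"
    using SH P by (simp only: mult.assoc)
  then have PH: "P * hook_poly lam = content_poly d lam"
    using nz by (simp only: mult_cancel_left) simp
  have "monom 1 ?n * (P * A) = monom 1 ?n * B" using SA P by (simp only: mult.assoc)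
  then have PA: "P * A = B" using nz by (simp only: mult_cancel_left) simp
  show ?thesis
  proof
    show "ssyt_gf (monom 1 1) lam ?N = monom 1 ?n * P" using P by (simp only: S_def)
    show "P_frac d lam = Fraction_Field.Fract P 1"
      using H0 PH by (simp add: P_frac_def eq_fract)
    show "P \<noteq> 0" using PA B by auto
    then have "degree P + degree A = degree B" using A PA by (metis degree_mult_eq)
    moreover have "degree B = (\<Sum>i<?N. \<Sum>k\<in>{i<..<?N}. (lam i - lam k) + (k - i - 1))"
      unfolding deg_B
    proof (intro sum.cong refl)
      fix i k assume "i \<in> {..<?N}" "k \<in> {i<..<?N}"
      then show "lam i + ?N - 1 - i - (lam k + ?N - 1 - k) - 1 = (lam i - lam k) + (k - i - 1)"
        using anti[of i k] by simp
    qed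
    ultimately have "degree P = (\<Sum>i<?N. \<Sum>k\<in>{i<..<?N}. lam i - lam k)"
      by (simp only: deg_A sum.distrib add_right_cancel)
    then show "degree P + 2 * ?n = part_size lam * d"
      using sum_triangle_differences[of lam d] anti by (simp add: part_size_eq_sum[OF lam])
  qed
qed

text \<open>An entry \<open>t\<close> stands for a vector of weight \<open>d - 2 t\<close> in the
  irreducible representation of dimension \<open>d + 1\<close>, so \<open>k\<close> is the total
  weight of the tableau under \<open>diag(a, 1/a)\<close>.\<close>

definition ssyt_mult :: "(nat \<Rightarrow> nat) \<Rightarrow> nat \<Rightarrow> int \<Rightarrow> nat" where
  "ssyt_mult lam d k = card {T \<in> ssyt lam (d + 1).
     int (part_size lam * d) - 2 * int (\<Sum>u\<in>young_diagram lam. T u) = k}"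

lemma card_young_diagram:
  assumes "is_partition lam"
  shows "finite (young_diagram lam)" "card (young_diagram lam) = part_size lam"
  using young_diagram_Sigma[OF assms order.refl] part_size_eq_sum[OF assms order.refl] by auto

lemma coeff_ssyt_gf:
  assumes lam: "is_partition lam" "part_length lam \<le> d + 1"
  shows "coeff (ssyt_gf (monom 1 1 :: rat poly) lam (d + 1)) m = of_nat (ssyt_mult lam d (2 * int m - int (part_size lam * d)))"
proof -
  let ?Y = "young_diagram lam"
  have fin: "finite (ssyt lam (d + 1))"
    by (rule finite_ssyt[of "d + 1"]) (rule partition_eq_0[OF lam])
  have eq: "(\<Sum>u\<in>?Y. d - T u) + (\<Sum>u\<in>?Y. T u) = part_size lam * d" if "T \<in> ssyt lam (d + 1)" for T
  proof -
    have "(\<Sum>u\<in>?Y. d - T u) + (\<Sum>u\<in>?Y. T u) = (\<Sum>u\<in>?Y. d - T u + T u)" by (simp add: sum.distrib)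
    also have "\<dots> = (\<Sum>u\<in>?Y. d)"
      using ssytD(1)[OF that] by (intro sum.cong) (force simp: young_diagram_def less_Suc_eq_le)+
    finally show ?thesis using card_young_diagram[OF lam(1)] by simp
  qed
  have "(\<Prod>u\<in>?Y. monom 1 1 ^ (d + 1 - 1 - T u)) = monom (1 :: rat) (\<Sum>u\<in>?Y. d - T u)" for T
    unfolding power_sum[symmetric] by (simp add: monom_power)
  then have "coeff (ssyt_gf (monom 1 1 :: rat poly) lam (d + 1)) m = (\<Sum>T\<in>ssyt lam (d + 1). if (\<Sum>u\<in>?Y. d - T u) = m then 1 else 0)"
    by (simp only: ssyt_gf_def coeff_sum coeff_monom)
  also have "\<dots> = of_nat (card {T \<in> ssyt lam (d + 1). (\<Sum>u\<in>?Y. d - T u) = m})"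
    using fin by (simp add: sum.If_cases Int_def)
  also have "{T \<in> ssyt lam (d + 1). (\<Sum>u\<in>?Y. d - T u) = m} =
      {T \<in> ssyt lam (d + 1). int (part_size lam * d) - 2 * int (\<Sum>u\<in>?Y. T u) = 2 * int m - int (part_size lam * d)}"
  proof (intro Collect_cong conj_cong refl)
    fix T assume "T \<in> ssyt lam (d + 1)"
    from eq[OF this] show "(\<Sum>u\<in>?Y. d - T u) = m \<longleftrightarrow>
        int (part_size lam * d) - 2 * int (\<Sum>u\<in>?Y. T u) = 2 * int m - int (part_size lam * d)"
      by linarith
  qed
  finally show ?thesis by (simp add: ssyt_mult_def)
qed

text \<open>The weight \<open>k\<close> corresponds to the exponent \<open>m\<close> with
  \<open>2 m = k + part_size lam * d\<close>. By the degree equation, \<open>m - n\<close> is half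
  of \<open>k + degree P\<close>, so neither \<open>n\<close> nor the size of \<open>lam\<close>
  survives in the formula.\<close>

lemma ssyt_mult_eq_coeff:
  assumes lam: "is_partition lam" "part_length lam \<le> d + 1"
    and P: "ssyt_gf (monom 1 1) lam (d + 1) = monom 1 n * (P :: rat poly)"
      "degree P + 2 * n = part_size lam * d"
  shows "of_nat (ssyt_mult lam d k) =
    (if even (k + int (degree P)) \<and> k + int (degree P) \<ge> 0 then coeff P (nat ((k + int (degree P)) div 2)) else 0)"
proof (cases "even (k + int (degree P)) \<and> k + int (part_size lam * d) \<ge> 0")
  case True
  have eq: "int (part_size lam * d) = int (degree P) + 2 * int n" using P(2) by linarith
  define m where "m = nat ((k + int (part_size lam * d)) div 2)"
  have "even (k + int (part_size lam * d))" using True unfolding eq by simp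
  then have m: "2 * int m = k + int (part_size lam * d)" using True by (simp add: m_def)
  have "of_nat (ssyt_mult lam d k) = coeff (monom 1 n * P) m"
    using coeff_ssyt_gf[OF lam, of m] m P(1) by simp
  also have "\<dots> = (if n \<le> m then coeff P (m - n) else 0)"
    by (simp add: coeff_monom_mult)
  also have "n \<le> m \<longleftrightarrow> k + int (degree P) \<ge> 0" using m eq by linarith
  also have "(if k + int (degree P) \<ge> 0 then coeff P (m - n) else 0) =
      (if k + int (degree P) \<ge> 0 then coeff P (nat ((k + int (degree P)) div 2)) else 0)"
  proof -
    have "m - n = nat ((k + int (degree P)) div 2)" if "k + int (degree P) \<ge> 0"
      using m eq that by linarith
    then show ?thesis by simp
  qed
  finally show ?thesis using True by simp
next
  case False
  have eq: "int (part_size lam * d) = int (degree P) + 2 * int n" using P(2) by linarith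
  have "ssyt_mult lam d k = 0"
  proof (rule ccontr)
    assume "ssyt_mult lam d k \<noteq> 0"
    then have "{T \<in> ssyt lam (d + 1). int (part_size lam * d) - 2 * int (\<Sum>u\<in>young_diagram lam. T u) = k} \<noteq> {}"
      unfolding ssyt_mult_def by (metis card.empty)
    then obtain T where T: "T \<in> ssyt lam (d + 1)"
      "int (part_size lam * d) - 2 * int (\<Sum>u\<in>young_diagram lam. T u) = k"
      by blast
    have "even (k + int (degree P))" unfolding T(2)[symmetric] eq by simp
    moreover have "(\<Sum>u\<in>young_diagram lam. T u) \<le> (\<Sum>u\<in>young_diagram lam. d)"
      using ssytD(1)[OF T(1)] by (intro sum_mono) (force simp: young_diagram_def less_Suc_eq_le)
    then have "(\<Sum>u\<in>young_diagram lam. T u) \<le> part_size lam * d"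
      using card_young_diagram[OF lam(1)] by simp
    then have "k + int (part_size lam * d) \<ge> 0"
      using T(2) by linarith
    ultimately show False using False by simp
  qed
  moreover have "\<not> (even (k + int (degree P)) \<and> k + int (degree P) \<ge> 0)"
    using False eq by auto
  ultimately show ?thesis by (simp only: if_False)
qed

text \<open>The degree of \<open>P\<close> is recovered as the largest weight with nonzero
  multiplicity, and the coefficients as the multiplicities. The parity statement follows because
  \<open>part_size lam * d\<close> differs from \<open>degree P\<close> by the even number
  \<open>2 * n\<close>.\<close>

theorem ssyt_mult_eq_iff:
  assumes lam: "is_partition lam" "part_length lam \<le> d + 1"
    and mu: "is_partition mu" "part_length mu \<le> e + 1"
  shows "(\<forall>k. ssyt_mult lam d k = ssyt_mult mu e k) \<longleftrightarrow> P_frac d lam = P_frac e mu" (is ?thesis1)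
    and "P_frac d lam = P_frac e mu \<longrightarrow> even (int (part_size lam * d) - int (part_size mu * e))" (is ?thesis2)
proof -
  obtain P n where P: "ssyt_gf (monom 1 1) lam (d + 1) = monom 1 n * P"
    "P_frac d lam = Fraction_Field.Fract P 1" "degree P + 2 * n = part_size lam * d" "P \<noteq> 0"
    by (rule P_frac_ssyt_gf[OF lam])
  obtain Q m where Q: "ssyt_gf (monom 1 1) mu (e + 1) = monom 1 m * Q"
    "P_frac e mu = Fraction_Field.Fract Q 1" "degree Q + 2 * m = part_size mu * e" "Q \<noteq> 0"
    by (rule P_frac_ssyt_gf[OF mu])
  note mP = ssyt_mult_eq_coeff[OF lam P(1,3)] and mQ = ssyt_mult_eq_coeff[OF mu Q(1,3)]
  have PQ: "P_frac d lam = P_frac e mu \<longleftrightarrow> P = Q"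
    unfolding P(2) Q(2) by (simp add: eq_fract)
  have "P = Q" if eq: "\<forall>k. ssyt_mult lam d k = ssyt_mult mu e k"
  proof -
    \<comment> \<open>The leading coefficient of \<open>P'\<close> sits at weight
      \<open>degree P'\<close>. Hence the coefficient of \<open>Q'\<close> with index half of
      \<open>degree P' + degree Q'\<close> is nonzero, and that index is at most
      \<open>degree Q'\<close>.\<close>
    have "degree P' \<le> degree Q'"
      if "P' \<noteq> 0" and eq: "\<And>k. (if even (k + int (degree P')) \<and> k + int (degree P') \<ge> 0 then coeff P' (nat ((k + int (degree P')) div 2)) else 0) =
       (if even (k + int (degree Q')) \<and> k + int (degree Q') \<ge> 0 then coeff Q' (nat ((k + int (degree Q')) div 2)) else 0)"
      for P' Q' :: "rat poly"
    proof -
      let ?k = "int (degree P')"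
      have "coeff Q' (nat ((?k + int (degree Q')) div 2)) \<noteq> 0"
        using eq[of ?k] \<open>P' \<noteq> 0\<close> by (auto split: if_splits)
      then have "nat ((?k + int (degree Q')) div 2) \<le> degree Q'" by (rule le_degree)
      moreover have "even (?k + int (degree Q'))"
        using eq[of ?k] \<open>P' \<noteq> 0\<close> by (auto split: if_splits)
      then obtain b where b: "?k + int (degree Q') = 2 * b" by (rule evenE)
      ultimately have "b \<le> int (degree Q')" by simp
      with b show ?thesis by linarith
    qed
    note this[OF P(4), of Q] this[OF Q(4), of P]
    then have deg: "degree P = degree Q"
      using eq mP mQ by (metis (no_types, lifting) le_antisym)
    show "P = Q"
    proof (rule poly_eqI)
      fix j
      show "coeff P j = coeff Q j"
        using mP[of "2 * int j - int (degree P)"] mQ[of "2 * int j - int (degree P)"] eq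
        by (simp add: deg)
    qed
  qed
  moreover have "\<forall>k. ssyt_mult lam d k = ssyt_mult mu e k" if "P = Q"
  proof
    fix k
    have "(of_nat (ssyt_mult lam d k) :: rat) = of_nat (ssyt_mult mu e k)"
      unfolding mP mQ that ..
    then show "ssyt_mult lam d k = ssyt_mult mu e k" by simp
  qed
  ultimately show ?thesis1 unfolding PQ by blast
  show ?thesis2
  proof
    assume "P_frac d lam = P_frac e mu"
    then have "int (part_size lam * d) - int (part_size mu * e) = 2 * (int n - int m)"
      using PQ P(3)[symmetric] Q(3)[symmetric] by simp
    then show "even (int (part_size lam * d) - int (part_size mu * e))" by simp
  qed
qed

section \<open>Relations between images of the Young symmetrizer\<close>

context
  fixes lam :: "nat \<Rightarrow> nat"
  assumes lam: "is_partition lam"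
begin

lemma sum_le_part_size: "(\<Sum>i<m. lam i) \<le> part_size lam"
  using part_size_eq_sum[OF lam, of "max m (part_length lam)"]
  by (simp add: sum_mono2)

lemma box_row_eqI:
  assumes "(\<Sum>i'<i. lam i') \<le> k" "k < (\<Sum>i'<Suc i. lam i')"
  shows "box_row lam k = i"
  unfolding box_row_def lessThan_Suc_atMost[symmetric]
proof (rule Least_equality)
  fix i2 assume *: "k < (\<Sum>i'<Suc i2. lam i')"
  show "i \<le> i2"
  proof (rule ccontr)
    assume "\<not> i \<le> i2"
    then have "(\<Sum>i'<Suc i2. lam i') \<le> (\<Sum>i'<i. lam i')" by (intro sum_mono2) auto
    with * assms(1) show False by simp
  qed
qed (use assms in simp)

lemma box_row_bounds:
  assumes "k < part_size lam"
  shows "(\<Sum>i'<box_row lam k. lam i') \<le> k" "k < (\<Sum>i'<Suc (box_row lam k). lam i')"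
proof -
  have ex: "k < (\<Sum>i'\<le>part_length lam. lam i')"
    using assms part_size_eq_sum[OF lam, of "Suc (part_length lam)"] by (simp add: lessThan_Suc_atMost)
  show "k < (\<Sum>i'<Suc (box_row lam k). lam i')"
    unfolding lessThan_Suc_atMost box_row_def by (rule LeastI[of "\<lambda>i. k < (\<Sum>i'\<le>i. lam i')", OF ex])
  show "(\<Sum>i'<box_row lam k. lam i') \<le> k"
  proof (cases "box_row lam k")
    case (Suc i)
    then have "\<not> k < (\<Sum>i'\<le>i. lam i')"
      using not_less_Least[of i "\<lambda>i. k < (\<Sum>i'\<le>i. lam i')"] by (simp add: box_row_def)
    then show ?thesis by (simp add: Suc lessThan_Suc_atMost)
  qed simp
qed

lemma bij_betw_boxes:
  "bij_betw (\<lambda>k. (box_row lam k, box_col lam k)) {..<part_size lam} (young_diagram lam)"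
proof (rule bij_betw_byWitness[where f' = "\<lambda>(i, j). (\<Sum>i'<i. lam i') + j"])
  have box: "box_row lam ((\<Sum>i'<i. lam i') + j) = i" "(\<Sum>i'<i. lam i') + j < part_size lam" if "j < lam i" for i j
  proof -
    show "box_row lam ((\<Sum>i'<i. lam i') + j) = i" by (rule box_row_eqI) (use that in auto)
    show "(\<Sum>i'<i. lam i') + j < part_size lam"
      using that sum_le_part_size[of "Suc i"] by simp
  qed
  show "\<forall>k\<in>{..<part_size lam}. (\<lambda>(i, j). (\<Sum>i'<i. lam i') + j) (box_row lam k, box_col lam k) = k"
    using box_row_bounds by (auto simp: box_col_def)
  show "\<forall>u\<in>young_diagram lam. (\<lambda>k. (box_row lam k, box_col lam k)) ((\<lambda>(i, j). (\<Sum>i'<i. lam i') + j) u) = u"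
    using box by (auto simp: box_col_def)
  show "(\<lambda>k. (box_row lam k, box_col lam k)) ` {..<part_size lam} \<subseteq> young_diagram lam"
    using box_row_bounds by (fastforce simp: box_col_def less_diff_conv2)
  show "(\<lambda>(i, j). (\<Sum>i'<i. lam i') + j) ` young_diagram lam \<subseteq> {..<part_size lam}"
    using box by auto
qed

lemma box_eqI:
  "k < part_size lam \<Longrightarrow> k' < part_size lam \<Longrightarrow> box_row lam k = box_row lam k' \<Longrightarrow>
    box_col lam k = box_col lam k' \<Longrightarrow> k = k'"
  using inj_onD[OF bij_betw_imp_inj_on[OF bij_betw_boxes], of k k'] by auto

lemma box_col_less: "k < part_size lam \<Longrightarrow> box_col lam k < lam (box_row lam k)"
  using bij_betwE[OF bij_betw_boxes] by auto

lemma box_exists: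
  assumes "j < lam i"
  obtains k where "k < part_size lam" "box_row lam k = i" "box_col lam k = j"
proof -
  have "(i, j) \<in> (\<lambda>k. (box_row lam k, box_col lam k)) ` {..<part_size lam}"
    using assms bij_betw_imp_surj_on[OF bij_betw_boxes] by simp
  then show ?thesis using that by auto
qed

end

section \<open>Permutations preserving a labelling, and sums over row and column
  permutations\<close>

definition stab_group :: "nat \<Rightarrow> (nat \<Rightarrow> 'b) \<Rightarrow> (nat \<Rightarrow> nat) set" where
  "stab_group n cl = {p. p permutes {..<n} \<and> (\<forall>k<n. cl (p k) = cl k)}"

lemma row_group_eq: "row_group lam = stab_group (part_size lam) (box_row lam)"
  and col_group_eq: "col_group lam = stab_group (part_size lam) (box_col lam)"
  by (simp_all add: row_group_def col_group_def stab_group_def)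

lemma stab_groupD:
  assumes "p \<in> stab_group n cl"
  shows "p permutes {..<n}" "k < n \<Longrightarrow> cl (p k) = cl k" "k < n \<Longrightarrow> p k < n" "permutation p"
  using assms permutes_in_image[of p "{..<n}" k] permutation_permutes[of p] by (auto simp: stab_group_def)

lemma finite_stab_group [simp]: "finite (stab_group n cl)"
  by (rule finite_subset[OF _ finite_permutations[of "{..<n}"]]) (auto simp: stab_group_def)

lemma id_in_stab_group: "id \<in> stab_group n cl"
  by (simp add: stab_group_def permutes_id)

lemma comp_in_stab_group:
  "p \<in> stab_group n cl \<Longrightarrow> q \<in> stab_group n cl \<Longrightarrow> p \<circ> q \<in> stab_group n cl"
  using stab_groupD(3)[of q n cl] by (auto simp: stab_group_def permutes_compose)

lemma inv_in_stab_group: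
  assumes "p \<in> stab_group n cl"
  shows "Hilbert_Choice.inv p \<in> stab_group n cl"
proof -
  note p = stab_groupD[OF assms]
  have "Hilbert_Choice.inv p permutes {..<n}" by (rule permutes_inv[OF p(1)])
  moreover have "cl (Hilbert_Choice.inv p k) = cl k" if "k < n" for k
    using p(2)[of "Hilbert_Choice.inv p k"] permutes_in_image[OF permutes_inv[OF p(1)], of k] that
    by (simp add: permutes_inverses[OF p(1)])
  ultimately show ?thesis by (simp add: stab_group_def)
qed

lemma transpose_in_stab_group:
  "i < n \<Longrightarrow> j < n \<Longrightarrow> cl i = cl j \<Longrightarrow> Transposition.transpose i j \<in> stab_group n cl"
  by (auto simp: stab_group_def permutes_swap_id Transposition.transpose_def)

lemma bij_betw_comp_right_stab_group:
  assumes "r \<in> stab_group n cl"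
  shows "bij_betw (\<lambda>p. p \<circ> r) (stab_group n cl) (stab_group n cl)"
proof (rule bij_betw_byWitness[where f' = "\<lambda>p. p \<circ> Hilbert_Choice.inv r"])
  note r = stab_groupD(1)[OF assms]
  show "\<forall>p\<in>stab_group n cl. p \<circ> r \<circ> Hilbert_Choice.inv r = p" "\<forall>p\<in>stab_group n cl. p \<circ> Hilbert_Choice.inv r \<circ> r = p"
    by (simp_all add: o_assoc[symmetric] permutes_inv_o[OF r])
  show "(\<lambda>p. p \<circ> r) ` stab_group n cl \<subseteq> stab_group n cl"
    by (intro image_subsetI comp_in_stab_group assms)
  show "(\<lambda>p. p \<circ> Hilbert_Choice.inv r) ` stab_group n cl \<subseteq> stab_group n cl"
    by (intro image_subsetI comp_in_stab_group inv_in_stab_group assms)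
qed

text \<open>The Young symmetrizer as a functional on functions of a permutation. Relations between
  its values come from right translation of the argument, without reference to tensors.\<close>

definition young_sum :: "(nat \<Rightarrow> nat) \<Rightarrow> ((nat \<Rightarrow> nat) \<Rightarrow> complex) \<Rightarrow> complex" where
  "young_sum lam f = (\<Sum>p\<in>row_group lam. \<Sum>q\<in>col_group lam. of_int (sign q) * f (p \<circ> q))"

lemma young_symmetrizer_eq: "young_symmetrizer lam x is = young_sum lam (\<lambda>s. x (permute_list s is))"
  by (simp add: young_symmetrizer_def young_sum_def)

lemma young_sum_col:
  assumes c: "c \<in> col_group lam"
  shows "young_sum lam (\<lambda>s. f (s \<circ> c)) = of_int (sign c) * young_sum lam f"
proof -
  note cD = stab_groupD[OF c[unfolded col_group_eq]]
  have "(\<Sum>q\<in>col_group lam. of_int (sign q) * f (p \<circ> q \<circ> c)) =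
      of_int (sign c) * (\<Sum>q\<in>col_group lam. of_int (sign q) * f (p \<circ> q))" for p
  proof -
    have "(\<Sum>q\<in>col_group lam. of_int (sign q) * f (p \<circ> q)) =
        (\<Sum>q\<in>col_group lam. of_int (sign (q \<circ> c)) * f (p \<circ> (q \<circ> c)))"
      unfolding col_group_eq
      by (rule sum.reindex_bij_betw[symmetric, OF bij_betw_comp_right_stab_group]) (use c in \<open>simp add: col_group_eq\<close>)
    also have "\<dots> = (\<Sum>q\<in>col_group lam. of_int (sign c) * (of_int (sign q) * f (p \<circ> q \<circ> c)))"
      by (intro sum.cong refl) (auto simp: col_group_eq sign_compose stab_groupD(4) cD(4) o_assoc)
    also have "\<dots> = of_int (sign c) * (\<Sum>q\<in>col_group lam. of_int (sign q) * f (p \<circ> q \<circ> c))"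
      by (simp only: sum_distrib_left)
    finally have *: "(\<Sum>q\<in>col_group lam. of_int (sign q) * f (p \<circ> q)) = \<dots>" .
    have "of_int (sign c) * of_int (sign c) = (1 :: complex)"
      by (simp flip: of_int_mult)
    then show ?thesis unfolding * by (simp only: mult.assoc[symmetric] mult_1_left)
  qed
  then show ?thesis by (simp add: young_sum_def sum_distrib_left)
qed

text \<open>If \<open>q\<close> moves two elements of \<open>G\<close> into one row, then the transposition of these two elements
  becomes a row permutation after conjugation by \<open>q\<close>, so that the terms for \<open>q\<close> cancel in pairs.\<close>

lemma young_sum_garnir:
  assumes G: "G \<subseteq> {..<part_size lam}"
    and pair: "\<And>q. q \<in> col_group lam \<Longrightarrow> \<exists>u\<in>G. \<exists>v\<in>G. u \<noteq> v \<and> box_row lam (q u) = box_row lam (q v)"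
  shows "(\<Sum>w | w permutes G. of_int (sign w) * young_sum lam (\<lambda>s. f (s \<circ> w))) = 0"
proof -
  let ?P = "{w. w permutes G}"
  define g where "g s = (\<Sum>p\<in>row_group lam. f (p \<circ> s))" for s
  have finG: "finite G" using G by (rule finite_subset) simp
  have g_row: "g (r \<circ> s) = g s" if "r \<in> row_group lam" for r s
    unfolding g_def
  proof -
    have "bij_betw (\<lambda>p. p \<circ> r) (row_group lam) (row_group lam)"
      using that unfolding row_group_eq by (rule bij_betw_comp_right_stab_group)
    from sum.reindex_bij_betw[OF this, of "\<lambda>p. f (p \<circ> s)"]
    show "(\<Sum>p\<in>row_group lam. f (p \<circ> (r \<circ> s))) = (\<Sum>p\<in>row_group lam. f (p \<circ> s))"
      by (simp only: o_assoc)
  qed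
  have zero: "(\<Sum>w\<in>?P. of_int (sign w) * g (q \<circ> w)) = 0" if q: "q \<in> col_group lam" for q
  proof -
    note qD = stab_groupD[OF q[unfolded col_group_eq]]
    obtain u v where uv: "u \<in> G" "v \<in> G" "u \<noteq> v" "box_row lam (q u) = box_row lam (q v)"
      using pair[OF q] by blast
    let ?t = "Transposition.transpose u v"
    have t: "?t permutes G" using uv by (simp add: permutes_swap_id)
    have tw: "g (q \<circ> (?t \<circ> w)) = g (q \<circ> w)" for w
    proof -
      have "q \<circ> (?t \<circ> w) = Transposition.transpose (q u) (q v) \<circ> (q \<circ> w)"
        using inj_eq[OF permutes_inj[OF qD(1)]] by (auto simp: fun_eq_iff Transposition.transpose_def)
      moreover have "Transposition.transpose (q u) (q v) \<in> row_group lam"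
        unfolding row_group_eq using uv G qD(3) by (intro transpose_in_stab_group) auto
      ultimately show ?thesis by (simp only: g_row)
    qed
    have sgn: "sign (?t \<circ> w) = - sign w" if "w permutes G" for w
    proof -
      have "permutation w" using that finG permutation_permutes by blast
      then show ?thesis using uv(3) by (simp add: sign_compose permutation_swap_id sign_swap_id)
    qed
    have bij: "bij_betw (\<lambda>w. ?t \<circ> w) ?P ?P"
      by (rule bij_betw_byWitness[where f' = "\<lambda>w. ?t \<circ> w"])
         (use t in \<open>simp_all add: o_assoc image_subset_iff permutes_compose\<close>)
    have "(\<Sum>w\<in>?P. of_int (sign w) * g (q \<circ> w)) = (\<Sum>w\<in>?P. of_int (sign (?t \<circ> w)) * g (q \<circ> (?t \<circ> w)))"
      by (rule sum.reindex_bij_betw[symmetric, OF bij])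
    also have "\<dots> = - (\<Sum>w\<in>?P. of_int (sign w) * g (q \<circ> w))"
      unfolding sum_negf[symmetric] by (intro sum.cong refl) (simp add: sgn tw)
    finally show ?thesis by simp
  qed
  have "young_sum lam (\<lambda>s. f (s \<circ> w)) = (\<Sum>q\<in>col_group lam. of_int (sign q) * g (q \<circ> w))" for w
    unfolding young_sum_def g_def sum_distrib_left by (subst sum.swap) (simp only: o_assoc)
  then have "(\<Sum>w\<in>?P. of_int (sign w) * young_sum lam (\<lambda>s. f (s \<circ> w))) =
      (\<Sum>w\<in>?P. \<Sum>q\<in>col_group lam. of_int (sign q) * (of_int (sign w) * g (q \<circ> w)))"
    by (simp add: sum_distrib_left ac_simps)
  also have "\<dots> = (\<Sum>q\<in>col_group lam. of_int (sign q) * (\<Sum>w\<in>?P. of_int (sign w) * g (q \<circ> w)))"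
    by (subst sum.swap) (simp add: sum_distrib_left)
  also have "\<dots> = 0" by (simp add: zero)
  finally show ?thesis .
qed

lemma pure_tensor_permute_list:
  assumes w: "w permutes {..<length vs}"
  shows "pure_tensor (permute_list w vs) js = pure_tensor vs (permute_list (Hilbert_Choice.inv w) js)"
proof (cases "length js = length vs")
  case True
  have "(\<Prod>k<length vs. (permute_list w vs ! k) (js ! k)) = (\<Prod>k<length vs. (vs ! w k) (js ! k))"
    using w by (intro prod.cong refl) (simp add: permute_list_nth)
  also have "\<dots> = (\<Prod>k<length vs. (vs ! w k) (js ! (Hilbert_Choice.inv w (w k))))"
    by (simp add: permutes_inverses[OF w])
  also have "\<dots> = (\<Prod>k<length vs. (vs ! k) (js ! (Hilbert_Choice.inv w k)))"
    using prod.permute[OF w, of "\<lambda>k. (vs ! k) (js ! (Hilbert_Choice.inv w k))"] by (simp add: o_def)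
  also have "\<dots> = (\<Prod>k<length vs. (vs ! k) (permute_list (Hilbert_Choice.inv w) js ! k))"
    using permutes_inv[OF w] True by (intro prod.cong refl) (simp add: permute_list_nth)
  finally show ?thesis using True by (simp add: pure_tensor_def)
qed (simp add: pure_tensor_def)

definition young_tensor :: "(nat \<Rightarrow> nat) \<Rightarrow> (nat \<Rightarrow> 'i \<Rightarrow> complex) \<Rightarrow> nat list \<Rightarrow> 'i list \<Rightarrow> complex" where
  "young_tensor lam v T = young_symmetrizer lam (pure_tensor (map v T))"

text \<open>Permuting the factors of a pure tensor is the same as permuting the index list
  inversely. This translates relations between fillings into right translations in
  \<open>young_sum\<close>.\<close>

lemma young_tensor_permute_list:
  assumes w: "w permutes {..<part_size lam}" and T: "length T = part_size lam"
  shows "young_tensor lam v (permute_list w T) is =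
    young_sum lam (\<lambda>s. pure_tensor (map v T) (permute_list (s \<circ> Hilbert_Choice.inv w) is))"
proof (cases "length is = part_size lam")
  case True
  have "pure_tensor (map v (permute_list w T)) (permute_list s is) =
     pure_tensor (map v T) (permute_list (s \<circ> Hilbert_Choice.inv w) is)" for s
  proof -
    have "map v (permute_list w T) = permute_list w (map v T)"
      using w T by (simp add: permute_list_map)
    moreover have "permute_list (Hilbert_Choice.inv w) (permute_list s is) = permute_list (s \<circ> Hilbert_Choice.inv w) is"
      using True permutes_inv[OF w] by (simp add: permute_list_compose)
    ultimately show ?thesis using w T by (simp add: pure_tensor_permute_list)
  qed
  then show ?thesis by (simp add: young_tensor_def young_symmetrizer_eq)
qed (use T in \<open>simp add: young_tensor_def young_symmetrizer_eq pure_tensor_def\<close>)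

lemma young_tensor_col:
  assumes c: "c \<in> col_group lam" and T: "length T = part_size lam"
  shows "young_tensor lam v (permute_list c T) = fscale (of_int (sign c)) (young_tensor lam v T)"
proof
  fix "is"
  note cD = stab_groupD[OF c[unfolded col_group_eq]]
  have ci: "Hilbert_Choice.inv c \<in> col_group lam"
    using inv_in_stab_group c by (simp add: col_group_eq)
  show "young_tensor lam v (permute_list c T) is = fscale (of_int (sign c)) (young_tensor lam v T) is"
    unfolding young_tensor_permute_list[OF cD(1) T]
    using young_sum_col[OF ci, of "\<lambda>s. pure_tensor (map v T) (permute_list s is)"]
    by (simp add: fscale_def young_tensor_def young_symmetrizer_eq sign_inverse[OF cD(4)])
qed

text \<open>Inverting the summation variable does not change its sign, so this is the Garnir
  relation for \<open>young_sum\<close>. The sum runs over all permutations of \<open>G\<close>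
  rather than coset representatives; the repeated terms are collected when straightening.\<close>

lemma young_tensor_garnir:
  assumes T: "length T = part_size lam" and G: "G \<subseteq> {..<part_size lam}"
    and pair: "\<And>q. q \<in> col_group lam \<Longrightarrow> \<exists>u\<in>G. \<exists>v\<in>G. u \<noteq> v \<and> box_row lam (q u) = box_row lam (q v)"
  shows "(\<Sum>w | w permutes G. fscale (of_int (sign w)) (young_tensor lam v (permute_list w T))) = 0"
proof
  fix "is"
  let ?f = "\<lambda>s. pure_tensor (map v T) (permute_list s is)"
  have finG: "finite G" using G by (rule finite_subset) simp
  have "(\<Sum>w | w permutes G. fscale (of_int (sign w)) (young_tensor lam v (permute_list w T))) is =
      (\<Sum>w | w permutes G. of_int (sign w) * young_tensor lam v (permute_list w T) is)"
    by (induction rule: infinite_finite_induct) (auto simp: fscale_def)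
  also have "\<dots> = (\<Sum>w | w permutes G. of_int (sign (Hilbert_Choice.inv w)) * young_sum lam (\<lambda>s. ?f (s \<circ> Hilbert_Choice.inv w)))"
  proof (intro sum.cong refl)
    fix w assume "w \<in> {w. w permutes G}"
    then have w: "w permutes G" by simp
    have "w permutes {..<part_size lam}" by (rule permutes_subset[OF w G])
    moreover have "sign (Hilbert_Choice.inv w) = sign w"
      using w finG permutation_permutes sign_inverse by blast
    ultimately show "of_int (sign w) * young_tensor lam v (permute_list w T) is =
        of_int (sign (Hilbert_Choice.inv w)) * young_sum lam (\<lambda>s. ?f (s \<circ> Hilbert_Choice.inv w))"
      by (simp add: young_tensor_permute_list T)
  qed
  also have "\<dots> = (\<Sum>w | w permutes G. of_int (sign w) * young_sum lam (\<lambda>s. ?f (s \<circ> w)))"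
    by (rule sum.reindex_bij_betw[of "Hilbert_Choice.inv"], rule bij_betw_byWitness[where f' = "Hilbert_Choice.inv"])
       (auto simp: permutes_inv permutes_inv_inv)
  also have "\<dots> = 0" by (rule young_sum_garnir[OF G pair])
  finally show "(\<Sum>w | w permutes G. fscale (of_int (sign w)) (young_tensor lam v (permute_list w T))) is = 0 is"
    by simp
qed

section \<open>Fillings and the straightening algorithm\<close>

definition col_strict :: "(nat \<Rightarrow> nat) \<Rightarrow> nat list \<Rightarrow> bool" where
  "col_strict lam T \<longleftrightarrow> (\<forall>k<part_size lam. \<forall>k'<part_size lam.
     box_col lam k = box_col lam k' \<longrightarrow> box_row lam k < box_row lam k' \<longrightarrow> T ! k < T ! k')"

definition row_weak :: "(nat \<Rightarrow> nat) \<Rightarrow> nat list \<Rightarrow> bool" where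
  "row_weak lam T \<longleftrightarrow> (\<forall>k<part_size lam. \<forall>k'<part_size lam.
     box_row lam k = box_row lam k' \<longrightarrow> box_col lam k < box_col lam k' \<longrightarrow> T ! k \<le> T ! k')"

definition fillings :: "(nat \<Rightarrow> nat) \<Rightarrow> nat \<Rightarrow> nat list set" where
  "fillings lam N = {T. length T = part_size lam \<and> set T \<subseteq> {..<N}}"

definition tableaux :: "(nat \<Rightarrow> nat) \<Rightarrow> nat \<Rightarrow> nat list set" where
  "tableaux lam N = {T \<in> fillings lam N. col_strict lam T \<and> row_weak lam T}"

text \<open>Potentials for straightening: this one grows when large entries move right,
  \<open>row_weight\<close> when they move down. The row weight also orders the tableaux for which
  evaluation is triangular.\<close>

definition col_weight :: "(nat \<Rightarrow> nat) \<Rightarrow> nat list \<Rightarrow> nat" where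
  "col_weight lam T = (\<Sum>k<part_size lam. box_col lam k * T ! k)"

definition row_weight :: "(nat \<Rightarrow> nat) \<Rightarrow> nat list \<Rightarrow> nat" where
  "row_weight lam T = (\<Sum>k<part_size lam. box_row lam k * T ! k)"

lemma fillingsD:
  assumes "T \<in> fillings lam N"
  shows "length T = part_size lam" "k < part_size lam \<Longrightarrow> T ! k < N"
proof -
  show len: "length T = part_size lam" using assms by (simp add: fillings_def)
  assume "k < part_size lam"
  then have "T ! k \<in> set T" using len by simp
  then show "T ! k < N" using assms by (auto simp: fillings_def)
qed

lemma permute_list_fillings:
  assumes "w permutes {..<part_size lam}" "T \<in> fillings lam N"
  shows "permute_list w T \<in> fillings lam N"
  using assms by (auto simp: fillings_def)

text \<open>The rearrangement inequality for a single inversion.\<close>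

lemma sum_transpose_diff:
  fixes f g :: "nat \<Rightarrow> nat"
  assumes "a < n" "b < n" "a \<noteq> b" "f a < f b" "g a > g b"
  shows "(\<Sum>k<n. f k * g k) < (\<Sum>k<n. f k * g (Transposition.transpose a b k))"
proof -
  have split: "sum h {..<n} = h a + h b + sum h ({..<n} - {a, b})" for h :: "nat \<Rightarrow> nat"
    using assms(1-3) by (subst sum.subset_diff[of "{a, b}"]) auto
  have "(\<Sum>k\<in>{..<n} - {a, b}. f k * g (Transposition.transpose a b k)) = (\<Sum>k\<in>{..<n} - {a, b}. f k * g k)"
    by (intro sum.cong) (auto simp: Transposition.transpose_def)
  moreover have "f a * g a + f b * g b < f a * g b + f b * g a"
  proof -
    obtain x y where "f b = f a + Suc x" "g a = g b + Suc y"
      using assms(4,5) less_imp_Suc_add by (metis add_Suc_right)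
    then show ?thesis by (simp add: algebra_simps)
  qed
  ultimately show ?thesis unfolding split by simp
qed

lemma row_weight_transpose:
  assumes "length T = part_size lam" "k < part_size lam" "k' < part_size lam"
    "box_row lam k < box_row lam k'" "T ! k > T ! k'"
  shows "row_weight lam T < row_weight lam (permute_list (Transposition.transpose k k') T)"
proof -
  have "k \<noteq> k'" using assms by auto
  moreover have "Transposition.transpose k k' permutes {..<part_size lam}"
    using assms by (simp add: permutes_swap_id)
  ultimately show ?thesis
    using sum_transpose_diff[of k "part_size lam" k' "box_row lam" "(!) T"] assms
    by (simp add: row_weight_def permute_list_nth)
qed

lemma col_weight_col_group:
  assumes "c \<in> col_group lam" "length T = part_size lam"
  shows "col_weight lam (permute_list c T) = col_weight lam T"
proof -
  note c = stab_groupD[OF assms(1)[unfolded col_group_eq]]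
  have "col_weight lam (permute_list c T) = (\<Sum>k<part_size lam. box_col lam (c k) * T ! c k)"
    unfolding col_weight_def using assms(2) c by (intro sum.cong) (auto simp: permute_list_nth)
  also have "\<dots> = col_weight lam T"
    using sum.permute[OF c(1), of "\<lambda>k. box_col lam k * T ! k"] by (simp add: col_weight_def o_def)
  finally show ?thesis .
qed

lemma row_weight_row_group:
  assumes "p \<in> row_group lam" "length T = part_size lam"
  shows "row_weight lam (permute_list p T) = row_weight lam T"
proof -
  note p = stab_groupD[OF assms(1)[unfolded row_group_eq]]
  have "row_weight lam (permute_list p T) = (\<Sum>k<part_size lam. box_row lam (p k) * T ! p k)"
    unfolding row_weight_def using assms(2) p by (intro sum.cong) (auto simp: permute_list_nth)
  also have "\<dots> = row_weight lam T"
    using sum.permute[OF p(1), of "\<lambda>k. box_row lam k * T ! k"] by (simp add: row_weight_def o_def)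
  finally show ?thesis .
qed

lemma sum_permuted_subset_less:
  fixes f :: "nat \<Rightarrow> nat"
  assumes fin: "finite A" "finite B" and w: "w permutes A \<union> B" and ne: "w ` B \<noteq> B"
    and A: "\<And>x. x \<in> A \<Longrightarrow> a \<le> f x" and B: "\<And>x. x \<in> B \<Longrightarrow> f x \<le> b" and "b < a"
  shows "(\<Sum>x\<in>B. f x) < (\<Sum>x\<in>B. f (w x))"
proof -
  have inj: "inj_on w B" using permutes_inj[OF w] by (rule inj_on_subset) simp
  have sub: "w ` B \<subseteq> A \<union> B" using permutes_image[OF w] by blast
  have finw: "finite (w ` B)" using fin by simp
  have card: "card (w ` B) = card B" by (rule card_image[OF inj])
  have "card (w ` B - B) = card (B - w ` B)"
    using card_Diff_subset_Int[of "w ` B" B] card_Diff_subset_Int[of B "w ` B"] fin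
    by (simp add: card Int_commute)
  moreover have "w ` B - B \<noteq> {}"
  proof
    assume "w ` B - B = {}"
    then have "w ` B \<subseteq> B" by blast
    from card_subset_eq[OF fin(2) this card] show False using ne by contradiction
  qed
  then have "card (w ` B - B) > 0" using finw by (simp add: card_gt_0_iff)
  ultimately have cards: "card (B - w ` B) * b < card (w ` B - B) * a"
    using \<open>b < a\<close> by simp
  have "(\<Sum>x\<in>B. f x) = (\<Sum>x\<in>B \<inter> w ` B. f x) + (\<Sum>x\<in>B - w ` B. f x)"
    by (rule sum.Int_Diff[OF fin(2)])
  also have "(\<Sum>x\<in>B - w ` B. f x) \<le> card (B - w ` B) * b"
    using sum_bounded_above[of "B - w ` B" f b] B by simp
  also note cards
  also have "card (w ` B - B) * a \<le> (\<Sum>x\<in>w ` B - B. f x)"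
    using sum_bounded_below[of "w ` B - B" a f] A sub by auto
  also have "(\<Sum>x\<in>B \<inter> w ` B. f x) + (\<Sum>x\<in>w ` B - B. f x) = (\<Sum>x\<in>w ` B. f x)"
    using sum.Int_Diff[OF finw, of f B] by (simp add: Int_commute)
  also have "\<dots> = (\<Sum>x\<in>B. f (w x))" by (simp add: sum.reindex[OF inj])
  finally show ?thesis by simp
qed

lemma span_fscale_cancel:
  assumes "c \<noteq> 0" "fscale c x \<in> fun_space.span S"
  shows "x \<in> fun_space.span S"
proof -
  have "fscale (inverse c) (fscale c x) = x" using assms(1) by (simp add: fscale_def fun_eq_iff)
  then show ?thesis using fun_space.span_scale[OF assms(2), of "inverse c"] by simp
qed

context
  fixes lam :: "nat \<Rightarrow> nat"
  assumes lam: "is_partition lam"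
begin

lemma card_column_part:
  "card {k. k < part_size lam \<and> box_col lam k = j \<and> P (box_row lam k)} = card {i. j < lam i \<and> P i}"
proof -
  have "bij_betw (box_row lam) {k. k < part_size lam \<and> box_col lam k = j \<and> P (box_row lam k)} {i. j < lam i \<and> P i}"
    unfolding bij_betw_def
  proof
    show "inj_on (box_row lam) {k. k < part_size lam \<and> box_col lam k = j \<and> P (box_row lam k)}"
    proof (rule inj_onI, elim CollectE conjE)
      fix k k' assume "k < part_size lam" "k' < part_size lam" "box_row lam k = box_row lam k'"
        "box_col lam k = j" "box_col lam k' = j"
      then show "k = k'" by (simp add: box_eqI[OF lam])
    qed
    show "box_row lam ` {k. k < part_size lam \<and> box_col lam k = j \<and> P (box_row lam k)} = {i. j < lam i \<and> P i}"
    proof safe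
      fix i assume "j < lam i" "P i"
      then show "i \<in> box_row lam ` {k. k < part_size lam \<and> box_col lam k = j \<and> P (box_row lam k)}"
        by (elim box_exists[OF lam]) (auto intro!: image_eqI)
    qed (use box_col_less[OF lam] in auto)
  qed
  then show ?thesis by (rule bij_betw_same_card)
qed

text \<open>\<open>G\<close> is the classical Garnir belt: the left column from row \<open>i\<close>
  downwards and the right column down to row \<open>i\<close>. It has one box more than the left
  column, while column permutations keep its boxes in the two columns, which occupy no more rows
  than the left one alone.\<close>

lemma garnir_pigeonhole:
  assumes kk: "k < part_size lam" "k' < part_size lam" "box_row lam k = box_row lam k'" "box_col lam k < box_col lam k'"
    and q: "q \<in> col_group lam"
    and G: "G = {x. x < part_size lam \<and> box_col lam x = box_col lam k \<and> box_row lam k \<le> box_row lam x} \<union>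
        {x. x < part_size lam \<and> box_col lam x = box_col lam k' \<and> box_row lam x \<le> box_row lam k}"
  shows "\<exists>u\<in>G. \<exists>v\<in>G. u \<noteq> v \<and> box_row lam (q u) = box_row lam (q v)"
proof -
  note qD = stab_groupD[OF q[unfolded col_group_eq]]
  let ?i = "box_row lam k" and ?j = "box_col lam k" and ?j' = "box_col lam k'"
  let ?A = "{x. x < part_size lam \<and> box_col lam x = ?j \<and> ?i \<le> box_row lam x}"
  let ?B = "{x. x < part_size lam \<and> box_col lam x = ?j' \<and> box_row lam x \<le> ?i}"
  note c = less_conj_part_iff[OF lam]
  have "card ?A = card {i. ?j < lam i \<and> ?i \<le> i}"
    by (rule card_column_part)
  also have "{i. ?j < lam i \<and> ?i \<le> i} = {?i..<conj_part lam ?j}" by (auto simp: c)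
  finally have cA: "card ?A = conj_part lam ?j - ?i" by simp
  have i': "?i < conj_part lam ?j'" using box_col_less[OF lam kk(2)] kk(3) by (simp add: c)
  have "card ?B = card {i. ?j' < lam i \<and> i \<le> ?i}"
    by (rule card_column_part)
  also have "{i. ?j' < lam i \<and> i \<le> ?i} = {..?i}" using i' by (auto simp: c[symmetric])
  finally have cB: "card ?B = Suc ?i" by simp
  have le: "conj_part lam ?j' \<le> conj_part lam ?j"
    using c[of "conj_part lam ?j" ?j'] c[of "conj_part lam ?j" ?j] kk(4) by (auto simp: not_less)
  have "card (?A \<union> ?B) = card ?A + card ?B"
    using kk(4) by (intro card_Un_disjoint) auto
  then have cG: "card G = Suc (conj_part lam ?j)"
    unfolding G cA cB using i' le by simp
  have "(\<lambda>x. box_row lam (q x)) ` G \<subseteq> {..<conj_part lam ?j}"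
  proof safe
    fix x assume "x \<in> G"
    then have x: "x < part_size lam" "box_col lam x = ?j \<or> box_col lam x = ?j'" unfolding G by auto
    have "box_col lam (q x) < lam (box_row lam (q x))"
      by (rule box_col_less[OF lam qD(3)[OF x(1)]])
    then have "?j < lam (box_row lam (q x))" using x qD(2)[OF x(1)] kk(4) by auto
    then show "box_row lam (q x) < conj_part lam ?j" by (simp add: c)
  qed
  from card_mono[OF finite_lessThan this]
  have "card ((\<lambda>x. box_row lam (q x)) ` G) \<le> conj_part lam ?j" by simp
  then have "\<not> inj_on (\<lambda>x. box_row lam (q x)) G"
    using cG card_image[of "\<lambda>x. box_row lam (q x)" G] by linarith
  then show ?thesis by (auto simp: inj_on_def)
qed

text \<open>Column strictness spreads the violation \<open>T ! k' < T ! k\<close> to all of the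
  belt: entries in \<open>B\<close> are at most \<open>T ! k'\<close>, entries in \<open>A\<close>
  at least \<open>T ! k\<close>. A permutation not preserving \<open>B\<close> therefore moves
  larger entries into the right column.\<close>

lemma col_weight_garnir_less:
  assumes T: "T \<in> fillings lam N" "col_strict lam T"
    and kk: "k < part_size lam" "k' < part_size lam" "box_row lam k = box_row lam k'"
      "box_col lam k < box_col lam k'" "T ! k' < T ! k"
    and A: "A = {x. x < part_size lam \<and> box_col lam x = box_col lam k \<and> box_row lam k \<le> box_row lam x}"
    and B: "B = {x. x < part_size lam \<and> box_col lam x = box_col lam k' \<and> box_row lam x \<le> box_row lam k}"
    and w: "w permutes A \<union> B" "w ` B \<noteq> B"
  shows "col_weight lam T < col_weight lam (permute_list w T)"
proof -
  let ?j = "box_col lam k" and ?j' = "box_col lam k'" and ?n = "part_size lam"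
  have T': "length T = ?n" using T by (simp add: fillings_def)
  have fin: "finite A" "finite B" unfolding A B by auto
  have disj: "A \<inter> B = {}" unfolding A B using kk(4) by auto
  have sub: "A \<union> B \<subseteq> {..<?n}" unfolding A B by auto
  have w': "w permutes {..<length T}" using permutes_subset[OF w(1) sub] T' by simp
  \<comment> \<open>Writing the weight \<open>?j'\<close> as \<open>?j\<close> plus the positive
    number \<open>?j' - ?j\<close> leaves the sum over \<open>B\<close> as the only term that
    \<open>w\<close> changes.\<close>
  have split: "(\<Sum>x<?n. box_col lam x * f x) =
      (\<Sum>x\<in>{..<?n} - (A \<union> B). box_col lam x * f x) + ?j * (\<Sum>x\<in>A \<union> B. f x) + (?j' - ?j) * (\<Sum>x\<in>B. f x)"
    for f :: "nat \<Rightarrow> nat"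
  proof -
    have "(\<Sum>x<?n. box_col lam x * f x) =
        (\<Sum>x\<in>{..<?n} - (A \<union> B). box_col lam x * f x) + (\<Sum>x\<in>A \<union> B. box_col lam x * f x)"
      by (rule sum.subset_diff[OF sub]) simp
    also have "(\<Sum>x\<in>A \<union> B. box_col lam x * f x) = (\<Sum>x\<in>A. box_col lam x * f x) + (\<Sum>x\<in>B. box_col lam x * f x)"
      by (rule sum.union_disjoint[OF fin disj])
    also have "(\<Sum>x\<in>A. box_col lam x * f x) = ?j * (\<Sum>x\<in>A. f x)"
      unfolding sum_distrib_left by (intro sum.cong) (auto simp: A)
    also have "(\<Sum>x\<in>B. box_col lam x * f x) = (?j + (?j' - ?j)) * (\<Sum>x\<in>B. f x)"
      unfolding sum_distrib_left using kk(4) by (intro sum.cong) (auto simp: B)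
    also have "?j * (\<Sum>x\<in>A. f x) + (?j + (?j' - ?j)) * (\<Sum>x\<in>B. f x) =
        ?j * (\<Sum>x\<in>A \<union> B. f x) + (?j' - ?j) * (\<Sum>x\<in>B. f x)"
      unfolding sum.union_disjoint[OF fin disj] by (simp only: distrib_left distrib_right add.assoc)
    finally show ?thesis by (simp only: add.assoc)
  qed
  have AB: "T ! k \<le> T ! x" if "x \<in> A" for x
  proof -
    have x: "x < ?n" "box_col lam x = ?j" "box_row lam k \<le> box_row lam x"
      using that unfolding A by blast+
    show ?thesis
    proof (cases "box_row lam k = box_row lam x")
      case True
      then have "x = k" by (intro box_eqI[OF lam x(1) kk(1) _ x(2)] True[symmetric])
      then show ?thesis by simp
    next
      case False
      then have "box_row lam k < box_row lam x" using x(3) by linarith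
      then show ?thesis
        by (intro less_imp_le T(2)[unfolded col_strict_def, rule_format, OF kk(1) x(1) x(2)[symmetric]])
    qed
  qed
  have BA: "T ! x \<le> T ! k'" if "x \<in> B" for x
  proof -
    have x: "x < ?n" "box_col lam x = ?j'" "box_row lam x \<le> box_row lam k'"
      using that unfolding B kk(3) by blast+
    show ?thesis
    proof (cases "box_row lam x = box_row lam k'")
      case True
      then have "x = k'" by (intro box_eqI[OF lam x(1) kk(2) _ x(2)] True)
      then show ?thesis by simp
    next
      case False
      then have "box_row lam x < box_row lam k'" using x(3) by linarith
      then show ?thesis
        by (intro less_imp_le T(2)[unfolded col_strict_def, rule_format, OF x(1) kk(2) x(2)])
    qed
  qed
  have less: "(\<Sum>x\<in>B. T ! x) < (\<Sum>x\<in>B. T ! w x)"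
    by (rule sum_permuted_subset_less[OF fin w AB BA kk(5)])
  have rest: "(\<Sum>x\<in>{..<?n} - (A \<union> B). box_col lam x * T ! w x) = (\<Sum>x\<in>{..<?n} - (A \<union> B). box_col lam x * T ! x)"
    using permutes_not_in[OF w(1)] by (intro sum.cong) auto
  have tot: "(\<Sum>x\<in>A \<union> B. T ! w x) = (\<Sum>x\<in>A \<union> B. T ! x)"
    using sum.permute[OF w(1), of "(!) T"] by (simp add: o_def)
  have "col_weight lam (permute_list w T) = (\<Sum>x<?n. box_col lam x * T ! w x)"
    unfolding col_weight_def by (intro sum.cong refl) (use w' T' in \<open>simp add: permute_list_nth\<close>)
  also have "\<dots> = (\<Sum>x\<in>{..<?n} - (A \<union> B). box_col lam x * T ! x) + ?j * (\<Sum>x\<in>A \<union> B. T ! x) +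
      (?j' - ?j) * (\<Sum>x\<in>B. T ! w x)"
    by (subst split) (simp only: rest tot)
  also have "\<dots> > (\<Sum>x\<in>{..<?n} - (A \<union> B). box_col lam x * T ! x) + ?j * (\<Sum>x\<in>A \<union> B. T ! x) +
      (?j' - ?j) * (\<Sum>x\<in>B. T ! x)"
    using less kk(4) by (simp only: add_less_cancel_left nat_mult_less_cancel1 zero_less_diff)
  finally show ?thesis by (simp only: col_weight_def split)
qed

text \<open>Each rewriting step raises the pair of column weight and row weight lexicographically. A
  transposition within a column keeps the column weight and raises the row weight; a Garnir
  relation, used only for column-strict fillings, raises the column weight. Both weights are bounded
  on fillings, so the process ends at tableaux.\<close>

lemma young_tensor_straightening:
  assumes "T \<in> fillings lam N"
  shows "young_tensor lam v T \<in> fun_space.span (young_tensor lam v ` tableaux lam N)"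
proof -
  let ?n = "part_size lam" and ?S = "fun_space.span (young_tensor lam v ` tableaux lam N)"
  \<comment> \<open>\<open>K\<close> exceeds both weights of every filling, so
    \<open>K * col_weight lam T + row_weight lam T\<close> encodes the lexicographic order in one
    number.\<close>
  define K where "K = Suc (\<Sum>k<?n. (box_row lam k + box_col lam k) * N)"
  define m where "m T = K * col_weight lam T + row_weight lam T" for T
  have bound: "col_weight lam T < K" "row_weight lam T < K" if "T \<in> fillings lam N" for T
  proof -
    have Tk: "T ! k \<le> N" if "k < ?n" for k
      using fillingsD(2)[OF \<open>T \<in> fillings lam N\<close> that] by simp
    have "col_weight lam T \<le> (\<Sum>k<?n. (box_row lam k + box_col lam k) * N)"
      unfolding col_weight_def by (intro sum_mono mult_le_mono le_add2 Tk) (rule lessThan_iff[THEN iffD1])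
    moreover have "row_weight lam T \<le> (\<Sum>k<?n. (box_row lam k + box_col lam k) * N)"
      unfolding row_weight_def by (intro sum_mono mult_le_mono le_add1 Tk) (rule lessThan_iff[THEN iffD1])
    ultimately show "col_weight lam T < K" "row_weight lam T < K"
      by (simp_all only: K_def less_Suc_eq_le)
  qed
  have m_bound: "m T < K * K + K" if "T \<in> fillings lam N" for T
    unfolding m_def
  proof (rule add_le_less_mono)
    show "K * col_weight lam T \<le> K * K" using bound(1)[OF that] by (intro mult_le_mono) simp_all
  qed (rule bound(2)[OF that])
  have m_col: "m T < m T'" if "col_weight lam T < col_weight lam T'" "T \<in> fillings lam N" for T T'
  proof -
    have "m T < K * Suc (col_weight lam T)" using bound[OF that(2)] by (simp add: m_def)
    also have "\<dots> \<le> K * col_weight lam T'" using that(1) by (intro mult_le_mono) simp_all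
    finally show ?thesis by (simp add: m_def)
  qed
  show ?thesis
    using assms
  proof (induction "K * K + K - m T" arbitrary: T rule: less_induct)
    case less
    have T: "length T = ?n" using less.prems by (simp add: fillings_def)
    have IH: "young_tensor lam v T' \<in> ?S" if "m T < m T'" "T' \<in> fillings lam N" for T'
    proof (rule less.hyps[OF _ that(2)])
      show "K * K + K - m T' < K * K + K - m T"
        using that(1) m_bound[OF that(2)] by linarith
    qed
    consider "T \<in> tableaux lam N" | "\<not> col_strict lam T" | "col_strict lam T" "\<not> row_weak lam T"
      using less.prems by (auto simp: tableaux_def)
    then show ?case
    proof cases
      case 1
      then show ?thesis by (intro fun_space.span_base) auto
    next
      case 2
      then obtain k k' where k: "k < ?n" "k' < ?n" "box_col lam k = box_col lam k'"
          "box_row lam k < box_row lam k'" "T ! k' \<le> T ! k"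
        by (auto simp: col_strict_def not_less)
      let ?t = "Transposition.transpose k k'"
      have t: "?t \<in> col_group lam"
        unfolding col_group_eq using k by (intro transpose_in_stab_group) auto
      have tp: "?t permutes {..<?n}" using k by (simp add: permutes_swap_id)
      have "k \<noteq> k'" using k by auto
      then have y: "young_tensor lam v (permute_list ?t T) = fscale (-1) (young_tensor lam v T)"
        using young_tensor_col[OF t T] by (simp add: sign_swap_id)
      have "young_tensor lam v (permute_list ?t T) \<in> ?S"
      proof (cases "T ! k = T ! k'")
        case True
        \<comment> \<open>A filling with a repeated entry in a column is fixed by an odd column
          permutation, so its tensor equals its own negative and vanishes.\<close>
        have "permute_list ?t T = T"
          by (rule nth_equalityI) (use True tp T in \<open>auto simp: permute_list_nth Transposition.transpose_def\<close>)
        then have "young_tensor lam v T = 0"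
          using y by (auto simp: fscale_def fun_eq_iff)
        then show ?thesis using y by (simp add: fun_space.span_zero)
      next
        case False
        have "m T < m (permute_list ?t T)"
          using row_weight_transpose[OF T k(1,2,4)] col_weight_col_group[OF t T] k(5) False
          by (simp add: m_def)
        then show ?thesis using permute_list_fillings[OF tp less.prems] by (rule IH)
      qed
      then have "fscale (-1) (young_tensor lam v (permute_list ?t T)) \<in> ?S" by (rule fun_space.span_scale)
      then show ?thesis by (simp add: y fscale_def)
    next
      case 3
      then obtain k k' where k: "k < ?n" "k' < ?n" "box_row lam k = box_row lam k'"
          "box_col lam k < box_col lam k'" "T ! k' < T ! k"
        by (auto simp: row_weak_def not_le)
      define A where "A = {x. x < ?n \<and> box_col lam x = box_col lam k \<and> box_row lam k \<le> box_row lam x}"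
      define B where "B = {x. x < ?n \<and> box_col lam x = box_col lam k' \<and> box_row lam x \<le> box_row lam k}"
      let ?P = "{w. w permutes A \<union> B}" and ?f = "\<lambda>w. fscale (of_int (sign w)) (young_tensor lam v (permute_list w T))"
      have sub: "A \<union> B \<subseteq> {..<?n}" unfolding A_def B_def by auto
      have finP: "finite ?P" by (rule finite_permutations) (use sub finite_subset in blast)
      have disj: "A \<inter> B = {}" unfolding A_def B_def using k(4) by auto
      have "(\<Sum>w\<in>?P. ?f w) = 0"
        by (rule young_tensor_garnir[OF T sub garnir_pigeonhole[OF k(1-4)]]) (auto simp: A_def B_def)
      moreover have "(\<Sum>w\<in>?P. ?f w) = (\<Sum>w\<in>?P \<inter> {w. w ` B = B}. ?f w) + (\<Sum>w\<in>?P - {w. w ` B = B}. ?f w)"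
        by (rule sum.Int_Diff[OF finP])
      \<comment> \<open>A permutation preserving \<open>B\<close> also preserves \<open>A\<close>,
        hence both columns. Its sign cancels against the sign of the column relation, so each such
        term reproduces the tensor of \<open>T\<close>.\<close>
      moreover have "?f w = young_tensor lam v T" if w: "w \<in> ?P \<inter> {w. w ` B = B}" for w
      proof -
        have wAB: "w permutes A \<union> B" and wB: "w ` B = B" using w by simp_all
        have wp: "w permutes {..<?n}" by (rule permutes_subset[OF wAB sub])
        have "box_col lam (w x) = box_col lam x" if "x < ?n" for x
        proof -
          consider "x \<in> A" | "x \<in> B" | "x \<notin> A \<union> B" by auto
          then show ?thesis
          proof cases
            case 1
            have "w x \<in> A \<union> B" using 1 permutes_in_image[OF wAB, of x] by blast
            moreover have "w x \<notin> B"
            proof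
              assume "w x \<in> B"
              then have "w x \<in> w ` B" by (simp only: wB)
              then obtain b where "b \<in> B" "w x = w b" by blast
              then have "x \<in> B" using inj_eq[OF permutes_inj[OF wp]] by simp
              then show False using 1 disj by blast
            qed
            ultimately have "w x \<in> A" by blast
            then show ?thesis using 1 by (auto simp: A_def)
          next
            case 2
            then have "w x \<in> w ` B" by (rule imageI)
            then have "w x \<in> B" by (simp only: wB)
            then show ?thesis using 2 by (auto simp: B_def)
          next
            case 3
            then show ?thesis using permutes_not_in[OF wAB, of x] by simp
          qed
        qed
        then have "w \<in> col_group lam" using wp by (auto simp: col_group_eq stab_group_def)
        moreover have "of_int (sign w) * of_int (sign w) = (1 :: complex)"
          unfolding of_int_mult[symmetric] by simp
        ultimately show ?thesis by (simp add: fscale_def young_tensor_col[OF _ T] mult.assoc[symmetric])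
      qed
      then have "(\<Sum>w\<in>?P \<inter> {w. w ` B = B}. ?f w) = fscale (of_nat (card (?P \<inter> {w. w ` B = B}))) (young_tensor lam v T)"
        by (simp add: fun_eq_iff fscale_def)
      ultimately have eq: "fscale (of_nat (card (?P \<inter> {w. w ` B = B}))) (young_tensor lam v T) = - (\<Sum>w\<in>?P - {w. w ` B = B}. ?f w)"
        by (simp add: eq_neg_iff_add_eq_0)
      have "(\<Sum>w\<in>?P - {w. w ` B = B}. ?f w) \<in> ?S"
      proof (intro fun_space.span_sum fun_space.span_scale IH)
        fix w assume w: "w \<in> ?P - {w. w ` B = B}"
        have wAB: "w permutes A \<union> B" and wB: "w ` B \<noteq> B" using w by simp_all
        show "m T < m (permute_list w T)"
          using m_col[OF col_weight_garnir_less[OF less.prems 3(1) k A_def B_def wAB wB] less.prems] .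
        show "permute_list w T \<in> fillings lam N"
          by (intro permute_list_fillings less.prems permutes_subset[OF wAB sub])
      qed
      then have in_S: "fscale (of_nat (card (?P \<inter> {w. w ` B = B}))) (young_tensor lam v T) \<in> ?S"
        unfolding eq by (rule fun_space.span_neg)
      \<comment> \<open>The tensor of \<open>T\<close> occurs in the relation with a positive
        integer multiplicity, since the identity is one of these permutations; it can be divided out
        over the complex numbers.\<close>
      define X where "X = ?P \<inter> {w. w ` B = B}"
      have "id \<in> X" by (simp add: X_def permutes_id)
      moreover have "finite X" using finP by (simp add: X_def)
      ultimately have "card X \<noteq> 0" by auto
      then have "of_nat (card X) \<noteq> (0 :: complex)" by simp
      then show ?thesis using in_S unfolding X_def[symmetric] by (rule span_fscale_cancel)
    qed
  qed
qed

end

section \<open>The basis of semistandard tableaux\<close>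

text \<open>Listed in the order of \<open>key\<close>, the values of \<open>f\<close> and those of
  \<open>f\<close> after \<open>p\<close> form two sorted lists with the same multiset of entries,
  and a multiset has only one sorted list.\<close>

lemma monotone_rearrangement_unique:
  fixes f :: "'a \<Rightarrow> nat" and key :: "'a \<Rightarrow> nat"
  assumes fin: "finite X" and p: "bij_betw p X X" and key: "inj_on key X"
    and f: "\<And>x y. x \<in> X \<Longrightarrow> y \<in> X \<Longrightarrow> key x < key y \<Longrightarrow> f x \<le> f y"
    and fp: "\<And>x y. x \<in> X \<Longrightarrow> y \<in> X \<Longrightarrow> key x < key y \<Longrightarrow> f (p x) \<le> f (p y)"
    and x: "x \<in> X"
  shows "f (p x) = f x"
proof -
  define ks where "ks = sorted_list_of_set (key ` X)"
  define e where "e = inv_into X key"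
  have set_ks: "set ks = key ` X" using fin by (simp add: ks_def)
  have e: "e (key y) = y" if "y \<in> X" for y
    unfolding e_def by (rule inv_into_f_f[OF key that])
  have mset_ks: "mset ks = image_mset key (mset_set X)"
    using mset_set_set[of ks] set_ks image_mset_mset_set[OF key] by (simp add: ks_def)
  have srt: "sorted (map (\<lambda>k. g (e k)) ks)"
    if g: "\<And>x y. x \<in> X \<Longrightarrow> y \<in> X \<Longrightarrow> key x < key y \<Longrightarrow> g x \<le> g y" for g :: "'a \<Rightarrow> nat"
    unfolding sorted_map
  proof (rule sorted_wrt_mono_rel)
    show "sorted_wrt (<) ks" by (simp add: ks_def)
    fix a b assume "a \<in> set ks" "b \<in> set ks" "a < b"
    then show "g (e a) \<le> g (e b)" using g e by (auto simp: set_ks)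
  qed
  have mset_g: "mset (map (\<lambda>k. g (e k)) ks) = image_mset g (mset_set X)" for g :: "'a \<Rightarrow> nat"
  proof -
    have "mset (map (\<lambda>k. g (e k)) ks) = image_mset (\<lambda>x. g (e (key x))) (mset_set X)"
      by (simp add: mset_ks image_mset.compositionality o_def)
    also have "\<dots> = image_mset g (mset_set X)"
      using e fin by (intro image_mset_cong) simp
    finally show ?thesis .
  qed
  have "image_mset (\<lambda>x. f (p x)) (mset_set X) = image_mset f (image_mset p (mset_set X))"
    by (simp add: image_mset.compositionality o_def)
  also have "image_mset p (mset_set X) = mset_set X"
    using image_mset_mset_set[OF bij_betw_imp_inj_on[OF p]] bij_betw_imp_surj_on[OF p] by simp
  finally have "mset (map (\<lambda>k. f (p (e k))) ks) = mset (map (\<lambda>k. f (e k)) ks)"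
    using mset_g[of f] mset_g[of "\<lambda>x. f (p x)"] by simp
  then have "map (\<lambda>k. f (p (e k))) ks = map (\<lambda>k. f (e k)) ks"
    using properties_for_sort[OF _ srt[of "\<lambda>x. f (p x)", OF fp]] sorted_sort_id[OF srt[of f, OF f]] by simp
  then have "f (p (e k)) = f (e k)" if "k \<in> set ks" for k using that by simp
  from this[of "key x"] show ?thesis using x by (simp add: set_ks e)
qed

lemma stab_group_rearrangement_unique:
  fixes T :: "nat list" and cl key :: "nat \<Rightarrow> nat"
  assumes p: "p \<in> stab_group n cl" and T: "length T = n"
    and key: "\<And>x y. x < n \<Longrightarrow> y < n \<Longrightarrow> cl x = cl y \<Longrightarrow> key x = key y \<Longrightarrow> x = y"
    and mono: "\<And>x y. x < n \<Longrightarrow> y < n \<Longrightarrow> cl x = cl y \<Longrightarrow> key x < key y \<Longrightarrow> T ! x \<le> T ! y"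
    and mono': "\<And>x y. x < n \<Longrightarrow> y < n \<Longrightarrow> cl x = cl y \<Longrightarrow> key x < key y \<Longrightarrow>
      permute_list p T ! x \<le> permute_list p T ! y"
  shows "permute_list p T = T"
proof (rule nth_equalityI)
  note pD = stab_groupD[OF p]
  have nth: "permute_list p T ! x = T ! p x" if "x < n" for x
    using that pD(1) T by (simp add: permute_list_nth)
  fix k assume "k < length (permute_list p T)"
  then have k: "k < n" using T by simp
  let ?X = "{x. x < n \<and> cl x = cl k}"
  have bij: "bij_betw p ?X ?X"
  proof -
    have "inj_on p ?X" using permutes_inj[OF pD(1)] by (rule inj_on_subset) simp
    moreover have "p ` ?X \<subseteq> ?X" using pD(2,3) by auto
    ultimately show ?thesis
      by (simp add: bij_betw_def endo_inj_surj)
  qed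
  have "T ! p k = T ! k"
  proof (rule monotone_rearrangement_unique[where X = ?X and key = key and f = "(!) T" and p = p])
    show "inj_on key ?X" using key by (auto simp: inj_on_def)
    fix x y assume xy: "x \<in> ?X" "y \<in> ?X" "key x < key y"
    then show "T ! x \<le> T ! y" using mono by simp
    show "T ! p x \<le> T ! p y" using mono'[of x y] xy by (simp add: nth)
  qed (use bij k in simp_all)
  then show "permute_list p T ! k = T ! k" using k by (simp add: nth)
qed simp

lemma col_strictD:
  "col_strict lam T \<Longrightarrow> k < part_size lam \<Longrightarrow> k' < part_size lam \<Longrightarrow> box_col lam k = box_col lam k' \<Longrightarrow>
    box_row lam k < box_row lam k' \<Longrightarrow> T ! k < T ! k'"
  unfolding col_strict_def by simp

lemma row_weakD:
  "row_weak lam T \<Longrightarrow> k < part_size lam \<Longrightarrow> k' < part_size lam \<Longrightarrow> box_row lam k = box_row lam k' \<Longrightarrow>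
    box_col lam k < box_col lam k' \<Longrightarrow> T ! k \<le> T ! k'"
  unfolding row_weak_def by simp

context
  fixes lam :: "nat \<Rightarrow> nat"
  assumes lam: "is_partition lam"
begin

lemma col_strict_unique:
  assumes "c \<in> col_group lam" "length T = part_size lam" "col_strict lam T" "col_strict lam (permute_list c T)"
  shows "permute_list c T = T"
proof (rule stab_group_rearrangement_unique[where key = "box_row lam"])
  show "c \<in> stab_group (part_size lam) (box_col lam)" using assms(1) by (simp add: col_group_eq)
  show "x = y" if "x < part_size lam" "y < part_size lam" "box_col lam x = box_col lam y" "box_row lam x = box_row lam y" for x y
    using box_eqI[OF lam that(1,2,4,3)] .
  show "length T = part_size lam" by fact
qed (use col_strictD[OF assms(3)] col_strictD[OF assms(4)] in \<open>simp_all add: less_imp_le\<close>)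

lemma row_weak_unique:
  assumes "p \<in> row_group lam" "length T = part_size lam" "row_weak lam T" "row_weak lam (permute_list p T)"
  shows "permute_list p T = T"
proof (rule stab_group_rearrangement_unique[where key = "box_col lam"])
  show "p \<in> stab_group (part_size lam) (box_row lam)" using assms(1) by (simp add: row_group_eq)
  show "x = y" if "x < part_size lam" "y < part_size lam" "box_row lam x = box_row lam y" "box_col lam x = box_col lam y" for x y
    using box_eqI[OF lam that] .
  show "length T = part_size lam" by fact
qed (use row_weakD[OF assms(3)] row_weakD[OF assms(4)] in simp_all)

lemma col_strict_inj:
  assumes "col_strict lam T" "k < part_size lam" "k' < part_size lam" "box_col lam k = box_col lam k'" "T ! k = T ! k'"
  shows "k = k'"
proof (cases "box_row lam k" "box_row lam k'" rule: linorder_cases)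
  case equal
  then show ?thesis using box_eqI[OF lam assms(2,3) _ assms(4)] by simp
next
  case less
  then have "T ! k < T ! k'" by (rule col_strictD[OF assms(1-4)])
  then show ?thesis using assms(5) by simp
next
  case greater
  then have "T ! k' < T ! k" by (rule col_strictD[OF assms(1,3,2) assms(4)[symmetric]])
  then show ?thesis using assms(5) by simp
qed

text \<open>Among the column rearrangements of \<open>T\<close>, one of maximal row weight has no inversions in its
  columns, hence it is \<open>T\<close>.\<close>

lemma row_weight_col_group_le:
  assumes T: "length T = part_size lam" "col_strict lam T" and c: "c \<in> col_group lam"
  shows "row_weight lam (permute_list c T) \<le> row_weight lam T"
    and "row_weight lam (permute_list c T) = row_weight lam T \<Longrightarrow> permute_list c T = T"
proof -
  let ?C = "col_group lam" and ?n = "part_size lam"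
  let ?f = "\<lambda>c. row_weight lam (permute_list c T)"
  have max_eq: "permute_list c T = T" if c: "c \<in> ?C" and max: "\<And>c'. c' \<in> ?C \<Longrightarrow> ?f c' \<le> ?f c" for c
  proof (rule col_strict_unique[OF c T])
    note cD = stab_groupD[OF c[unfolded col_group_eq]]
    have nth: "permute_list c T ! k = T ! c k" if "k < ?n" for k
      using that cD(1) T by (simp add: permute_list_nth)
    show "col_strict lam (permute_list c T)"
    proof (rule ccontr)
      assume "\<not> ?thesis"
      then obtain k k' where k: "k < ?n" "k' < ?n" "box_col lam k = box_col lam k'"
          "box_row lam k < box_row lam k'" "permute_list c T ! k' \<le> permute_list c T ! k"
        by (auto simp: col_strict_def not_less)
      have "permute_list c T ! k' \<noteq> permute_list c T ! k"
      proof
        assume "permute_list c T ! k' = permute_list c T ! k"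
        then have Tc: "T ! c k' = T ! c k" by (simp only: nth k)
        have "box_col lam (c k') = box_col lam (c k)" by (simp only: cD(2) k)
        from col_strict_inj[OF T(2) cD(3)[OF k(2)] cD(3)[OF k(1)] this Tc]
        have "k' = k" by (simp only: inj_eq[OF permutes_inj[OF cD(1)]])
        then show False using k(4) by simp
      qed
      with k(5) have gt: "permute_list c T ! k' < permute_list c T ! k" by simp
      let ?t = "Transposition.transpose k k'"
      have t: "?t \<in> ?C" unfolding col_group_eq using k by (intro transpose_in_stab_group) auto
      have tp: "?t permutes {..<length T}" using k T by (simp add: permutes_swap_id)
      have "?f c < row_weight lam (permute_list ?t (permute_list c T))"
        using T k gt by (intro row_weight_transpose) auto
      also have "permute_list ?t (permute_list c T) = permute_list (c \<circ> ?t) T"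
        by (rule permute_list_compose[OF tp, symmetric])
      finally have "?f c < ?f (c \<circ> ?t)" .
      moreover have "c \<circ> ?t \<in> ?C" using c t unfolding col_group_eq by (rule comp_in_stab_group)
      ultimately show False using max[of "c \<circ> ?t"] by simp
    qed
  qed
  have "finite (?f ` ?C)" "?f ` ?C \<noteq> {}"
    using c by (auto simp: col_group_eq)
  then have "Max (?f ` ?C) \<in> ?f ` ?C" and Max: "\<And>c'. c' \<in> ?C \<Longrightarrow> ?f c' \<le> Max (?f ` ?C)"
    by (auto intro: Max_in)
  then obtain c0 where c0: "c0 \<in> ?C" "?f c0 = Max (?f ` ?C)" by auto
  have "permute_list c0 T = T" using max_eq[OF c0(1)] Max c0(2) by simp
  then have M: "Max (?f ` ?C) = row_weight lam T" using c0(2) by simp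
  show "?f c \<le> row_weight lam T" using Max[OF c] M by simp
  show "permute_list c T = T" if "?f c = row_weight lam T"
    using max_eq[OF c] Max that M by simp
qed

context
  fixes v :: "nat \<Rightarrow> 'i \<Rightarrow> complex" and s :: "nat \<Rightarrow> 'i" and N :: nat
  assumes dual: "\<And>i j. i < N \<Longrightarrow> j < N \<Longrightarrow> v j (s i) = (if i = j then 1 else 0)"
begin

text \<open>The index \<open>s i\<close> reads off the coordinate dual to \<open>v i\<close>, so a
  pure tensor evaluated at \<open>map s S\<close> tests whether its filling is \<open>S\<close>. The
  evaluation becomes a signed count of pairs of row and column permutations.\<close>

lemma young_tensor_eval:
  assumes T: "T \<in> fillings lam N" and S: "S \<in> fillings lam N"
  shows "young_tensor lam v T (map s S) =
    young_sum lam (\<lambda>w. if permute_list w S = T then 1 else 0)"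
proof -
  have "pure_tensor (map v T) (permute_list (p \<circ> q) (map s S)) = (if permute_list (p \<circ> q) S = T then 1 else 0)"
    if p: "p \<in> row_group lam" and q: "q \<in> col_group lam" for p q
  proof -
    have pq: "(p \<circ> q) permutes {..<part_size lam}"
      using p q stab_groupD(1) permutes_compose unfolding row_group_eq col_group_eq by blast
    define S' where "S' = permute_list (p \<circ> q) S"
    have S': "S' \<in> fillings lam N" unfolding S'_def by (rule permute_list_fillings[OF pq S])
    have len: "length T = part_size lam" "length S' = part_size lam" "length S = part_size lam"
      using T S S' by (auto simp: fillings_def)
    have "permute_list (p \<circ> q) (map s S) = map s S'"
      unfolding S'_def using pq len by (intro permute_list_map) simp
    then have "pure_tensor (map v T) (permute_list (p \<circ> q) (map s S)) = (\<Prod>k<part_size lam. if S' ! k = T ! k then 1 else 0)"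
      using len fillingsD(2)[OF T] fillingsD(2)[OF S'] by (auto simp: pure_tensor_def dual intro!: prod.cong)
    also have "\<dots> = (if S' = T then 1 else 0)"
      using len by (auto simp: list_eq_iff_nth_eq)
    finally show ?thesis by (simp add: S'_def)
  qed
  then show ?thesis by (simp add: young_tensor_def young_symmetrizer_eq young_sum_def)
qed

text \<open>The hypothesis says that a row rearrangement of \<open>S\<close> is a column
  rearrangement of \<open>T\<close>. The former keeps the row weight, the latter cannot raise it. In
  the case of equality the column rearrangement is trivial, row weakness gives \<open>S = T\<close>,
  and \<open>q\<close> is the identity because the entries of a column are distinct.\<close>

lemma permute_tableaux:
  assumes T: "T \<in> tableaux lam N" and S: "S \<in> tableaux lam N"
    and pq: "p \<in> row_group lam" "q \<in> col_group lam" "permute_list (p \<circ> q) S = T"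
  shows "row_weight lam S < row_weight lam T \<or> (S = T \<and> q = id)"
proof -
  let ?n = "part_size lam"
  have len: "length T = ?n" "length S = ?n" using S T by (auto simp: tableaux_def fillings_def)
  have T': "col_strict lam T" "row_weak lam T" and S': "row_weak lam S" using S T by (auto simp: tableaux_def)
  note qD = stab_groupD[OF pq(2)[unfolded col_group_eq]]
  have qi: "Hilbert_Choice.inv q \<in> col_group lam" using pq(2) unfolding col_group_eq by (rule inv_in_stab_group)
  have "permute_list (Hilbert_Choice.inv q) T = permute_list (Hilbert_Choice.inv q) (permute_list (p \<circ> q) S)"
    using pq(3) by simp
  also have "\<dots> = permute_list (p \<circ> q \<circ> Hilbert_Choice.inv q) S"
    using permutes_inv[OF qD(1)] len by (intro permute_list_compose[symmetric]) simp
  also have "p \<circ> q \<circ> Hilbert_Choice.inv q = p"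
    by (simp add: o_assoc[symmetric] permutes_inv_o[OF qD(1)])
  finally have eq: "permute_list (Hilbert_Choice.inv q) T = permute_list p S" .
  have w: "row_weight lam S = row_weight lam (permute_list (Hilbert_Choice.inv q) T)"
    unfolding eq by (rule row_weight_row_group[OF pq(1) len(2), symmetric])
  show ?thesis
  proof (cases "row_weight lam S = row_weight lam T")
    case False
    then show ?thesis using row_weight_col_group_le(1)[OF len(1) T'(1) qi] w by simp
  next
    case True
    then have qT: "permute_list (Hilbert_Choice.inv q) T = T"
      using row_weight_col_group_le(2)[OF len(1) T'(1) qi] w by simp
    then have pS: "permute_list p S = T" using eq by simp
    then have "permute_list p S = S" using row_weak_unique[OF pq(1) len(2) S'] T'(2) by simp
    then have "S = T" using pS by simp
    moreover have "Hilbert_Choice.inv q k = k" for k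
    proof (cases "k < ?n")
      case k: True
      note qiD = stab_groupD[OF qi[unfolded col_group_eq]]
      have "T ! Hilbert_Choice.inv q k = permute_list (Hilbert_Choice.inv q) T ! k"
        using k len qiD(1) by (simp add: permute_list_nth)
      then have "T ! Hilbert_Choice.inv q k = T ! k" by (simp only: qT)
      then show ?thesis by (rule col_strict_inj[OF T'(1) qiD(3)[OF k] k qiD(2)[OF k]])
    next
      case False
      then show ?thesis using permutes_not_in[OF permutes_inv[OF qD(1)], of k] by simp
    qed
    then have "q = id" using permutes_inv_inv[OF qD(1)] by (metis eq_id_iff inv_id)
    ultimately show ?thesis by simp
  qed
qed

lemma young_tensor_eval_triangular:
  assumes T: "T \<in> tableaux lam N" and S: "S \<in> tableaux lam N" and nz: "young_tensor lam v T (map s S) \<noteq> 0"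
  shows "row_weight lam S < row_weight lam T \<or> S = T"
proof (rule ccontr)
  assume *: "\<not> ?thesis"
  have "young_tensor lam v T (map s S) = young_sum lam (\<lambda>w. if permute_list w S = T then 1 else 0)"
    using S T by (intro young_tensor_eval) (auto simp: tableaux_def)
  also have "\<dots> = 0"
    unfolding young_sum_def using permute_tableaux[OF T S] * by (intro sum.neutral ballI) auto
  finally show False using nz by simp
qed

text \<open>Only the identity of the column group contributes, so all signs are positive and nothing
  cancels: the value counts the row permutations fixing \<open>T\<close>.\<close>

lemma young_tensor_eval_diagonal:
  assumes T: "T \<in> tableaux lam N"
  shows "young_tensor lam v T (map s T) \<noteq> 0"
proof -
  let ?P = "{p \<in> row_group lam. permute_list p T = T}"
  have id: "id \<in> row_group lam" "id \<in> col_group lam"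
    by (simp_all add: row_group_eq col_group_eq id_in_stab_group)
  have fin: "finite (row_group lam)" "finite (col_group lam)"
    by (simp_all add: row_group_eq col_group_eq)
  have "young_tensor lam v T (map s T) = young_sum lam (\<lambda>w. if permute_list w T = T then 1 else 0)"
    using T by (intro young_tensor_eval) (auto simp: tableaux_def)
  also have "\<dots> = (\<Sum>p\<in>row_group lam. \<Sum>q\<in>col_group lam. if q = id then (if permute_list p T = T then 1 else 0) else 0)"
    unfolding young_sum_def using permute_tableaux[OF T T] by (intro sum.cong refl) auto
  also have "\<dots> = of_nat (card ?P)"
    using fin id by (simp add: sum.If_cases Int_def)
  finally have eq: "young_tensor lam v T (map s T) = of_nat (card ?P)" .
  have "id \<in> ?P" using id by simp
  then have "card ?P \<noteq> 0" using fin by auto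
  then show ?thesis unfolding eq by simp
qed

text \<open>Among the tableaux with nonzero coefficient let \<open>S\<close> have maximal row
  weight. By triangularity, evaluating the relation at \<open>map s S\<close> leaves only the
  diagonal term of \<open>S\<close>.\<close>

lemma young_tensor_independent:
  assumes fin: "finite A" and A: "A \<subseteq> tableaux lam N" and zero: "(\<Sum>T\<in>A. fscale (a T) (young_tensor lam v T)) = 0"
    and T: "T \<in> A"
  shows "a T = 0"
proof (rule ccontr)
  let ?B = "{T \<in> A. a T \<noteq> 0}"
  assume "a T \<noteq> 0"
  then have B: "finite ?B" "?B \<noteq> {}" using fin T by auto
  have "Max (row_weight lam ` ?B) \<in> row_weight lam ` ?B" using B by (intro Max_in) auto
  then obtain S where S: "S \<in> ?B" and SM: "row_weight lam S = Max (row_weight lam ` ?B)" by auto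
  have S_max: "row_weight lam T \<le> row_weight lam S" if "T \<in> ?B" for T
    unfolding SM using B that by (intro Max_ge) auto
  have "0 = (\<Sum>T\<in>A. fscale (a T) (young_tensor lam v T)) (map s S)" by (simp add: zero)
  also have "\<dots> = (\<Sum>T\<in>A. a T * young_tensor lam v T (map s S))"
    using fin by (induction rule: finite_induct) (auto simp: fscale_def)
  also have "\<dots> = (\<Sum>T\<in>A. if T = S then a S * young_tensor lam v S (map s S) else 0)"
  proof (intro sum.cong refl)
    fix T assume "T \<in> A"
    show "a T * young_tensor lam v T (map s S) = (if T = S then a S * young_tensor lam v S (map s S) else 0)"
    proof (cases "a T = 0 \<or> T = S")
      case False
      then have "young_tensor lam v T (map s S) = 0"
        using young_tensor_eval_triangular[of T S] S_max[of T] S A \<open>T \<in> A\<close> by fastforce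
      then show ?thesis using False by simp
    qed (use S in auto)
  qed
  also have "\<dots> = a S * young_tensor lam v S (map s S)" using fin S by simp
  also have "\<dots> \<noteq> 0" using S young_tensor_eval_diagonal[of S] A by auto
  finally show False by simp
qed

end

end

section \<open>Spanning sets of tensor powers and Schur functors\<close>

interpretation fun_pair: vector_space_pair
  "fscale :: complex \<Rightarrow> ('i \<Rightarrow> complex) \<Rightarrow> 'i \<Rightarrow> complex" "fscale :: complex \<Rightarrow> ('j \<Rightarrow> complex) \<Rightarrow> 'j \<Rightarrow> complex"
  ..

lemma linear_young_symmetrizer: "Vector_Spaces.linear fscale fscale (young_symmetrizer lam)"
  unfolding Vector_Spaces.linear_iff
  by (auto simp: fun_space.vector_space_axioms fun_eq_iff young_symmetrizer_def fscale_def
      algebra_simps sum.distrib sum_distrib_left)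

lemma pure_tensor_middle:
  "pure_tensor (us @ x # ws) is = (if length is = Suc (length us + length ws)
     then x (is ! length us) * (\<Prod>k\<in>{..<Suc (length us + length ws)} - {length us}. ((us @ x # ws) ! k) (is ! k)) else 0)"
proof -
  have "(\<Prod>k<Suc (length us + length ws). ((us @ x # ws) ! k) (is ! k)) = x (is ! length us) *
      (\<Prod>k\<in>{..<Suc (length us + length ws)} - {length us}. ((us @ x # ws) ! k) (is ! k))"
    by (subst prod.remove[of _ "length us"]) (auto simp: nth_append)
  then show ?thesis by (simp add: pure_tensor_def del: prod.lessThan_Suc)
qed

lemma pure_tensor_middle_others:
  "(\<Prod>k\<in>{..<Suc (length us + length ws)} - {length us}. ((us @ x # ws) ! k) (is ! k)) =
   (\<Prod>k\<in>{..<Suc (length us + length ws)} - {length us}. ((us @ y # ws) ! k) (is ! k))"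
  by (intro prod.cong) (auto simp: nth_append nth_Cons split: nat.split)

lemma pure_tensor_add: "pure_tensor (us @ (x + y) # ws) = pure_tensor (us @ x # ws) + pure_tensor (us @ y # ws)"
proof
  fix "is"
  show "pure_tensor (us @ (x + y) # ws) is = (pure_tensor (us @ x # ws) + pure_tensor (us @ y # ws)) is"
    unfolding plus_fun_apply pure_tensor_middle
      pure_tensor_middle_others[where x = "x + y" and y = x] pure_tensor_middle_others[where x = y and y = x]
    by (simp add: distrib_right)
qed

lemma pure_tensor_scale: "pure_tensor (us @ fscale c x # ws) = fscale c (pure_tensor (us @ x # ws))"
proof
  fix "is"
  show "pure_tensor (us @ fscale c x # ws) is = fscale c (pure_tensor (us @ x # ws)) is"
    unfolding fscale_def[of c "pure_tensor _"] pure_tensor_middle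
      pure_tensor_middle_others[where x = "fscale c x" and y = x]
    by (simp add: fscale_def)
qed

lemma pure_tensor_zero: "pure_tensor (us @ 0 # ws) = 0"
  by (auto simp: fun_eq_iff pure_tensor_middle)

text \<open>The factors are expanded one at a time from the right. The suffix \<open>map v S\<close>
  of factors that are already expanded grows during the induction, hence the generalization over
  \<open>S\<close>.\<close>

lemma pure_tensor_in_span:
  assumes "set us \<subseteq> fun_space.span (v ` {..<N})" "set S \<subseteq> {..<N}"
  shows "pure_tensor (us @ map v S) \<in>
    fun_space.span {pure_tensor (map v T) | T. length T = length us + length S \<and> set T \<subseteq> {..<N}}"
  using assms
proof (induction us arbitrary: S rule: rev_induct)
  case Nil
  then show ?case by (intro fun_space.span_base) auto
next
  case (snoc x us)
  let ?S = "fun_space.span {pure_tensor (map v T) | T. length T = Suc (length us + length S) \<and> set T \<subseteq> {..<N}}"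
  have "x \<in> fun_space.span (v ` {..<N})" using snoc.prems by simp
  then have "pure_tensor (us @ x # map v S) \<in> ?S"
  proof (induction rule: fun_space.span_induct_alt)
    case base
    show ?case unfolding pure_tensor_zero by (rule fun_space.span_zero)
  next
    case (step c x y)
    then obtain j where j: "j < N" "x = v j" by auto
    have "pure_tensor (us @ map v (j # S)) \<in> ?S"
      using snoc.IH[of "j # S"] snoc.prems j by simp
    then have "pure_tensor (us @ x # map v S) \<in> ?S" using j by simp
    then show ?case unfolding pure_tensor_add pure_tensor_scale
      by (intro fun_space.span_add fun_space.span_scale step)
  qed
  then show ?case by simp
qed

lemma tensor_power_span:
  "tensor_power n (fun_space.span (v ` {..<N})) =
    fun_space.span ((\<lambda>T. pure_tensor (map v T)) ` {T. length T = n \<and> set T \<subseteq> {..<N}})"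
proof
  let ?V = "fun_space.span (v ` {..<N})"
  have eq: "(\<lambda>T. pure_tensor (map v T)) ` {T. length T = n \<and> set T \<subseteq> {..<N}} =
     {pure_tensor (map v T) | T. length T = n \<and> set T \<subseteq> {..<N}}" by auto
  show "tensor_power n ?V \<subseteq> fun_space.span ((\<lambda>T. pure_tensor (map v T)) ` {T. length T = n \<and> set T \<subseteq> {..<N}})"
    unfolding tensor_power_def eq
  proof (rule fun_space.span_minimal)
    show "{pure_tensor vs |vs. length vs = n \<and> set vs \<subseteq> ?V} \<subseteq>
       fun_space.span {pure_tensor (map v T) | T. length T = n \<and> set T \<subseteq> {..<N}}"
      using pure_tensor_in_span[of _ v N "[]"] by auto
  qed simp
  show "fun_space.span ((\<lambda>T. pure_tensor (map v T)) ` {T. length T = n \<and> set T \<subseteq> {..<N}}) \<subseteq> tensor_power n ?V"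
    unfolding tensor_power_def
  proof (intro fun_space.span_mono image_subsetI)
    fix T assume T: "T \<in> {T. length T = n \<and> set T \<subseteq> {..<N}}"
    have "set (map v T) \<subseteq> ?V" using T fun_space.span_base[of _ "v ` {..<N}"] by auto
    then show "pure_tensor (map v T) \<in> {pure_tensor vs |vs. length vs = n \<and> set vs \<subseteq> ?V}"
      using T by (auto intro!: exI[of _ "map v T"])
  qed
qed

text \<open>Used twice: with the standard basis of the two-dimensional space for the inner functor,
  and with the resulting basis of weight vectors for the outer one.\<close>

theorem schur_span:
  assumes lam: "is_partition lam"
  shows "schur lam (fun_space.span (v ` {..<N})) = fun_space.span (young_tensor lam v ` tableaux lam N)"
proof -
  have "schur lam (fun_space.span (v ` {..<N})) = fun_space.span (young_symmetrizer lam ` ((\<lambda>T. pure_tensor (map v T)) ` fillings lam N))"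
    unfolding schur_def tensor_power_span fillings_def
    by (rule fun_pair.linear_span_image[OF linear_young_symmetrizer, symmetric])
  also have "\<dots> = fun_space.span (young_tensor lam v ` fillings lam N)"
    unfolding image_image by (intro arg_cong[where f = fun_space.span] image_cong refl) (simp only: young_tensor_def)
  also have "\<dots> = fun_space.span (young_tensor lam v ` tableaux lam N)"
  proof
    show "fun_space.span (young_tensor lam v ` fillings lam N) \<subseteq> fun_space.span (young_tensor lam v ` tableaux lam N)"
      using young_tensor_straightening[OF lam] by (intro fun_space.span_minimal) auto
    show "fun_space.span (young_tensor lam v ` tableaux lam N) \<subseteq> fun_space.span (young_tensor lam v ` fillings lam N)"
      by (intro fun_space.span_mono image_mono) (auto simp: tableaux_def)
  qed
  finally show ?thesis .
qed

lemma finite_fillings: "finite (fillings lam N)"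
  using finite_lists_length_eq[of "{..<N}" "part_size lam"] by (simp add: fillings_def conj_commute)

lemma finite_tableaux: "finite (tableaux lam N)"
  by (rule finite_subset[OF _ finite_fillings]) (auto simp: tableaux_def)

section \<open>Semistandard tableaux read along the numbering of the boxes\<close>

definition tableau_of :: "(nat \<Rightarrow> nat) \<Rightarrow> (nat \<times> nat \<Rightarrow> nat) \<Rightarrow> nat list" where
  "tableau_of lam F = map (\<lambda>k. F (box_row lam k, box_col lam k)) [0..<part_size lam]"

lemma sum_list_tableau_of:
  assumes "is_partition lam"
  shows "sum_list (tableau_of lam F) = (\<Sum>u\<in>young_diagram lam. F u)"
proof -
  have "sum_list (tableau_of lam F) = (\<Sum>k<part_size lam. F (box_row lam k, box_col lam k))"
    by (simp add: tableau_of_def sum_list_sum_nth atLeast0LessThan)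
  also have "\<dots> = (\<Sum>u\<in>young_diagram lam. F u)"
    by (rule sum.reindex_bij_betw[OF bij_betw_boxes[OF assms]])
  finally show ?thesis .
qed

lemma bij_betw_tableau_of:
  assumes lam: "is_partition lam"
  shows "bij_betw (tableau_of lam) (ssyt lam N) (tableaux lam N)"
proof (rule bij_betw_imageI)
  let ?n = "part_size lam" and ?Y = "young_diagram lam"
  have nth: "tableau_of lam F ! k = F (box_row lam k, box_col lam k)" if "k < ?n" for F k
    using that by (simp add: tableau_of_def)
  show "inj_on (tableau_of lam) (ssyt lam N)"
  proof (rule inj_onI, rule ext)
    fix F F' and u :: "nat \<times> nat" assume F: "F \<in> ssyt lam N" "F' \<in> ssyt lam N" "tableau_of lam F = tableau_of lam F'"
    obtain i j where u: "u = (i, j)" by (cases u)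
    show "F u = F' u"
    proof (cases "j < lam i")
      case True
      then obtain k where k: "k < ?n" "box_row lam k = i" "box_col lam k = j" by (rule box_exists[OF lam])
      show ?thesis using nth[OF k(1), of F] nth[OF k(1), of F'] F(3) by (simp add: k u)
    next
      case False
      then show ?thesis using ssytD(4)[OF F(1)] ssytD(4)[OF F(2)] by (simp add: u)
    qed
  qed
  show "tableau_of lam ` ssyt lam N = tableaux lam N"
  proof
    show "tableau_of lam ` ssyt lam N \<subseteq> tableaux lam N"
    proof (rule image_subsetI)
      fix F assume F: "F \<in> ssyt lam N"
      have "col_strict lam (tableau_of lam F)"
        unfolding col_strict_def
      proof (intro allI impI)
        fix k k' assume k: "k < ?n" "k' < ?n" "box_col lam k = box_col lam k'" "box_row lam k < box_row lam k'"
        show "tableau_of lam F ! k < tableau_of lam F ! k'"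
          using ssytD(3)[OF F k(4) box_col_less[OF lam k(2)]] by (simp add: nth k)
      qed
      moreover have "row_weak lam (tableau_of lam F)"
        unfolding row_weak_def
      proof (intro allI impI)
        fix k k' assume k: "k < ?n" "k' < ?n" "box_row lam k = box_row lam k'" "box_col lam k < box_col lam k'"
        show "tableau_of lam F ! k \<le> tableau_of lam F ! k'"
          using ssytD(2)[OF F less_imp_le[OF k(4)] box_col_less[OF lam k(2)]] by (simp add: nth k)
      qed
      moreover have "tableau_of lam F \<in> fillings lam N"
        using ssytD(1)[OF F] box_col_less[OF lam] by (auto simp: tableau_of_def fillings_def)
      ultimately show "tableau_of lam F \<in> tableaux lam N" by (simp add: tableaux_def)
    qed
    show "tableaux lam N \<subseteq> tableau_of lam ` ssyt lam N"
    proof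
      fix T assume T: "T \<in> tableaux lam N"
      then have Tf: "T \<in> fillings lam N" and cs: "col_strict lam T" and rw: "row_weak lam T"
        by (auto simp: tableaux_def)
      define pos where "pos i j = (SOME k. k < ?n \<and> box_row lam k = i \<and> box_col lam k = j)" for i j
      have pos: "pos i j < ?n" "box_row lam (pos i j) = i" "box_col lam (pos i j) = j" if "j < lam i" for i j
      proof -
        have "\<exists>k. k < ?n \<and> box_row lam k = i \<and> box_col lam k = j"
          using box_exists[OF lam that] by blast
        from someI_ex[OF this] show "pos i j < ?n" "box_row lam (pos i j) = i" "box_col lam (pos i j) = j"
          by (simp_all add: pos_def)
      qed
      define F where "F = restrict (\<lambda>(i, j). T ! pos i j) ?Y"
      have F: "F (i, j) = T ! pos i j" if "j < lam i" for i j using that by (simp add: F_def)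
      have "F \<in> ssyt lam N"
        unfolding ssyt_def
      proof (intro CollectI conjI allI impI)
        show "F \<in> ?Y \<rightarrow>\<^sub>E {..<N}"
          using fillingsD(2)[OF Tf] pos(1) by (auto simp: F_def young_diagram_def)
        show "F (i, j) \<le> F (i, j')" if "j \<le> j'" "j' < lam i" for i j j'
        proof (cases "j = j'")
          case False
          then have j: "j < lam i" "j < j'" using that by simp_all
          show ?thesis unfolding F[OF j(1)] F[OF that(2)]
            using j(2) by (intro row_weakD[OF rw pos(1)[OF j(1)] pos(1)[OF that(2)]]) (simp_all only: pos[OF j(1)] pos[OF that(2)])
        qed simp
        show "F (i, j) < F (i', j)" if "i < i'" "j < lam i'" for i i' j
        proof -
          have j: "j < lam i" using partition_antimono[OF lam order.refl, of i i'] that by simp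
          show ?thesis unfolding F[OF j] F[OF that(2)]
            using that(1) by (intro col_strictD[OF cs pos(1)[OF j] pos(1)[OF that(2)]]) (simp_all only: pos[OF j] pos[OF that(2)])
        qed
      qed
      moreover have "tableau_of lam F = T"
      proof (rule nth_equalityI)
        show "length (tableau_of lam F) = length T" using fillingsD(1)[OF Tf] by (simp add: tableau_of_def)
        fix k assume "k < length (tableau_of lam F)"
        then have k: "k < ?n" by (simp add: tableau_of_def)
        note p = pos[OF box_col_less[OF lam k]]
        have "pos (box_row lam k) (box_col lam k) = k"
          by (rule box_eqI[OF lam p(1) k p(2,3)])
        then show "tableau_of lam F ! k = T ! k"
          by (simp add: nth[OF k] F[OF box_col_less[OF lam k]])
      qed
      ultimately show "T \<in> tableau_of lam ` ssyt lam N" by blast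
    qed
  qed
qed

lemma card_tableaux_weight:
  assumes lam: "is_partition lam"
  shows "card {T \<in> tableaux lam (d + 1). int (part_size lam * d) - 2 * int (sum_list T) = k} = ssyt_mult lam d k"
proof -
  have "bij_betw (tableau_of lam)
     {F \<in> ssyt lam (d + 1). int (part_size lam * d) - 2 * int (sum_list (tableau_of lam F)) = k}
     {T \<in> tableaux lam (d + 1). int (part_size lam * d) - 2 * int (sum_list T) = k}"
    using bij_betw_tableau_of[OF lam, of "d + 1"] by (auto simp: bij_betw_def inj_on_def)
  from bij_betw_same_card[OF this] show ?thesis
    by (simp add: ssyt_mult_def sum_list_tableau_of[OF lam])
qed

section \<open>Polynomial representations with adjoints\<close>

definition mat2 :: "complex \<Rightarrow> complex \<Rightarrow> complex \<Rightarrow> complex \<Rightarrow> complex^2^2" where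
  "mat2 a b c d = (\<chi> i j. if i = 1 then (if j = 1 then a else b) else (if j = 1 then c else d))"

definition adjoint2 :: "complex^2^2 \<Rightarrow> complex^2^2" where
  "adjoint2 g = (\<chi> i j. cnj (g $ j $ i))"

lemma mat2_nth [simp]:
  "Finite_Cartesian_Product.vec_nth (Finite_Cartesian_Product.vec_nth (mat2 a b c d) 1) 1 = a"
  "Finite_Cartesian_Product.vec_nth (Finite_Cartesian_Product.vec_nth (mat2 a b c d) 1) 2 = b"
  "Finite_Cartesian_Product.vec_nth (Finite_Cartesian_Product.vec_nth (mat2 a b c d) 2) 1 = c"
  "Finite_Cartesian_Product.vec_nth (Finite_Cartesian_Product.vec_nth (mat2 a b c d) 2) 2 = d"
  by (simp_all add: mat2_def)

lemma mat2_cases: obtains a b c d where "g = mat2 a b c d"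
proof
  show "g = mat2 (Finite_Cartesian_Product.vec_nth (Finite_Cartesian_Product.vec_nth g 1) 1) (Finite_Cartesian_Product.vec_nth (Finite_Cartesian_Product.vec_nth g 1) 2)
    (Finite_Cartesian_Product.vec_nth (Finite_Cartesian_Product.vec_nth g 2) 1) (Finite_Cartesian_Product.vec_nth (Finite_Cartesian_Product.vec_nth g 2) 2)"
    by (simp add: Finite_Cartesian_Product.vec_eq_iff forall_2)
qed

lemma mat2_mult: "mat2 a b c d ** mat2 a' b' c' d' = mat2 (a * a' + b * c') (a * b' + b * d') (c * a' + d * c') (c * b' + d * d')"
  by (simp add: Finite_Cartesian_Product.vec_eq_iff forall_2 matrix_matrix_mult_def sum_2)

lemma det_mat2: "Determinants.det (mat2 a b c d) = a * d - b * c"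
  by (simp add: det_2)

lemma adjoint2_mat2: "adjoint2 (mat2 a b c d) = mat2 (cnj a) (cnj c) (cnj b) (cnj d)"
  by (simp add: Finite_Cartesian_Product.vec_eq_iff forall_2 adjoint2_def)

lemma mat2_in_SL2: "mat2 a b c d \<in> SL2 \<longleftrightarrow> a * d - b * c = 1"
  by (simp add: SL2_def det_mat2)

lemma SL2_mult: "g \<in> SL2 \<Longrightarrow> h \<in> SL2 \<Longrightarrow> g ** h \<in> SL2"
  by (simp add: SL2_def det_mul)

lemma SL2_adjoint2: "g \<in> SL2 \<Longrightarrow> adjoint2 g \<in> SL2"
proof (rule mat2_cases[of g])
  fix a b c d assume "g \<in> SL2" "g = mat2 a b c d"
  then have "cnj (a * d - b * c) = cnj 1" by (simp add: mat2_in_SL2)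
  then show "adjoint2 g \<in> SL2" using \<open>g = mat2 a b c d\<close> by (simp add: adjoint2_mat2 mat2_in_SL2 mult.commute)
qed

lemma SL2_one: "mat2 1 0 0 1 \<in> SL2"
  by (simp add: mat2_in_SL2)

text \<open>Because 2 is not a root of unity, the single element \<open>diag(2, 1/2)\<close>
  separates all weights and can replace the whole torus.\<close>

lemma two_power_int_eq_iff: "(2 :: complex) powi m = 2 powi k \<longleftrightarrow> m = k"
proof
  assume "(2 :: complex) powi m = 2 powi k"
  then have "cmod (2 powi m) = cmod (2 powi k)" by simp
  then have "(2 :: real) powi m = 2 powi k" by (simp add: norm_power_int)
  then show "m = k" by (metis linorder_neqE power_int_strict_increasing one_less_numeral_iff semiring_norm(76) less_irrefl)
qed simp

text \<open>\<open>ht i\<close> is the degree of the basis vector \<open>i\<close> in the second basis vector of the standard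
  representation and \<open>deg\<close> is its total degree. Such representations are compatible with taking
  adjoints, that is, they are unitary when restricted to \<open>SU(2)\<close>.\<close>

locale polynomial_rep =
  fixes X :: "'i set" and ht :: "'i \<Rightarrow> nat" and deg :: nat and R :: "complex^2^2 \<Rightarrow> 'i \<Rightarrow> 'i \<Rightarrow> complex"
  assumes finite_X: "finite X"
    and R_supp: "R g i j \<noteq> 0 \<Longrightarrow> i \<in> X \<and> j \<in> X"
    and R_mult: "i \<in> X \<Longrightarrow> k \<in> X \<Longrightarrow> R (g ** h) i k = (\<Sum>j\<in>X. R g i j * R h j k)"
    and R_adjoint: "R (adjoint2 g) i j = cnj (R g j i)"
    and ht_le: "i \<in> X \<Longrightarrow> ht i \<le> deg"
    and R_diag: "i \<in> X \<Longrightarrow> R (mat2 a 0 0 b) i j = (if i = j then a ^ (deg - ht i) * b ^ ht i else 0)"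
    and R_upper: "R (mat2 1 t 0 1) i j \<noteq> 0 \<Longrightarrow> ht i < ht j \<or> i = j"
    and R_upper_diag: "i \<in> X \<Longrightarrow> R (mat2 1 t 0 1) i i = 1"
    and R_continuous: "continuous_on UNIV (\<lambda>g. R g i j)"
begin

definition vectors :: "('i \<Rightarrow> complex) set" where
  "vectors = {x. \<forall>i. i \<notin> X \<longrightarrow> x i = 0}"

definition act :: "complex^2^2 \<Rightarrow> ('i \<Rightarrow> complex) \<Rightarrow> 'i \<Rightarrow> complex" where
  "act g = mat_app (R g)"

definition ip :: "('i \<Rightarrow> complex) \<Rightarrow> ('i \<Rightarrow> complex) \<Rightarrow> complex" where
  "ip x y = (\<Sum>i\<in>X. x i * cnj (y i))"

definition wt :: "'i \<Rightarrow> int" where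
  "wt i = int deg - 2 * int (ht i)"

definition component :: "int \<Rightarrow> ('i \<Rightarrow> complex) \<Rightarrow> 'i \<Rightarrow> complex" where
  "component k x = (\<lambda>i. if wt i = k then x i else 0)"

definition weight_space :: "('i \<Rightarrow> complex) set \<Rightarrow> int \<Rightarrow> ('i \<Rightarrow> complex) set" where
  "weight_space W k = {x \<in> W. component k x = x}"

definition submodule :: "('i \<Rightarrow> complex) set \<Rightarrow> bool" where
  "submodule W \<longleftrightarrow> fun_space.subspace W \<and> W \<subseteq> vectors \<and> (\<forall>g\<in>SL2. \<forall>x\<in>W. act g x \<in> W)"

lemma subspace_vectors: "fun_space.subspace vectors"
  by (simp add: fun_space.subspace_def vectors_def fscale_def)

lemma act_eq: "x \<in> vectors \<Longrightarrow> act g x i = (\<Sum>j\<in>X. R g i j * x j)"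
  unfolding act_def mat_app_def vectors_def using finite_X by (intro sum.mono_neutral_left) auto

lemma act_vectors: "act g x \<in> vectors"
proof -
  have "R g i j = 0" if "i \<notin> X" for i j using R_supp[of g i j] that by blast
  then show ?thesis by (simp add: vectors_def act_def mat_app_def)
qed

lemma act_add: "x \<in> vectors \<Longrightarrow> y \<in> vectors \<Longrightarrow> act g (x + y) = act g x + act g y"
  using fun_space.subspace_add[OF subspace_vectors]
  by (auto simp: fun_eq_iff act_eq distrib_left sum.distrib)

lemma act_scale: "x \<in> vectors \<Longrightarrow> act g (fscale c x) = fscale c (act g x)"
  using fun_space.subspace_scale[OF subspace_vectors]
  by (auto simp: fun_eq_iff act_eq fscale_def sum_distrib_left ac_simps)

lemma act_zero: "act g 0 = 0"
  by (simp add: fun_eq_iff act_def mat_app_def)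

lemma act_mult:
  assumes "x \<in> vectors"
  shows "act (g ** h) x = act g (act h x)"
proof
  fix i
  show "act (g ** h) x i = act g (act h x) i"
  proof (cases "i \<in> X")
    case True
    have "act (g ** h) x i = (\<Sum>k\<in>X. (\<Sum>j\<in>X. R g i j * R h j k) * x k)"
      using True by (simp add: act_eq[OF assms] R_mult)
    also have "\<dots> = (\<Sum>j\<in>X. \<Sum>k\<in>X. R g i j * (R h j k * x k))"
      unfolding sum_distrib_right by (subst sum.swap) (simp add: ac_simps)
    also have "\<dots> = act g (act h x) i"
      by (simp add: act_eq[OF assms] act_eq[OF act_vectors] sum_distrib_left)
    finally show ?thesis .
  qed (use act_vectors in \<open>simp add: vectors_def\<close>)
qed

lemma act_diag: "x \<in> vectors \<Longrightarrow> act (mat2 a 0 0 b) x i = a ^ (deg - ht i) * b ^ ht i * x i"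
proof (cases "i \<in> X")
  case True
  then show "x \<in> vectors \<Longrightarrow> ?thesis"
    using finite_X by (simp add: act_eq R_diag if_distrib[of "\<lambda>c. c * _"] cong: if_cong)
next
  case False
  then show "x \<in> vectors \<Longrightarrow> ?thesis" using act_vectors by (simp add: vectors_def)
qed

lemma act_one: "x \<in> vectors \<Longrightarrow> act (mat2 1 0 0 1) x = x"
  by (simp add: fun_eq_iff act_diag)

lemma act_torus:
  assumes "x \<in> vectors" "a \<noteq> 0"
  shows "act (mat2 a 0 0 (inverse a)) x i = a powi wt i * x i"
proof (cases "i \<in> X")
  case True
  have "a ^ (deg - ht i) * inverse a ^ ht i = a powi wt i"
  proof -
    have "a powi wt i = a powi (int (deg - ht i) - int (ht i))"
      using ht_le[OF True] by (simp add: wt_def of_nat_diff)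
    also have "\<dots> = a ^ (deg - ht i) * inverse a ^ ht i"
      using assms(2) by (simp add: power_int_diff power_inverse divide_inverse)
    finally show ?thesis by simp
  qed
  then show ?thesis by (simp add: act_diag[OF assms(1)])
next
  case False
  then show ?thesis using assms act_vectors by (simp add: vectors_def)
qed

lemma act_torus_eq:
  "x \<in> vectors \<Longrightarrow> act (mat2 2 0 0 (inverse 2)) x = (\<lambda>i. 2 powi wt i * x i)"
  by (rule ext, rule act_torus) simp_all

lemma ip_add_left: "ip (x + y) z = ip x z + ip y z"
  and ip_scale_left: "ip (fscale c x) z = c * ip x z"
  and ip_add_right: "ip z (x + y) = ip z x + ip z y"
  and ip_scale_right: "ip z (fscale c x) = cnj c * ip z x"
  and ip_zero: "ip 0 z = 0" "ip z 0 = 0"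
  by (simp_all add: ip_def fscale_def algebra_simps sum.distrib sum_distrib_left)

lemma ip_diff_left: "ip (x - y) z = ip x z - ip y z"
  and ip_diff_right: "ip z (x - y) = ip z x - ip z y"
  by (simp_all add: ip_def algebra_simps sum_subtractf)

lemma ip_commute: "ip x y = cnj (ip y x)"
  by (simp add: ip_def ac_simps)

lemma ip_self_eq_0: "x \<in> vectors \<Longrightarrow> ip x x = 0 \<longleftrightarrow> x = 0"
proof
  assume x: "x \<in> vectors" and "ip x x = 0"
  then have "complex_of_real (\<Sum>i\<in>X. (cmod (x i))\<^sup>2) = 0"
    by (simp only: ip_def of_real_sum complex_norm_square)
  then have "(\<Sum>i\<in>X. (cmod (x i))\<^sup>2) = 0" by (simp only: of_real_eq_0_iff)
  then have "\<forall>i\<in>X. x i = 0" using finite_X by (simp add: sum_nonneg_eq_0_iff)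
  then show "x = 0" using x by (auto simp: vectors_def fun_eq_iff)
qed (simp add: ip_zero)

text \<open>Since \<open>SL2\<close> is closed under adjoints, this makes orthogonal complements of
  submodules again submodules, which yields complete reducibility without averaging over a compact
  group.\<close>

lemma ip_act:
  assumes "x \<in> vectors" "y \<in> vectors"
  shows "ip (act g x) y = ip x (act (adjoint2 g) y)"
proof -
  have "ip (act g x) y = (\<Sum>i\<in>X. \<Sum>j\<in>X. R g i j * x j * cnj (y i))"
    by (simp add: ip_def act_eq[OF assms(1)] sum_distrib_right)
  also have "\<dots> = (\<Sum>j\<in>X. \<Sum>i\<in>X. R g i j * x j * cnj (y i))" by (rule sum.swap)
  also have "\<dots> = ip x (act (adjoint2 g) y)"
    by (simp add: ip_def act_eq[OF assms(2)] R_adjoint sum_distrib_left ac_simps)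
  finally show ?thesis .
qed

lemma submoduleD:
  assumes "submodule W"
  shows "fun_space.subspace W" "x \<in> W \<Longrightarrow> x \<in> vectors" "g \<in> SL2 \<Longrightarrow> x \<in> W \<Longrightarrow> act g x \<in> W"
  using assms by (auto simp: submodule_def)

text \<open>Lagrange interpolation in the operator of \<open>diag(2, 1/2)\<close> projects onto the weight spaces.\<close>

lemma component_in_submodule:
  assumes W: "submodule W" and x: "x \<in> W"
  shows "component k x \<in> W"
proof -
  note WD = submoduleD[OF W]
  let ?c = "\<lambda>m. 2 powi m :: complex"
  note c_eq = two_power_int_eq_iff
  have "(\<lambda>i. (\<Prod>m\<in>M. (?c (wt i) - ?c m) / (?c k - ?c m)) * x i) \<in> W" if "finite M" for M
    using that
  proof (induction M)
    case empty
    then show ?case using x by simp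
  next
    case (insert m M)
    let ?y = "\<lambda>i. (\<Prod>m\<in>M. (?c (wt i) - ?c m) / (?c k - ?c m)) * x i"
    have y: "?y \<in> W" by (rule insert.IH)
    have "act (mat2 2 0 0 (inverse 2)) ?y \<in> W"
      by (rule WD(3)[OF _ y]) (simp add: mat2_in_SL2)
    then have "fscale (1 / (?c k - ?c m)) (act (mat2 2 0 0 (inverse 2)) ?y - fscale (?c m) ?y) \<in> W"
      by (intro fun_space.subspace_scale[OF WD(1)] fun_space.subspace_diff[OF WD(1)] y)
    also have "fscale (1 / (?c k - ?c m)) (act (mat2 2 0 0 (inverse 2)) ?y - fscale (?c m) ?y) =
      (\<lambda>i. (\<Prod>m\<in>insert m M. (?c (wt i) - ?c m) / (?c k - ?c m)) * x i)"
      unfolding act_torus_eq[OF WD(2)[OF y]] using insert.hyps by (simp add: fun_eq_iff fscale_def field_simps)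
    finally show ?case .
  qed
  then have "(\<lambda>i. (\<Prod>m\<in>wt ` X - {k}. (?c (wt i) - ?c m) / (?c k - ?c m)) * x i) \<in> W"
    using finite_X by simp
  also have "(\<lambda>i. (\<Prod>m\<in>wt ` X - {k}. (?c (wt i) - ?c m) / (?c k - ?c m)) * x i) = component k x"
  proof
    fix i
    show "(\<Prod>m\<in>wt ` X - {k}. (?c (wt i) - ?c m) / (?c k - ?c m)) * x i = component k x i"
    proof (cases "i \<in> X")
      case True
      have "(\<Prod>m\<in>wt ` X - {k}. (?c (wt i) - ?c m) / (?c k - ?c m)) = (if wt i = k then 1 else 0)"
        using True finite_X by (auto simp: c_eq intro!: prod.neutral)
      then show ?thesis by (simp add: component_def)
    next
      case False
      then show ?thesis using WD(2)[OF x] by (simp add: vectors_def component_def)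
    qed
  qed
  finally show ?thesis .
qed

lemma weight_spaceD: "x \<in> weight_space W k \<Longrightarrow> x \<in> W" "x \<in> weight_space W k \<Longrightarrow> x i \<noteq> 0 \<Longrightarrow> wt i = k"
  by (auto simp: weight_space_def component_def fun_eq_iff split: if_splits)

lemma component_in_weight_space: "submodule W \<Longrightarrow> x \<in> W \<Longrightarrow> component k x \<in> weight_space W k"
  using component_in_submodule by (auto simp: weight_space_def component_def)

lemma subspace_weight_space: "submodule W \<Longrightarrow> fun_space.subspace (weight_space W k)"
  using fun_space.subspace_add[OF submoduleD(1)] fun_space.subspace_scale[OF submoduleD(1)] fun_space.subspace_0[OF submoduleD(1)]
  by (auto simp: fun_space.subspace_def weight_space_def component_def fun_eq_iff fscale_def)

text \<open>Weight vectors are described by the action of one group element. Thus an equivariant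
  injection preserves and reflects them, although \<open>component\<close> refers to
  coordinates.\<close>

lemma weight_space_iff:
  assumes "x \<in> vectors" "x \<in> W"
  shows "x \<in> weight_space W k \<longleftrightarrow> act (mat2 2 0 0 (inverse 2)) x = fscale (2 powi k) x"
proof -
  have "component k x = x \<longleftrightarrow> (\<forall>i. x i \<noteq> 0 \<longrightarrow> wt i = k)"
    by (auto simp: component_def fun_eq_iff)
  then show ?thesis
    using assms(2) unfolding act_torus_eq[OF assms(1)] by (auto simp: weight_space_def fun_eq_iff fscale_def two_power_int_eq_iff)
qed

lemma sum_components:
  assumes "x \<in> vectors"
  shows "x = (\<Sum>k\<in>wt ` X. component k x)"
proof
  fix i
  have "(\<Sum>k\<in>K. component k x) i = (\<Sum>k\<in>K. component k x i)" for K
    by (induction K rule: infinite_finite_induct) auto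
  moreover have "(\<Sum>k\<in>wt ` X. component k x i) = x i"
    using assms finite_X by (cases "i \<in> X") (auto simp: component_def vectors_def)
  ultimately show "x i = (\<Sum>k\<in>wt ` X. component k x) i" by simp
qed

end

lemma continuous_on_mat2 [continuous_intros]:
  assumes "continuous_on S a" "continuous_on S b" "continuous_on S c" "continuous_on S d"
  shows "continuous_on S (\<lambda>e. mat2 (a e) (b e) (c e) (d e))"
  unfolding mat2_def
proof (intro continuous_on_vec_lambda)
  fix i j :: 2
  show "continuous_on S (\<lambda>e. if i = 1 then if j = 1 then a e else b e else if j = 1 then c e else d e)"
    using assms by (cases "i = 1"; cases "j = 1") simp_all
qed

section \<open>Orthogonal projections and complements of submodules\<close>

context polynomial_rep
begin

lemma vectors_subset_span: "vectors \<subseteq> fun_space.span ((\<lambda>i j. if j = i then 1 else 0) ` X)"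
proof
  fix x assume x: "x \<in> vectors"
  have "(\<Sum>i\<in>X. fscale (x i) (\<lambda>j. if j = i then 1 else 0)) \<in> fun_space.span ((\<lambda>i j. if j = i then 1 else 0) ` X)"
    by (intro fun_space.span_sum fun_space.span_scale fun_space.span_base) auto
  also have "(\<Sum>i\<in>X. fscale (x i) (\<lambda>j. if j = i then 1 else 0)) = x"
  proof
    fix j
    have "(\<Sum>i\<in>I. fscale (x i) (\<lambda>j. if j = i then 1 else 0)) j = (\<Sum>i\<in>I. if j = i then x i else 0)" for I
      by (induction I rule: infinite_finite_induct) (auto simp: fscale_def)
    then show "(\<Sum>i\<in>X. fscale (x i) (\<lambda>j. if j = i then 1 else 0)) j = x j"
      using x finite_X by (auto simp: vectors_def)
  qed
  finally show "x \<in> fun_space.span ((\<lambda>i j. if j = i then 1 else 0) ` X)" .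
qed

lemma finite_basis:
  assumes "fun_space.subspace S" "S \<subseteq> vectors"
  obtains B where "finite B" "B \<subseteq> S" "fun_space.independent B" "fun_space.span B = S" "card B = fun_space.dim S"
proof -
  obtain B where B: "B \<subseteq> S" "fun_space.independent B" "S \<subseteq> fun_space.span B" "card B = fun_space.dim S"
    by (rule fun_space.basis_exists)
  have "B \<subseteq> fun_space.span ((\<lambda>i j. if j = i then 1 else 0) ` X)"
    using B(1) assms(2) vectors_subset_span by blast
  then have "finite B"
    using fun_space.independent_span_bound[OF _ B(2)] finite_X by blast
  moreover have "fun_space.span B = S"
    using B(1,3) fun_space.span_minimal[OF B(1) assms(1)] by blast
  ultimately show ?thesis using that B by blast
qed

lemma dim_pos:
  assumes "fun_space.subspace S" "S \<subseteq> vectors" "x \<in> S" "x \<noteq> 0"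
  shows "fun_space.dim S > 0"
proof -
  obtain B where B: "finite B" "fun_space.span B = S" "card B = fun_space.dim S"
    by (rule finite_basis[OF assms(1,2)])
  have "B \<noteq> {}" using B(2) assms(3,4) by auto
  then show ?thesis using B(1,3) by (metis card_gt_0_iff)
qed

lemma dim_orthogonal_sum:
  assumes A: "fun_space.subspace A" "A \<subseteq> vectors" and B: "fun_space.subspace B" "B \<subseteq> vectors"
    and orth: "\<And>a b. a \<in> A \<Longrightarrow> b \<in> B \<Longrightarrow> ip a b = 0"
    and S: "S = {a + b | a b. a \<in> A \<and> b \<in> B}"
  shows "fun_space.dim S = fun_space.dim A + fun_space.dim B"
proof -
  have int0: "x = 0" if "x \<in> A" "x \<in> B" for x
    using orth[OF that] ip_self_eq_0[of x] that A(2) by blast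
  obtain C where C: "finite C" "C \<subseteq> A" "fun_space.independent C" "fun_space.span C = A" "card C = fun_space.dim A"
    by (rule finite_basis[OF A])
  obtain D where D: "finite D" "D \<subseteq> B" "fun_space.independent D" "fun_space.span D = B" "card D = fun_space.dim B"
    by (rule finite_basis[OF B])
  have disj: "C \<inter> D = {}"
  proof -
    have "x = 0" if "x \<in> C" "x \<in> D" for x using int0 that C(2) D(2) by blast
    moreover have "0 \<notin> C" using C(3) fun_space.dependent_zero by blast
    ultimately show ?thesis by blast
  qed
  have "fun_space.independent (C \<union> D)"
  proof (rule fun_space.independent_if_scalars_zero)
    fix f x assume sum: "(\<Sum>x\<in>C \<union> D. fscale (f x) x) = 0" and x: "x \<in> C \<union> D"
    let ?a = "\<Sum>x\<in>C. fscale (f x) x" and ?b = "\<Sum>x\<in>D. fscale (f x) x"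
    have ab: "?a + ?b = 0" using sum sum.union_disjoint[OF C(1) D(1) disj, of "\<lambda>x. fscale (f x) x"] by simp
    have a: "?a \<in> A" using C(2) by (intro fun_space.subspace_sum[OF A(1)] fun_space.subspace_scale[OF A(1)]) auto
    have b: "?b \<in> B" using D(2) by (intro fun_space.subspace_sum[OF B(1)] fun_space.subspace_scale[OF B(1)]) auto
    have "?a = - ?b" using ab by (simp add: eq_neg_iff_add_eq_0)
    then have "?a = 0" using int0[OF a] fun_space.subspace_neg[OF B(1) b] by simp
    then have "?b = 0" using ab by simp
    from fun_space.independentD[OF C(3) C(1) order.refl \<open>?a = 0\<close>] fun_space.independentD[OF D(3) D(1) order.refl \<open>?b = 0\<close>]
    show "f x = 0" using x by blast
  qed (use C(1) D(1) in simp)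
  moreover have "C \<union> D \<subseteq> S"
  proof -
    have "x \<in> S" if "x \<in> C" for x
      unfolding S using that C(2) fun_space.subspace_0[OF B(1)] by (intro CollectI exI[of _ x] exI[of _ 0]) auto
    moreover have "x \<in> S" if "x \<in> D" for x
      unfolding S using that D(2) fun_space.subspace_0[OF A(1)] by (intro CollectI exI[of _ 0] exI[of _ x]) auto
    ultimately show ?thesis by blast
  qed
  moreover have "S \<subseteq> fun_space.span (C \<union> D)"
    unfolding S using C(4) D(4) fun_space.span_mono[of C "C \<union> D"] fun_space.span_mono[of D "C \<union> D"]
    by (blast intro: fun_space.span_add)
  ultimately have "card (C \<union> D) = fun_space.dim S" by (intro fun_space.basis_card_eq_dim)
  then show ?thesis using C(1,5) D(1,5) disj by (simp add: card_Un_disjoint)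
qed

lemma ip_span_eq_0:
  assumes "y \<in> fun_space.span B" "\<And>b. b \<in> B \<Longrightarrow> ip x b = 0"
  shows "ip x y = 0"
  using assms(1)
proof (induction rule: fun_space.span_induct_alt)
  case base
  show ?case by (rule ip_zero(2))
next
  case (step c b y)
  then show ?case unfolding ip_add_right ip_scale_right by (simp add: assms(2))
qed

lemma orthogonal_projection_span:
  assumes "finite B" "B \<subseteq> vectors" "x \<in> vectors"
  shows "\<exists>z\<in>fun_space.span B. \<forall>b\<in>B. ip (x - z) b = 0"
  using assms
proof (induction B arbitrary: x rule: finite_induct)
  case (insert b B)
  have B: "B \<subseteq> vectors" "b \<in> vectors" using insert.prems by simp_all
  obtain zb where zb: "zb \<in> fun_space.span B" "\<forall>a\<in>B. ip (b - zb) a = 0"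
    using insert.IH[OF B] by blast
  obtain zx where zx: "zx \<in> fun_space.span B" "\<forall>a\<in>B. ip (x - zx) a = 0"
    using insert.IH[OF B(1) insert.prems(2)] by blast
  \<comment> \<open>One Gram-Schmidt step: \<open>b'\<close> is orthogonal to \<open>B\<close>, so
    correcting along it keeps the orthogonality already achieved. If \<open>b'\<close> is zero, then
    \<open>b\<close> lies in the span of \<open>B\<close> and the division yields
    \<open>c = 0\<close>.\<close>
  define b' where "b' = b - zb"
  define c where "c = ip (x - zx) b' / ip b' b'"
  have "zb \<in> vectors" using zb(1) B(1) fun_space.span_minimal[OF B(1) subspace_vectors] by blast
  then have b': "b' \<in> vectors" unfolding b'_def by (intro fun_space.subspace_diff[OF subspace_vectors] B)
  have mono: "fun_space.span B \<subseteq> fun_space.span (insert b B)" by (rule fun_space.span_mono) blast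
  have "zx + fscale c b' \<in> fun_space.span (insert b B)"
    unfolding b'_def
    by (intro fun_space.span_add fun_space.span_scale fun_space.span_diff subsetD[OF mono zb(1)]
        subsetD[OF mono zx(1)] fun_space.span_base[OF insertI1])
  moreover have "ip (x - (zx + fscale c b')) a = 0" if "a \<in> insert b B" for a
  proof -
    have eq: "ip (x - (zx + fscale c b')) y = ip (x - zx) y - c * ip b' y" for y
      by (simp add: ip_diff_left ip_add_left ip_scale_left algebra_simps)
    have B0: "ip (x - (zx + fscale c b')) a = 0" if "a \<in> B" for a
      using zb(2) zx(2) that unfolding eq by (simp add: b'_def)
    have "ip (x - (zx + fscale c b')) b' = 0"
    proof (cases "b' = 0")
      case False
      then show ?thesis using ip_self_eq_0[OF b'] unfolding eq by (simp add: c_def)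
    qed (simp add: ip_zero)
    moreover have "ip (x - (zx + fscale c b')) zb = 0" by (rule ip_span_eq_0[OF zb(1) B0])
    moreover have "b = b' + zb" by (simp add: b'_def)
    ultimately have "ip (x - (zx + fscale c b')) b = 0" by (simp add: ip_add_right)
    then show ?thesis using that B0 by blast
  qed
  ultimately show ?case by blast
qed (auto intro: fun_space.span_zero)

definition orth :: "('i \<Rightarrow> complex) set \<Rightarrow> ('i \<Rightarrow> complex) set \<Rightarrow> ('i \<Rightarrow> complex) set" where
  "orth W Z = {x \<in> W. \<forall>z\<in>Z. ip x z = 0}"

lemma submodule_orth:
  assumes W: "submodule W" and Z: "submodule Z"
  shows "submodule (orth W Z)"
proof -
  note WD = submoduleD[OF W] and ZD = submoduleD[OF Z]
  have "fun_space.subspace (orth W Z)"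
    using fun_space.subspace_0[OF WD(1)] fun_space.subspace_add[OF WD(1)] fun_space.subspace_scale[OF WD(1)]
    by (auto simp: fun_space.subspace_def orth_def ip_add_left ip_scale_left ip_zero)
  moreover have "act g x \<in> orth W Z" if "g \<in> SL2" "x \<in> orth W Z" for g x
    using that WD ZD SL2_adjoint2[OF that(1)] by (auto simp: orth_def ip_act)
  ultimately show ?thesis using WD(2) by (auto simp: submodule_def orth_def)
qed

lemma orth_decomposition:
  assumes W: "submodule W" and Z: "submodule Z" "Z \<subseteq> W" and x: "x \<in> W"
  obtains z y where "z \<in> Z" "y \<in> orth W Z" "x = z + y"
proof -
  note WD = submoduleD[OF W] and ZD = submoduleD[OF Z(1)]
  obtain B where B: "finite B" "B \<subseteq> Z" "fun_space.span B = Z"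
    using finite_basis[OF ZD(1)] ZD(2) by (metis subsetI)
  obtain z where z: "z \<in> Z" "\<forall>b\<in>B. ip (x - z) b = 0"
    using orthogonal_projection_span[OF B(1) _ WD(2)[OF x]] B(2,3) ZD(2) by blast
  have "ip (x - z) y = 0" if "y \<in> Z" for y
    using that z(2) ip_span_eq_0[of y B] B(3) by blast
  then have "x - z \<in> orth W Z"
    using fun_space.subspace_diff[OF WD(1) x] z(1) Z(2) by (auto simp: orth_def)
  then show ?thesis using that[OF z(1)] by simp
qed

lemma orth_disjoint:
  assumes "submodule Z" "x \<in> Z" "x \<in> orth W Z"
  shows "x = 0"
  using assms ip_self_eq_0[OF submoduleD(2)[OF assms(1,2)]] by (simp add: orth_def)

text \<open>Components of vectors in a submodule stay in it, so the orthogonal decomposition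
  restricts to each weight space. This carries equality of multiplicities over to
  complements.\<close>

lemma dim_weight_space_orth:
  assumes W: "submodule W" and Z: "submodule Z" "Z \<subseteq> W"
  shows "fun_space.dim (weight_space W k) = fun_space.dim (weight_space Z k) + fun_space.dim (weight_space (orth W Z) k)"
proof (rule dim_orthogonal_sum)
  note O = submodule_orth[OF W Z(1)]
  show "fun_space.subspace (weight_space Z k)" "fun_space.subspace (weight_space (orth W Z) k)"
    using subspace_weight_space Z(1) O by blast+
  show "weight_space Z k \<subseteq> vectors" "weight_space (orth W Z) k \<subseteq> vectors"
    using submoduleD(2)[OF Z(1)] submoduleD(2)[OF O] by (auto dest: weight_spaceD)
  show "ip a b = 0" if "a \<in> weight_space Z k" "b \<in> weight_space (orth W Z) k" for a b
    using weight_spaceD(1)[OF that(1)] weight_spaceD(1)[OF that(2)] ip_commute[of a b] by (simp add: orth_def)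
  show "weight_space W k = {a + b |a b. a \<in> weight_space Z k \<and> b \<in> weight_space (orth W Z) k}"
  proof
    show "weight_space W k \<subseteq> {a + b |a b. a \<in> weight_space Z k \<and> b \<in> weight_space (orth W Z) k}"
    proof
      fix x assume x: "x \<in> weight_space W k"
      obtain z y where zy: "z \<in> Z" "y \<in> orth W Z" "x = z + y"
        by (rule orth_decomposition[OF W Z weight_spaceD(1)[OF x]])
      have "x = component k x" using x by (simp add: weight_space_def)
      also have "\<dots> = component k z + component k y" by (simp add: zy(3) component_def fun_eq_iff)
      finally have "x = component k z + component k y" .
      then show "x \<in> {a + b |a b. a \<in> weight_space Z k \<and> b \<in> weight_space (orth W Z) k}"
        using component_in_weight_space[OF Z(1) zy(1)] component_in_weight_space[OF O zy(2)] by blast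
    qed
    have "a + b \<in> weight_space W k" if "a \<in> weight_space Z k" "b \<in> weight_space (orth W Z) k" for a b
    proof -
      have "a \<in> weight_space W k" "b \<in> weight_space W k" using that Z(2) by (auto simp: weight_space_def orth_def)
      then show ?thesis by (rule fun_space.subspace_add[OF subspace_weight_space[OF W]])
    qed
    then show "{a + b |a b. a \<in> weight_space Z k \<and> b \<in> weight_space (orth W Z) k} \<subseteq> weight_space W k" by blast
  qed
qed

section \<open>Cyclic submodules and vectors of highest weight\<close>

definition orbit_span :: "('i \<Rightarrow> complex) \<Rightarrow> ('i \<Rightarrow> complex) set" where
  "orbit_span p = fun_space.span ((\<lambda>g. act g p) ` SL2)"

lemma submodule_orbit_span:
  assumes "p \<in> vectors"
  shows "submodule (orbit_span p)"
proof -
  have sub: "orbit_span p \<subseteq> vectors"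
    unfolding orbit_span_def using act_vectors by (intro fun_space.span_minimal subspace_vectors) auto
  have subsp: "fun_space.subspace (orbit_span p)" unfolding orbit_span_def by (rule fun_space.subspace_span)
  have "x \<in> vectors \<and> act h x \<in> orbit_span p" if h: "h \<in> SL2" and x: "x \<in> orbit_span p" for h x
    using x unfolding orbit_span_def[of p]
  proof (rule fun_space.span_induct)
    fix x assume "x \<in> (\<lambda>g. act g p) ` SL2"
    then obtain g where g: "g \<in> SL2" "x = act g p" by auto
    have "act h x = act (h ** g) p" by (simp add: g(2) act_mult[OF assms])
    then have "act h x \<in> fun_space.span ((\<lambda>g. act g p) ` SL2)"
      using SL2_mult[OF h g(1)] by (intro fun_space.span_base) auto
    then show "x \<in> vectors \<and> act h x \<in> fun_space.span ((\<lambda>g. act g p) ` SL2)"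
      using g(2) act_vectors by simp
  next
    show "fun_space.subspace {x. x \<in> vectors \<and> act h x \<in> fun_space.span ((\<lambda>g. act g p) ` SL2)}"
    proof (rule fun_space.subspaceI)
      show "0 \<in> {x. x \<in> vectors \<and> act h x \<in> fun_space.span ((\<lambda>g. act g p) ` SL2)}"
        by (simp only: mem_Collect_eq act_zero fun_space.span_zero fun_space.subspace_0[OF subspace_vectors])
    next
      fix x y assume xy: "x \<in> {x. x \<in> vectors \<and> act h x \<in> fun_space.span ((\<lambda>g. act g p) ` SL2)}"
        "y \<in> {x. x \<in> vectors \<and> act h x \<in> fun_space.span ((\<lambda>g. act g p) ` SL2)}"
      then have "act h (x + y) = act h x + act h y" by (intro act_add) simp_all
      then show "x + y \<in> {x. x \<in> vectors \<and> act h x \<in> fun_space.span ((\<lambda>g. act g p) ` SL2)}"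
        using xy by (simp only: mem_Collect_eq fun_space.span_add fun_space.subspace_add[OF subspace_vectors])
    next
      fix c x assume x: "x \<in> {x. x \<in> vectors \<and> act h x \<in> fun_space.span ((\<lambda>g. act g p) ` SL2)}"
      then have "act h (fscale c x) = fscale c (act h x)" by (intro act_scale) simp_all
      then show "fscale c x \<in> {x. x \<in> vectors \<and> act h x \<in> fun_space.span ((\<lambda>g. act g p) ` SL2)}"
        using x by (simp only: mem_Collect_eq fun_space.span_scale fun_space.subspace_scale[OF subspace_vectors])
    qed
  qed
  then show ?thesis using sub subsp by (simp add: submodule_def)
qed

lemma orbit_span_subset:
  assumes "submodule W" "p \<in> W"
  shows "orbit_span p \<subseteq> W"
  unfolding orbit_span_def using submoduleD[OF assms(1)] assms(2)
  by (intro fun_space.span_minimal) auto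

lemma in_orbit_span: "p \<in> vectors \<Longrightarrow> p \<in> orbit_span p"
  unfolding orbit_span_def by (intro fun_space.span_base image_eqI[where x = "mat2 1 0 0 1"])
    (simp_all add: act_one SL2_one)

text \<open>An upper unipotent matrix adds to a basis vector only terms of smaller
  \<open>ht\<close>, that is, of larger weight. Applied to \<open>p\<close>, the added terms have
  weights above \<open>n\<close>, and their components lie in \<open>W\<close>, where there are no
  such weights.\<close>

lemma top_weight_fixed:
  assumes W: "submodule W" and p: "p \<in> weight_space W n" and top: "\<And>k. k > n \<Longrightarrow> weight_space W k \<subseteq> {0}"
  shows "act (mat2 1 t 0 1) p = p"
proof
  fix i
  let ?y = "act (mat2 1 t 0 1) p"
  have pW: "p \<in> W" and pv: "p \<in> vectors" using weight_spaceD(1)[OF p] submoduleD(2)[OF W] by blast+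
  have yW: "?y \<in> W" by (rule submoduleD(3)[OF W _ pW]) (simp add: mat2_in_SL2)
  have terms: "R (mat2 1 t 0 1) i j * p j = 0" if "j \<in> X" "j \<noteq> i" "wt i \<le> n" for j
  proof (cases "p j = 0")
    case False
    then have "ht j \<le> ht i" using weight_spaceD(2)[OF p False] that(3) by (simp add: wt_def)
    then have "\<not> R (mat2 1 t 0 1) i j \<noteq> 0" using R_upper[of t i j] that(2) by auto
    then show ?thesis by simp
  qed simp
  show "?y i = p i"
  proof (cases "i \<in> X")
    case True
    show ?thesis
    proof (cases "wt i \<le> n")
      case le: True
      have "?y i = (\<Sum>j\<in>X. if j = i then p i else 0)"
        unfolding act_eq[OF pv] using terms[OF _ _ le] R_upper_diag[OF True] by (intro sum.cong) auto
      then show ?thesis using True finite_X by simp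
    next
      case False
      then have "component (wt i) ?y = 0"
        using top[of "wt i"] component_in_weight_space[OF W yW, of "wt i"] by auto
      then have "?y i = 0" by (auto simp: component_def fun_eq_iff split: if_splits)
      moreover have "p i = 0" using False weight_spaceD(2)[OF p, of i] by auto
      ultimately show ?thesis by simp
    qed
  next
    case False
    then show ?thesis using pv submoduleD(2)[OF W yW] by (simp add: vectors_def)
  qed
qed

text \<open>In the factorization into lower unipotent, diagonal and upper unipotent parts, the upper
  part fixes \<open>p\<close> directly. The lower part moves to the other side of the inner product,
  where its adjoint is upper unipotent and fixes \<open>p\<close> as well.\<close>

lemma matrix_coefficient:
  assumes pv: "p \<in> vectors" and wt: "\<And>i. p i \<noteq> 0 \<Longrightarrow> wt i = n" and fixed: "\<And>t. act (mat2 1 t 0 1) p = p"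
    and g: "mat2 a b c d \<in> SL2" "a \<noteq> 0"
  shows "ip (act (mat2 a b c d) p) p = a powi n * ip p p"
proof -
  let ?l = "mat2 1 0 (c / a) 1" and ?D = "mat2 a 0 0 (inverse a)" and ?u = "mat2 1 (b / a) 0 1"
  have "d = c * b / a + inverse a" using g by (simp add: mat2_in_SL2 field_simps)
  then have "mat2 a b c d = ?l ** (?D ** ?u)" using g(2) by (simp add: mat2_mult)
  then have "ip (act (mat2 a b c d) p) p = ip (act ?l (act ?D (act ?u p))) p"
    by (simp only: act_mult[OF pv] act_mult[OF act_vectors])
  also have "\<dots> = ip (act ?D p) (act (adjoint2 ?l) p)"
    unfolding fixed by (rule ip_act[OF act_vectors pv])
  also have "\<dots> = ip (act ?D p) p" by (simp add: adjoint2_mat2 fixed)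
  also have "act ?D p = fscale (a powi n) p"
  proof
    fix i
    show "act ?D p i = fscale (a powi n) p i"
      using wt[of i] by (cases "p i = 0") (simp_all add: act_torus[OF pv g(2)] fscale_def)
  qed
  finally show ?thesis by (simp add: ip_scale_left)
qed

text \<open>The curve is \<open>mat2 a b c d ** mat2 1 0 e 1\<close>. Its determinant is constant,
  and for \<open>a = 0\<close> and \<open>b \<noteq> 0\<close> its upper left entry vanishes only at
  \<open>e = 0\<close>.\<close>

lemma continuous_coefficient:
  assumes "p \<in> vectors"
  shows "continuous_on UNIV (\<lambda>e. ip (act (mat2 (a + b * e) b (c + d * e) d) p) q)"
proof -
  have R: "continuous_on UNIV (\<lambda>e. R (mat2 (a + b * e) b (c + d * e) d) i j)" for i j
    by (rule continuous_on_compose2[OF R_continuous]) (auto intro!: continuous_intros)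
  show ?thesis
    unfolding ip_def act_eq[OF assms] by (intro continuous_intros R)
qed

end

section \<open>Isomorphism of modules with equal weights\<close>

lemma dim_linear_image:
  fixes \<phi> :: "('i \<Rightarrow> complex) \<Rightarrow> 'j \<Rightarrow> complex"
  assumes lin: "Vector_Spaces.linear fscale fscale \<phi>" and S: "fun_space.subspace S" and inj: "inj_on \<phi> S"
  shows "fun_space.dim (\<phi> ` S) = fun_space.dim S"
proof -
  obtain B where B: "B \<subseteq> S" "fun_space.independent B" "S \<subseteq> fun_space.span B" "card B = fun_space.dim S"
    by (rule fun_space.basis_exists)
  have span: "fun_space.span B = S"
    using B(1,3) fun_space.span_minimal[OF B(1) S] by blast
  have "fun_space.independent (\<phi> ` B)"
    using inj unfolding span[symmetric] by (rule fun_pair.linear_independent_injective_image[OF lin B(2)])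
  moreover have "\<phi> ` S \<subseteq> fun_space.span (\<phi> ` B)"
    unfolding fun_pair.linear_span_image[OF lin] span ..
  ultimately have "card (\<phi> ` B) = fun_space.dim (\<phi> ` S)"
    using B(1) by (intro fun_space.basis_card_eq_dim image_mono)
  moreover have "card (\<phi> ` B) = card B" by (rule card_image[OF inj_on_subset[OF inj B(1)]])
  ultimately show ?thesis using B(4) by simp
qed

context polynomial_rep
begin

lemma ip_self_real: "ip x x = complex_of_real (\<Sum>i\<in>X. (cmod (x i))\<^sup>2)"
  by (simp only: ip_def of_real_sum complex_norm_square)

lemma unit_vector:
  assumes S: "fun_space.subspace S" "S \<subseteq> vectors" and x: "x \<in> S" "x \<noteq> 0"
  obtains y where "y \<in> S" "y \<noteq> 0" "ip y y = 1"
proof -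
  define r where "r = (\<Sum>i\<in>X. (cmod (x i))\<^sup>2)"
  have "ip x x \<noteq> 0" using ip_self_eq_0[of x] S(2) x by blast
  moreover have ip_x: "ip x x = complex_of_real r" by (simp only: ip_self_real r_def)
  ultimately have "r \<noteq> 0" by auto
  moreover have "r \<ge> 0" unfolding r_def by (intro sum_nonneg) simp
  ultimately have r: "r > 0" by simp
  let ?y = "fscale (complex_of_real (1 / sqrt r)) x"
  have "ip ?y ?y = complex_of_real (1 / sqrt r * (1 / sqrt r) * r)"
    by (simp only: ip_scale_left ip_scale_right ip_x complex_cnj_complex_of_real of_real_mult mult.assoc)
  also have "1 / sqrt r * (1 / sqrt r) * r = 1" using r by (simp add: field_simps flip: power2_eq_square)
  finally have "ip ?y ?y = 1" by simp
  moreover from this have "?y \<noteq> 0" using ip_zero by fastforce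
  moreover have "?y \<in> S" by (rule fun_space.subspace_scale[OF S(1) x(1)])
  ultimately show ?thesis using that by blast
qed

lemma weight_space_trivial_iff:
  assumes "submodule W"
  shows "fun_space.dim (weight_space W k) = 0 \<longleftrightarrow> weight_space W k \<subseteq> {0}"
proof
  assume 0: "fun_space.dim (weight_space W k) = 0"
  have sub: "weight_space W k \<subseteq> vectors" using submoduleD(2)[OF assms] by (auto dest: weight_spaceD)
  show "weight_space W k \<subseteq> {0}"
    using 0 dim_pos[OF subspace_weight_space[OF assms] sub] by fastforce
next
  assume "weight_space W k \<subseteq> {0}"
  then have "weight_space W k \<subseteq> fun_space.span {}" by simp
  then show "fun_space.dim (weight_space W k) = 0"
    using fun_space.dim_le_card[of "weight_space W k" "{}"] by simp
qed

lemma submodule_trivial: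
  assumes W: "submodule W" and triv: "\<And>k. weight_space W k \<subseteq> {0}"
  shows "W = {0}"
proof -
  have "x = 0" if "x \<in> W" for x
  proof -
    have "component k x = 0" for k using component_in_weight_space[OF W that, of k] triv by blast
    then have "(\<Sum>k\<in>wt ` X. component k x) = 0" by (intro sum.neutral) blast
    then show ?thesis using sum_components[OF submoduleD(2)[OF W that]] by (simp only:)
  qed
  then show ?thesis using fun_space.subspace_0[OF submoduleD(1)[OF W]] by blast
qed

end

locale rep_pair = A: polynomial_rep X1 ht1 deg1 R1 + B: polynomial_rep X2 ht2 deg2 R2
  for X1 :: "'i set" and ht1 deg1 R1 and X2 :: "'j set" and ht2 deg2 R2
begin

text \<open>Linear relations between the \<open>a g\<close> are determined by their inner products,
  so equal Gram matrices make the assignment of \<open>b g\<close> to \<open>a g\<close> consistent.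
  The map is defined on a maximal independent subfamily and then shown to have the right values on
  the others.\<close>

lemma gram_extension:
  fixes a :: "'g \<Rightarrow> 'i \<Rightarrow> complex" and b :: "'g \<Rightarrow> 'j \<Rightarrow> complex"
  assumes a: "\<And>g. g \<in> J \<Longrightarrow> a g \<in> A.vectors" and b: "\<And>g. g \<in> J \<Longrightarrow> b g \<in> B.vectors"
    and gram: "\<And>g h. g \<in> J \<Longrightarrow> h \<in> J \<Longrightarrow> A.ip (a g) (a h) = B.ip (b g) (b h)"
  obtains \<phi> where "Vector_Spaces.linear fscale fscale \<phi>" and "\<And>g. g \<in> J \<Longrightarrow> \<phi> (a g) = b g"
    and "\<And>x y. x \<in> fun_space.span (a ` J) \<Longrightarrow> y \<in> fun_space.span (a ` J) \<Longrightarrow> B.ip (\<phi> x) (\<phi> y) = A.ip x y"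
proof -
  obtain C where C: "C \<subseteq> a ` J" "fun_space.independent C" "a ` J \<subseteq> fun_space.span C"
    by (rule fun_space.maximal_independent_subset)
  define pre where "pre x = (SOME g. g \<in> J \<and> a g = x)" for x
  have pre: "pre x \<in> J" "a (pre x) = x" if "x \<in> C" for x
  proof -
    have "\<exists>g. g \<in> J \<and> a g = x" using that C(1) by blast
    from someI_ex[OF this] show "pre x \<in> J" "a (pre x) = x" by (simp_all add: pre_def)
  qed
  obtain \<phi> where lin: "Vector_Spaces.linear fscale fscale \<phi>" and \<phi>: "\<And>x. x \<in> C \<Longrightarrow> \<phi> x = b (pre x)"
    using fun_pair.linear_independent_extend[OF C(2), of "\<lambda>x. b (pre x)"] by blast
  note add = fun_pair.linear_add[OF lin] and scale = fun_pair.linear_scale[OF lin] and zero = fun_pair.linear_0[OF lin]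
  \<comment> \<open>One argument still ranges over all of \<open>J\<close>, not just over the chosen
    independent family; this is what determines \<open>\<phi>\<close> at the remaining
    vectors.\<close>
  have left: "B.ip (\<phi> x) (b g) = A.ip x (a g)" if "x \<in> fun_space.span C" "g \<in> J" for x g
    using that(1)
  proof (induction rule: fun_space.span_induct_alt)
    case base
    show ?case unfolding zero A.ip_zero B.ip_zero ..
  next
    case (step c x y)
    then show ?case unfolding add scale A.ip_add_left B.ip_add_left A.ip_scale_left B.ip_scale_left
      using gram[OF pre(1)[OF step(1)] that(2)] by (simp add: \<phi> pre)
  qed
  have iso: "B.ip (\<phi> x) (\<phi> y) = A.ip x y" if "x \<in> fun_space.span C" "y \<in> fun_space.span C" for x y
    using that(2)
  proof (induction rule: fun_space.span_induct_alt)
    case base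
    show ?case unfolding zero A.ip_zero B.ip_zero ..
  next
    case (step c y z)
    then show ?case unfolding add scale A.ip_add_right B.ip_add_right A.ip_scale_right B.ip_scale_right
      using left[OF that(1) pre(1)[OF step(1)]] by (simp add: \<phi> pre)
  qed
  have in_span: "a g \<in> fun_space.span C" if "g \<in> J" for g using C(3) that by blast
  have vec: "\<phi> x \<in> B.vectors" if "x \<in> fun_space.span C" for x
    using that
  proof (induction rule: fun_space.span_induct_alt)
    case base
    show ?case unfolding zero by (rule fun_space.subspace_0[OF B.subspace_vectors])
  next
    case (step c x y)
    then show ?case unfolding add scale \<phi>[OF step(1)]
      by (intro fun_space.subspace_add[OF B.subspace_vectors] fun_space.subspace_scale[OF B.subspace_vectors] b pre)
  qed
  \<comment> \<open>Expanding the squared norm of \<open>\<phi> (a g) - b g\<close> gives four inner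
    products, all equal to that of \<open>a g\<close> with itself, with signs adding up to
    zero.\<close>
  have ext: "\<phi> (a g) = b g" if g: "g \<in> J" for g
  proof -
    have "B.ip (b g) (\<phi> (a g)) = A.ip (a g) (a g)"
      using left[OF in_span[OF g] g] by (metis B.ip_commute A.ip_commute)
    then have "B.ip (\<phi> (a g) - b g) (\<phi> (a g) - b g) = 0"
      unfolding B.ip_diff_left B.ip_diff_right
      using left[OF in_span[OF g] g] iso[OF in_span[OF g] in_span[OF g]] gram[OF g g] by simp
    moreover have "\<phi> (a g) - b g \<in> B.vectors"
      by (intro fun_space.subspace_diff[OF B.subspace_vectors] vec in_span b g)
    ultimately have "\<phi> (a g) - b g = 0" using B.ip_self_eq_0 by blast
    then show ?thesis by (simp only: right_minus_eq)
  qed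
  have "fun_space.span (a ` J) \<subseteq> fun_space.span C"
    by (rule fun_space.span_minimal[OF C(3) fun_space.subspace_span])
  then show ?thesis using that[OF lin ext] iso by blast
qed

definition isometry :: "(('i \<Rightarrow> complex) \<Rightarrow> 'j \<Rightarrow> complex) \<Rightarrow> ('i \<Rightarrow> complex) set \<Rightarrow> ('j \<Rightarrow> complex) set \<Rightarrow> bool" where
  "isometry \<phi> W1 W2 \<longleftrightarrow> Vector_Spaces.linear fscale fscale \<phi> \<and> \<phi> ` W1 = W2 \<and>
     (\<forall>x\<in>W1. \<forall>y\<in>W1. B.ip (\<phi> x) (\<phi> y) = A.ip x y) \<and>
     (\<forall>g\<in>SL2. \<forall>x\<in>W1. \<phi> (A.act g x) = B.act g (\<phi> x))"

lemma isometryD: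
  assumes "isometry \<phi> W1 W2"
  shows "Vector_Spaces.linear fscale fscale \<phi>" "\<phi> ` W1 = W2"
    "x \<in> W1 \<Longrightarrow> y \<in> W1 \<Longrightarrow> B.ip (\<phi> x) (\<phi> y) = A.ip x y"
    "g \<in> SL2 \<Longrightarrow> x \<in> W1 \<Longrightarrow> \<phi> (A.act g x) = B.act g (\<phi> x)"
  using assms by (simp_all add: isometry_def)

lemma isometry_inj_on:
  assumes W1: "A.submodule W1" and iso: "isometry \<phi> W1 W2"
  shows "inj_on \<phi> W1"
proof (rule inj_onI)
  fix x y assume xy: "x \<in> W1" "y \<in> W1" "\<phi> x = \<phi> y"
  note I = isometryD[OF iso]
  have d: "x - y \<in> W1" by (intro fun_space.subspace_diff A.submoduleD[OF W1] xy)
  have "\<phi> (x - y) = 0" using xy(3) fun_pair.linear_diff[OF I(1), of x y] by simp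
  then have "A.ip (x - y) (x - y) = 0" using I(3)[OF d d] by (simp only: B.ip_zero)
  then have "x - y = 0" using A.ip_self_eq_0 A.submoduleD(2)[OF W1 d] by blast
  then show "x = y" by (simp only: right_minus_eq)
qed

lemma equivariant_dim_weight_space:
  assumes W1: "A.submodule W1" and W2: "B.submodule W2" and lin: "Vector_Spaces.linear fscale fscale \<phi>"
    and img: "\<phi> ` W1 = W2" and inj: "inj_on \<phi> W1"
    and act: "\<And>g x. g \<in> SL2 \<Longrightarrow> x \<in> W1 \<Longrightarrow> \<phi> (A.act g x) = B.act g (\<phi> x)"
  shows "fun_space.dim (A.weight_space W1 k) = fun_space.dim (B.weight_space W2 k)"
proof -
  let ?t = "mat2 2 0 0 (inverse 2)"
  have t: "?t \<in> SL2" by (simp add: mat2_in_SL2)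
  have iff: "x \<in> A.weight_space W1 k \<longleftrightarrow> \<phi> x \<in> B.weight_space W2 k" if x: "x \<in> W1" for x
  proof -
    have fx: "\<phi> x \<in> W2" using x img by blast
    have "x \<in> A.weight_space W1 k \<longleftrightarrow> A.act ?t x = fscale (2 powi k) x"
      by (rule A.weight_space_iff[OF A.submoduleD(2)[OF W1 x] x])
    also have "\<dots> \<longleftrightarrow> \<phi> (A.act ?t x) = \<phi> (fscale (2 powi k) x)"
      using inj_on_eq_iff[OF inj A.submoduleD(3)[OF W1 t x] fun_space.subspace_scale[OF A.submoduleD(1)[OF W1] x]] by blast
    also have "\<dots> \<longleftrightarrow> B.act ?t (\<phi> x) = fscale (2 powi k) (\<phi> x)"
      by (simp only: act[OF t x] fun_pair.linear_scale[OF lin])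
    also have "\<dots> \<longleftrightarrow> \<phi> x \<in> B.weight_space W2 k"
      by (rule B.weight_space_iff[OF B.submoduleD(2)[OF W2 fx] fx, symmetric])
    finally show ?thesis .
  qed
  have "\<phi> ` A.weight_space W1 k = B.weight_space W2 k"
  proof
    show "\<phi> ` A.weight_space W1 k \<subseteq> B.weight_space W2 k"
      using iff A.weight_spaceD(1) by blast
    show "B.weight_space W2 k \<subseteq> \<phi> ` A.weight_space W1 k"
    proof
      fix y assume y: "y \<in> B.weight_space W2 k"
      then obtain x where "x \<in> W1" "y = \<phi> x" using img B.weight_spaceD(1) by blast
      then show "y \<in> \<phi> ` A.weight_space W1 k" using iff y by blast
    qed
  qed
  moreover have "inj_on \<phi> (A.weight_space W1 k)"
    using inj by (rule inj_on_subset) (auto dest: A.weight_spaceD)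
  ultimately show ?thesis using dim_linear_image[OF lin A.subspace_weight_space[OF W1]] by metis
qed

text \<open>For \<open>a \<noteq> 0\<close> both sides are \<open>a powi n\<close> times the same
  squared norm. For \<open>a = 0\<close> the entry \<open>b\<close> is nonzero, and \<open>g\<close>
  is a limit of matrices in \<open>SL2\<close> with nonzero upper left entry.\<close>

lemma matrix_coefficients_eq:
  assumes p: "p \<in> A.vectors" "\<And>i. p i \<noteq> 0 \<Longrightarrow> A.wt i = n" "\<And>t. A.act (mat2 1 t 0 1) p = p"
    and q: "q \<in> B.vectors" "\<And>i. q i \<noteq> 0 \<Longrightarrow> B.wt i = n" "\<And>t. B.act (mat2 1 t 0 1) q = q"
    and pq: "A.ip p p = B.ip q q" and g: "g \<in> SL2"
  shows "A.ip (A.act g p) p = B.ip (B.act g q) q"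
proof -
  obtain a b c d where abcd: "g = mat2 a b c d" by (rule mat2_cases)
  have nz: "A.ip (A.act (mat2 a b c d) p) p = B.ip (B.act (mat2 a b c d) q) q"
    if "mat2 a b c d \<in> SL2" "a \<noteq> 0" for a b c d
    using A.matrix_coefficient[OF p that] B.matrix_coefficient[OF q that] pq by simp
  show ?thesis
  proof (cases "a = 0")
    case False
    then show ?thesis using nz g abcd by simp
  next
    case True
    with g abcd have "- (b * c) = 1" by (simp add: mat2_in_SL2)
    then have bc: "b * c = -1" by (metis minus_minus)
    then have "b \<noteq> 0" by auto
    let ?F = "\<lambda>e. A.ip (A.act (mat2 (a + b * e) b (c + d * e) d) p) p - B.ip (B.act (mat2 (a + b * e) b (c + d * e) d) q) q"
    have "continuous_on UNIV ?F"
      by (intro continuous_intros A.continuous_coefficient B.continuous_coefficient p q)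
    then have "isCont ?F 0" by (rule continuous_on_interior) simp
    then have "?F \<midarrow>0\<rightarrow> ?F 0" unfolding isCont_def .
    moreover have "?F e = 0" if "e \<noteq> 0" for e
    proof -
      have "mat2 (a + b * e) b (c + d * e) d \<in> SL2" using bc True by (simp add: mat2_in_SL2 algebra_simps)
      then show ?thesis using nz \<open>b \<noteq> 0\<close> that True by simp
    qed
    then have "?F \<midarrow>0\<rightarrow> 0" by (intro tendsto_eventually) (auto simp: eventually_at_filter)
    ultimately have "?F 0 = 0" by (rule LIM_unique)
    then show ?thesis using abcd by simp
  qed
qed

text \<open>The inner product of \<open>g p\<close> and \<open>h p\<close> is the matrix coefficient
  of \<open>p\<close> at \<open>adjoint2 h ** g\<close>, which lies in \<open>SL2\<close>. Hence the
  two orbits have the same Gram matrix, and the extended map is equivariant because it matches the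
  orbits element by element.\<close>

lemma orbit_isometry:
  assumes p: "p \<in> A.vectors" "\<And>i. p i \<noteq> 0 \<Longrightarrow> A.wt i = n" "\<And>t. A.act (mat2 1 t 0 1) p = p"
    and q: "q \<in> B.vectors" "\<And>i. q i \<noteq> 0 \<Longrightarrow> B.wt i = n" "\<And>t. B.act (mat2 1 t 0 1) q = q"
    and pq: "A.ip p p = B.ip q q"
  obtains \<phi> where "isometry \<phi> (A.orbit_span p) (B.orbit_span q)"
proof -
  let ?a = "\<lambda>g. A.act g p" and ?b = "\<lambda>g. B.act g q"
  have gram: "A.ip (?a g) (?a h) = B.ip (?b g) (?b h)" if gh: "g \<in> SL2" "h \<in> SL2" for g h
  proof -
    have hg: "adjoint2 h ** g \<in> SL2" using gh by (intro SL2_mult SL2_adjoint2)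
    have "A.ip (?a h) (?a g) = A.ip p (A.act (adjoint2 h ** g) p)"
      by (simp only: A.ip_act[OF p(1) A.act_vectors] A.act_mult[OF p(1)])
    moreover have "B.ip (?b h) (?b g) = B.ip q (B.act (adjoint2 h ** g) q)"
      by (simp only: B.ip_act[OF q(1) B.act_vectors] B.act_mult[OF q(1)])
    moreover have "A.ip p (A.act (adjoint2 h ** g) p) = B.ip q (B.act (adjoint2 h ** g) q)"
      using matrix_coefficients_eq[OF p q pq hg] by (metis A.ip_commute B.ip_commute)
    ultimately show ?thesis by (metis A.ip_commute B.ip_commute)
  qed
  obtain \<phi> where \<phi>: "Vector_Spaces.linear fscale fscale \<phi>" "\<And>g. g \<in> SL2 \<Longrightarrow> \<phi> (?a g) = ?b g"
    "\<And>x y. x \<in> fun_space.span (?a ` SL2) \<Longrightarrow> y \<in> fun_space.span (?a ` SL2) \<Longrightarrow> B.ip (\<phi> x) (\<phi> y) = A.ip x y"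
    by (rule gram_extension[of SL2 ?a ?b]) (simp_all only: A.act_vectors B.act_vectors gram)
  note add = fun_pair.linear_add[OF \<phi>(1)] and scale = fun_pair.linear_scale[OF \<phi>(1)] and zero = fun_pair.linear_0[OF \<phi>(1)]
  have img: "\<phi> ` A.orbit_span p = B.orbit_span q"
  proof -
    have "\<phi> ` ?a ` SL2 = ?b ` SL2" using \<phi>(2) by (simp add: image_image)
    then show ?thesis unfolding A.orbit_span_def B.orbit_span_def
      using fun_pair.linear_span_image[OF \<phi>(1), of "?a ` SL2"] by simp
  qed
  have A_orb: "A.submodule (A.orbit_span p)" and B_orb: "B.submodule (B.orbit_span q)"
    using A.submodule_orbit_span[OF p(1)] B.submodule_orbit_span[OF q(1)] .
  have V: "x \<in> A.vectors" "\<phi> x \<in> B.vectors" if "x \<in> fun_space.span (?a ` SL2)" for x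
  proof -
    have x: "x \<in> A.orbit_span p" using that by (simp only: A.orbit_span_def)
    show "x \<in> A.vectors" by (rule A.submoduleD(2)[OF A_orb x])
    have "\<phi> x \<in> B.orbit_span q" unfolding img[symmetric] by (rule imageI[OF x])
    then show "\<phi> x \<in> B.vectors" by (rule B.submoduleD(2)[OF B_orb])
  qed
  have equiv: "\<phi> (A.act h x) = B.act h (\<phi> x)" if h: "h \<in> SL2" and x: "x \<in> fun_space.span (?a ` SL2)" for h x
  proof -
    have "x \<in> fun_space.span (?a ` SL2) \<and> \<phi> (A.act h x) = B.act h (\<phi> x)"
      using x
    proof (induction rule: fun_space.span_induct_alt)
      case base
      show ?case unfolding A.act_zero zero B.act_zero by (intro conjI fun_space.span_zero refl)
    next
      case (step c x y)
      obtain g where g: "g \<in> SL2" "x = ?a g" using step(1) by (rule imageE)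
      have eq: "\<phi> (A.act h x) = B.act h (\<phi> x)"
        by (simp only: \<phi>(2)[OF SL2_mult[OF h g(1)]] \<phi>(2)[OF g(1)] g(2) B.act_mult[OF q(1)] A.act_mult[OF p(1), symmetric])
      have x: "x \<in> fun_space.span (?a ` SL2)" by (rule fun_space.span_base[OF step(1)])
      have cx: "fscale c x \<in> fun_space.span (?a ` SL2)" by (rule fun_space.span_scale[OF x])
      note y = conjunct1[OF step(2)] and yeq = conjunct2[OF step(2)]
      have "\<phi> (A.act h (fscale c x + y)) = fscale c (\<phi> (A.act h x)) + \<phi> (A.act h y)"
        by (subst A.act_add[OF V(1)[OF cx] V(1)[OF y]], subst A.act_scale[OF V(1)[OF x]], subst add, subst scale, rule refl)
      also have "\<dots> = fscale c (B.act h (\<phi> x)) + B.act h (\<phi> y)"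
        by (simp only: eq yeq)
      also have "\<dots> = B.act h (fscale c (\<phi> x) + \<phi> y)"
        by (subst B.act_add[OF fun_space.subspace_scale[OF B.subspace_vectors V(2)[OF x]] V(2)[OF y]],
            subst B.act_scale[OF V(2)[OF x]], rule refl)
      also have "fscale c (\<phi> x) + \<phi> y = \<phi> (fscale c x + y)"
        by (subst add, subst scale, rule refl)
      finally show ?case using fun_space.span_add[OF cx y] by (rule conjI[rotated])
    qed
    then show ?thesis by (rule conjunct2)
  qed
  have "isometry \<phi> (A.orbit_span p) (B.orbit_span q)"
    unfolding isometry_def using \<phi>(1,3) img equiv by (simp add: A.orbit_span_def)
  then show ?thesis by (rule that)
qed

end

context rep_pair
begin

text \<open>\<open>Z1\<close> and its complement together span \<open>W1\<close>, and their cross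
  terms vanish on both sides. The extension of maps with equal Gram matrices thus yields a single
  linear map restricting to both isometries.\<close>

lemma glue_isometries:
  assumes W1: "A.submodule W1" and Z1: "A.submodule Z1" "Z1 \<subseteq> W1"
    and W2: "B.submodule W2" and Z2: "B.submodule Z2" "Z2 \<subseteq> W2"
    and \<phi>: "isometry \<phi> Z1 Z2" and \<psi>: "isometry \<psi> (A.orth W1 Z1) (B.orth W2 Z2)"
  obtains \<Phi> where "isometry \<Phi> W1 W2"
proof -
  let ?Y1 = "A.orth W1 Z1" and ?Y2 = "B.orth W2 Z2"
  note P = isometryD[OF \<phi>] and Q = isometryD[OF \<psi>]
  note Y1 = A.submodule_orth[OF W1 Z1(1)] and Y2 = B.submodule_orth[OF W2 Z2(1)]
  \<comment> \<open>The case distinction is harmless: \<open>Z1\<close> meets its complement only in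
    0, where both maps vanish.\<close>
  define b where "b x = (if x \<in> Z1 then \<phi> x else \<psi> x)" for x
  have b_Z: "b x = \<phi> x" if "x \<in> Z1" for x using that by (simp add: b_def)
  have b_Y: "b x = \<psi> x" if "x \<in> ?Y1" for x
  proof (cases "x \<in> Z1")
    case True
    then have "x = 0" using A.orth_disjoint[OF Z1(1) True that] by simp
    then show ?thesis by (simp only: b_def fun_pair.linear_0[OF P(1)] fun_pair.linear_0[OF Q(1)] if_cancel)
  qed (simp add: b_def)
  have cross: "A.ip x y = B.ip (b x) (b y)" if x: "x \<in> Z1" and y: "y \<in> ?Y1" for x y
  proof -
    have "A.ip y x = 0" using x y by (simp add: A.orth_def)
    moreover have "B.ip (\<psi> y) (\<phi> x) = 0"
    proof -
      have "\<phi> x \<in> Z2" "\<psi> y \<in> ?Y2" using P(2) Q(2) x y by blast+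
      then show ?thesis by (simp add: B.orth_def)
    qed
    ultimately show ?thesis
      unfolding b_Z[OF x] b_Y[OF y] using A.ip_commute[of x y] B.ip_commute[of "\<phi> x" "\<psi> y"] by simp
  qed
  have gram: "A.ip x y = B.ip (b x) (b y)" if xy: "x \<in> Z1 \<union> ?Y1" "y \<in> Z1 \<union> ?Y1" for x y
  proof -
    consider "x \<in> Z1" "y \<in> Z1" | "x \<in> Z1" "y \<in> ?Y1" | "x \<in> ?Y1" "y \<in> Z1" | "x \<in> ?Y1" "y \<in> ?Y1"
      using xy by blast
    then show ?thesis
    proof cases
      case 1
      then show ?thesis by (simp only: b_Z P(3))
    next
      case 2
      then show ?thesis by (rule cross)
    next
      case 3
      then have "A.ip y x = B.ip (b y) (b x)" by (intro cross)
      then show ?thesis using A.ip_commute[of x y] B.ip_commute[of "b x" "b y"] by simp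
    next
      case 4
      then show ?thesis by (simp only: b_Y Q(3))
    qed
  qed
  have a_vec: "x \<in> A.vectors" if "x \<in> Z1 \<union> ?Y1" for x
    using that A.submoduleD(2)[OF Z1(1)] A.submoduleD(2)[OF Y1] by blast
  have b_vec: "b x \<in> B.vectors" if "x \<in> Z1 \<union> ?Y1" for x
    using that
  proof
    assume x: "x \<in> Z1"
    then have "\<phi> x \<in> Z2" using P(2) by blast
    then show ?thesis unfolding b_Z[OF x] by (rule B.submoduleD(2)[OF Z2(1)])
  next
    assume x: "x \<in> ?Y1"
    then have "\<psi> x \<in> ?Y2" using Q(2) by blast
    then show ?thesis unfolding b_Y[OF x] by (rule B.submoduleD(2)[OF Y2])
  qed
  obtain \<Phi> where \<Phi>: "Vector_Spaces.linear fscale fscale \<Phi>" "\<And>x. x \<in> Z1 \<union> ?Y1 \<Longrightarrow> \<Phi> x = b x"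
    "\<And>x y. x \<in> fun_space.span ((\<lambda>x. x) ` (Z1 \<union> ?Y1)) \<Longrightarrow> y \<in> fun_space.span ((\<lambda>x. x) ` (Z1 \<union> ?Y1)) \<Longrightarrow> B.ip (\<Phi> x) (\<Phi> y) = A.ip x y"
    using gram_extension[of "Z1 \<union> ?Y1" "\<lambda>x. x" b, OF a_vec b_vec gram] by blast
  note add = fun_pair.linear_add[OF \<Phi>(1)]
  have \<Phi>_Z: "\<Phi> x = \<phi> x" if "x \<in> Z1" for x using \<Phi>(2)[of x] b_Z[OF that] that by simp
  have \<Phi>_Y: "\<Phi> x = \<psi> x" if "x \<in> ?Y1" for x using \<Phi>(2)[of x] b_Y[OF that] that by simp
  have span: "W1 \<subseteq> fun_space.span ((\<lambda>x. x) ` (Z1 \<union> ?Y1))"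
  proof
    fix x assume x: "x \<in> W1"
    obtain z y where zy: "z \<in> Z1" "y \<in> ?Y1" "x = z + y"
      by (rule A.orth_decomposition[OF W1 Z1 x])
    show "x \<in> fun_space.span ((\<lambda>x. x) ` (Z1 \<union> ?Y1))"
      unfolding zy(3) image_ident using zy(1,2) by (intro fun_space.span_add fun_space.span_base) blast+
  qed
  have img: "\<Phi> ` W1 = W2"
  proof
    show "\<Phi> ` W1 \<subseteq> W2"
    proof (rule image_subsetI)
      fix x assume x: "x \<in> W1"
      obtain z y where zy: "z \<in> Z1" "y \<in> ?Y1" "x = z + y"
        by (rule A.orth_decomposition[OF W1 Z1 x])
      have "\<phi> z \<in> W2" using P(2) Z2(2) zy(1) by blast
      moreover have "\<psi> y \<in> W2" using Q(2) zy(2) by (auto simp: B.orth_def)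
      ultimately have "\<phi> z + \<psi> y \<in> W2" by (rule fun_space.subspace_add[OF B.submoduleD(1)[OF W2]])
      then show "\<Phi> x \<in> W2" by (simp only: zy(3) add \<Phi>_Z[OF zy(1)] \<Phi>_Y[OF zy(2)])
    qed
    show "W2 \<subseteq> \<Phi> ` W1"
    proof
      fix x assume x: "x \<in> W2"
      obtain z y where zy: "z \<in> Z2" "y \<in> ?Y2" "x = z + y"
        by (rule B.orth_decomposition[OF W2 Z2 x])
      obtain z' y' where z': "z' \<in> Z1" "z = \<phi> z'" and y': "y' \<in> ?Y1" "y = \<psi> y'"
        using zy(1,2) P(2) Q(2) by blast
      have "z' + y' \<in> W1"
        using z'(1) Z1(2) y'(1) by (intro fun_space.subspace_add[OF A.submoduleD(1)[OF W1]]) (auto simp: A.orth_def)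
      moreover have "x = \<Phi> (z' + y')"
        by (simp only: zy(3) z'(2) y'(2) add \<Phi>_Z[OF z'(1)] \<Phi>_Y[OF y'(1)])
      ultimately show "x \<in> \<Phi> ` W1" by blast
    qed
  qed
  have equiv: "\<Phi> (A.act g x) = B.act g (\<Phi> x)" if g: "g \<in> SL2" and x: "x \<in> W1" for g x
  proof -
    obtain z y where zy: "z \<in> Z1" "y \<in> ?Y1" "x = z + y"
      by (rule A.orth_decomposition[OF W1 Z1 x])
    have gz: "A.act g z \<in> Z1" by (rule A.submoduleD(3)[OF Z1(1) g zy(1)])
    have gy: "A.act g y \<in> ?Y1" by (rule A.submoduleD(3)[OF Y1 g zy(2)])
    have vz: "z \<in> A.vectors" and vy: "y \<in> A.vectors" using a_vec zy(1,2) by blast+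
    have wz: "\<phi> z \<in> B.vectors" and wy: "\<psi> y \<in> B.vectors"
      using b_vec[of z] b_vec[of y] b_Z[OF zy(1)] b_Y[OF zy(2)] zy(1,2) by simp_all
    have "\<Phi> (A.act g x) = \<phi> (A.act g z) + \<psi> (A.act g y)"
      unfolding zy(3) A.act_add[OF vz vy] add \<Phi>_Z[OF gz] \<Phi>_Y[OF gy] ..
    also have "\<dots> = B.act g (\<phi> z) + B.act g (\<psi> y)"
      unfolding P(4)[OF g zy(1)] Q(4)[OF g zy(2)] ..
    also have "\<dots> = B.act g (\<Phi> x)"
      unfolding zy(3) add \<Phi>_Z[OF zy(1)] \<Phi>_Y[OF zy(2)] B.act_add[OF wz wy] ..
    finally show ?thesis .
  qed
  have "isometry \<Phi> W1 W2"
    unfolding isometry_def using \<Phi>(1,3) span img equiv by blast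
  then show ?thesis by (rule that)
qed

text \<open>Both modules have the same highest weight, and unit vectors of that weight generate
  isometric submodules with equal multiplicities. The complements again satisfy the hypothesis with
  a smaller total dimension.\<close>

theorem isometry_exists:
  assumes "A.submodule W1" "B.submodule W2"
    and "\<And>k. fun_space.dim (A.weight_space W1 k) = fun_space.dim (B.weight_space W2 k)"
  shows "\<exists>\<phi>. isometry \<phi> W1 W2"
  using assms
proof (induction "\<Sum>k\<in>A.wt ` X1. fun_space.dim (A.weight_space W1 k)" arbitrary: W1 W2 rule: less_induct)
  case less
  note W1 = less.prems(1) and W2 = less.prems(2) and dims = less.prems(3)
  show ?case
  proof (cases "\<forall>k. A.weight_space W1 k \<subseteq> {0}")
    case True
    then have W1_0: "W1 = {0}" by (intro A.submodule_trivial[OF W1]) blast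
    have "fun_space.dim (A.weight_space W1 k) = 0" for k
      using True A.weight_space_trivial_iff[OF W1] by blast
    then have "B.weight_space W2 k \<subseteq> {0}" for k
      using dims B.weight_space_trivial_iff[OF W2] by metis
    then have W2_0: "W2 = {0}" by (intro B.submodule_trivial[OF W2])
    have lin: "Vector_Spaces.linear fscale fscale (\<lambda>x :: 'i \<Rightarrow> complex. 0 :: 'j \<Rightarrow> complex)"
      by (rule fun_pair.linear_zero)
    have "isometry (\<lambda>x. 0) W1 W2"
      unfolding isometry_def W1_0 W2_0 using lin by (simp only: ball_simps A.act_zero B.act_zero A.ip_zero B.ip_zero image_insert image_empty) simp
    then show ?thesis by blast
  next
    case False
    define K where "K = {k. \<not> A.weight_space W1 k \<subseteq> {0}}"
    have "K \<subseteq> A.wt ` X1"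
    proof
      fix k assume "k \<in> K"
      then obtain x where x: "x \<in> A.weight_space W1 k" "x \<noteq> 0" by (auto simp: K_def)
      then obtain i where i: "x i \<noteq> 0" by (auto simp: fun_eq_iff)
      have "x \<in> A.vectors" by (rule A.submoduleD(2)[OF W1 A.weight_spaceD(1)[OF x(1)]])
      then have "i \<in> X1" using i by (auto simp: A.vectors_def)
      then show "k \<in> A.wt ` X1" using A.weight_spaceD(2)[OF x(1) i] by blast
    qed
    then have "finite K" using A.finite_X finite_surj by blast
    moreover have "K \<noteq> {}" using False by (auto simp: K_def)
    ultimately have max: "Max K \<in> K" "\<And>k. k \<in> K \<Longrightarrow> k \<le> Max K" by simp_all
    define n where "n = Max K"
    have top1: "A.weight_space W1 k \<subseteq> {0}" if "k > n" for k
      using max(2)[of k] that by (auto simp: K_def n_def not_le[symmetric])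
    have top2: "B.weight_space W2 k \<subseteq> {0}" if "k > n" for k
    proof -
      have "fun_space.dim (A.weight_space W1 k) = 0" using top1[OF that] A.weight_space_trivial_iff[OF W1] by blast
      then show ?thesis using dims[of k] B.weight_space_trivial_iff[OF W2] by simp
    qed
    have nz1: "\<not> A.weight_space W1 n \<subseteq> {0}" using max(1) by (simp add: K_def n_def)
    then have "fun_space.dim (A.weight_space W1 n) \<noteq> 0" using A.weight_space_trivial_iff[OF W1] by blast
    then have nz2: "\<not> B.weight_space W2 n \<subseteq> {0}" using dims[of n] B.weight_space_trivial_iff[OF W2] by simp
    have sub1: "A.weight_space W1 n \<subseteq> A.vectors" using A.submoduleD(2)[OF W1] A.weight_spaceD(1) by blast
    have sub2: "B.weight_space W2 n \<subseteq> B.vectors" using B.submoduleD(2)[OF W2] B.weight_spaceD(1) by blast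
    obtain x1 where "x1 \<in> A.weight_space W1 n" "x1 \<noteq> 0" using nz1 by blast
    then obtain p where p: "p \<in> A.weight_space W1 n" "p \<noteq> 0" "A.ip p p = 1"
      by (rule A.unit_vector[OF A.subspace_weight_space[OF W1] sub1])
    obtain x2 where "x2 \<in> B.weight_space W2 n" "x2 \<noteq> 0" using nz2 by blast
    then obtain q where q: "q \<in> B.weight_space W2 n" "q \<noteq> 0" "B.ip q q = 1"
      by (rule B.unit_vector[OF B.subspace_weight_space[OF W2] sub2])
    have pW: "p \<in> W1" "p \<in> A.vectors" and qW: "q \<in> W2" "q \<in> B.vectors"
      using A.weight_spaceD(1)[OF p(1)] B.weight_spaceD(1)[OF q(1)] A.submoduleD(2)[OF W1] B.submoduleD(2)[OF W2] by blast+
    let ?Z1 = "A.orbit_span p" and ?Z2 = "B.orbit_span q"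
    have Z1: "A.submodule ?Z1" "?Z1 \<subseteq> W1" and Z2: "B.submodule ?Z2" "?Z2 \<subseteq> W2"
      using A.submodule_orbit_span[OF pW(2)] A.orbit_span_subset[OF W1 pW(1)]
        B.submodule_orbit_span[OF qW(2)] B.orbit_span_subset[OF W2 qW(1)] .
    obtain \<phi> where \<phi>: "isometry \<phi> ?Z1 ?Z2"
    proof (rule orbit_isometry[of p n q])
      show "A.act (mat2 1 t 0 1) p = p" for t by (rule A.top_weight_fixed[OF W1 p(1) top1])
      show "B.act (mat2 1 t 0 1) q = q" for t by (rule B.top_weight_fixed[OF W2 q(1) top2])
    qed (use pW qW p(3) q(3) A.weight_spaceD(2)[OF p(1)] B.weight_spaceD(2)[OF q(1)] in simp_all)
    have dimZ: "fun_space.dim (A.weight_space ?Z1 k) = fun_space.dim (B.weight_space ?Z2 k)" for k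
      by (rule equivariant_dim_weight_space[OF Z1(1) Z2(1) isometryD(1,2)[OF \<phi>] isometry_inj_on[OF Z1(1) \<phi>] isometryD(4)[OF \<phi>]])
    note dim1 = A.dim_weight_space_orth[OF W1 Z1] and dim2 = B.dim_weight_space_orth[OF W2 Z2]
    have "\<exists>\<psi>. isometry \<psi> (A.orth W1 ?Z1) (B.orth W2 ?Z2)"
    proof (rule less.hyps)
      show "A.submodule (A.orth W1 ?Z1)" by (rule A.submodule_orth[OF W1 Z1(1)])
      show "B.submodule (B.orth W2 ?Z2)" by (rule B.submodule_orth[OF W2 Z2(1)])
      show "fun_space.dim (A.weight_space (A.orth W1 ?Z1) k) = fun_space.dim (B.weight_space (B.orth W2 ?Z2) k)" for k
        using dims[of k] dimZ[of k] dim1[of k] dim2[of k] by simp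
      \<comment> \<open>The vector \<open>p\<close> itself makes the split-off part nonzero in
        weight \<open>n\<close>, so the measure drops strictly.\<close>
      have "p \<in> A.weight_space ?Z1 n" using p(1) A.in_orbit_span[OF pW(2)] by (simp add: A.weight_space_def)
      moreover have "A.weight_space ?Z1 n \<subseteq> A.vectors" using A.submoduleD(2)[OF Z1(1)] A.weight_spaceD(1) by blast
      ultimately have "fun_space.dim (A.weight_space ?Z1 n) > 0"
        using p(2) by (intro A.dim_pos[OF A.subspace_weight_space[OF Z1(1)]])
      moreover have "n \<in> A.wt ` X1" using max(1) \<open>K \<subseteq> A.wt ` X1\<close> by (auto simp: n_def)
      ultimately show "(\<Sum>k\<in>A.wt ` X1. fun_space.dim (A.weight_space (A.orth W1 ?Z1) k)) <
          (\<Sum>k\<in>A.wt ` X1. fun_space.dim (A.weight_space W1 k))"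
        using dim1 A.finite_X by (intro sum_strict_mono_ex1) (auto intro!: bexI[of _ n])
    qed
    then obtain \<psi> where \<psi>: "isometry \<psi> (A.orth W1 ?Z1) (B.orth W2 ?Z2)" by blast
    show ?thesis by (rule glue_isometries[OF W1 Z1 W2 Z2 \<phi> \<psi>]) blast
  qed
qed

text \<open>An arbitrary isomorphism is not assumed isometric, but it preserves eigenspaces of
  \<open>diag(2, 1/2)\<close> and thereby multiplicities; conversely, equal multiplicities even give
  an isometric isomorphism.\<close>

theorem module_iso_SL2_iff:
  assumes W1: "A.submodule W1" and W2: "B.submodule W2"
  shows "module_iso SL2 W1 A.act W2 B.act \<longleftrightarrow>
    (\<forall>k. fun_space.dim (A.weight_space W1 k) = fun_space.dim (B.weight_space W2 k))"
proof
  assume "\<forall>k. fun_space.dim (A.weight_space W1 k) = fun_space.dim (B.weight_space W2 k)"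
  then obtain \<phi> where \<phi>: "isometry \<phi> W1 W2" using isometry_exists[OF W1 W2] by blast
  note I = isometryD[OF \<phi>]
  have "bij_betw \<phi> W1 W2" using isometry_inj_on[OF W1 \<phi>] I(2) by (simp add: bij_betw_def)
  moreover have "\<phi> (x + y) = \<phi> x + \<phi> y" for x y by (rule fun_pair.linear_add[OF I(1)])
  moreover have "\<phi> (fscale c x) = fscale c (\<phi> x)" for c x by (rule fun_pair.linear_scale[OF I(1)])
  ultimately show "module_iso SL2 W1 A.act W2 B.act"
    unfolding module_iso_def using I(4) by (intro exI[of _ \<phi>] conjI ballI allI) simp_all
next
  assume "module_iso SL2 W1 A.act W2 B.act"
  then obtain f where f: "bij_betw f W1 W2" "\<And>x y. x \<in> W1 \<Longrightarrow> y \<in> W1 \<Longrightarrow> f (x + y) = f x + f y"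
    "\<And>c x. x \<in> W1 \<Longrightarrow> f (fscale c x) = fscale c (f x)"
    "\<And>g x. g \<in> SL2 \<Longrightarrow> x \<in> W1 \<Longrightarrow> f (A.act g x) = B.act g (f x)"
    unfolding module_iso_def by blast
  have sub: "W1 \<subseteq> A.vectors" using A.submoduleD(2)[OF W1] by blast
  obtain C where C: "finite C" "C \<subseteq> W1" "fun_space.independent C" "fun_space.span C = W1"
    by (rule A.finite_basis[OF A.submoduleD(1)[OF W1] sub])
  \<comment> \<open>\<open>f\<close> is additive and homogeneous on \<open>W1\<close> only. It is
    replaced by a linear map on the whole function space that agrees with it on a basis and hence on
    \<open>W1\<close>.\<close>
  obtain \<phi> where lin: "Vector_Spaces.linear fscale fscale \<phi>" and \<phi>: "\<And>x. x \<in> C \<Longrightarrow> \<phi> x = f x"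
    using fun_pair.linear_independent_extend[OF C(3), of f] by blast
  have "0 \<in> W1" by (rule fun_space.subspace_0[OF A.submoduleD(1)[OF W1]])
  then have f0: "f 0 = 0" using f(3)[of 0 0] by (simp only: fun_space.scale_zero_left)
  have "x \<in> W1 \<and> \<phi> x = f x" if "x \<in> fun_space.span C" for x
    using that
  proof (induction rule: fun_space.span_induct_alt)
    case base
    show ?case unfolding f0 using \<open>0 \<in> W1\<close> fun_pair.linear_0[OF lin] by (rule conjI)
  next
    case (step c x y)
    have x: "x \<in> W1" using step(1) C(2) by blast
    note y = conjunct1[OF step(2)] and yeq = conjunct2[OF step(2)]
    have cx: "fscale c x \<in> W1" by (rule fun_space.subspace_scale[OF A.submoduleD(1)[OF W1] x])
    have "\<phi> (fscale c x + y) = f (fscale c x + y)"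
      by (simp only: fun_pair.linear_add[OF lin] fun_pair.linear_scale[OF lin] \<phi>[OF step(1)] yeq f(2)[OF cx y] f(3)[OF x])
    with fun_space.subspace_add[OF A.submoduleD(1)[OF W1] cx y] show ?case by (rule conjI)
  qed
  then have eq: "\<phi> x = f x" if "x \<in> W1" for x using that C(4) by blast
  show "\<forall>k. fun_space.dim (A.weight_space W1 k) = fun_space.dim (B.weight_space W2 k)"
  proof
    fix k
    show "fun_space.dim (A.weight_space W1 k) = fun_space.dim (B.weight_space W2 k)"
    proof (rule equivariant_dim_weight_space[OF W1 W2 lin])
      show "\<phi> ` W1 = W2" using f(1) eq by (auto simp: bij_betw_def)
      show "inj_on \<phi> W1" using f(1) eq by (simp add: bij_betw_def inj_on_def)
      show "\<phi> (A.act g x) = B.act g (\<phi> x)" if "g \<in> SL2" "x \<in> W1" for g x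
        using f(4)[OF that] eq[OF that(2)] eq[OF A.submoduleD(3)[OF W1 that]] by (simp only:)
    qed
  qed
qed

section \<open>Scalar matrices and the passage to \<open>GL2\<close>\<close>

lemma GL2_decomposition:
  assumes "g \<in> GL2"
  obtains z h where "z \<noteq> 0" "h \<in> SL2" "g = mat2 z 0 0 z ** h"
proof -
  obtain a b c d where g: "g = mat2 a b c d" by (rule mat2_cases)
  \<comment> \<open>Dividing by a square root of the determinant normalises the determinant to 1.
    Either root serves.\<close>
  define z where "z = csqrt (a * d - b * c)"
  have "a * d - b * c \<noteq> 0" using assms by (simp add: GL2_def g invertible_det_nz det_mat2)
  then have z: "z \<noteq> 0" "z * z = a * d - b * c"
    by (simp_all add: z_def flip: power2_eq_square)
  have "g = mat2 z 0 0 z ** mat2 (a / z) (b / z) (c / z) (d / z)"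
    using z(1) by (simp add: g mat2_mult)
  moreover have "mat2 (a / z) (b / z) (c / z) (d / z) \<in> SL2"
    using z by (simp add: mat2_in_SL2 field_simps)
  ultimately show ?thesis using that z(1) by blast
qed

text \<open>The scalar matrix \<open>z\<close> acts on everything as multiplication by
  \<open>z ^ deg\<close>, so only the degrees must match in addition. The nonzero vector is what
  lets \<open>diag(2, 2)\<close> detect the degree: zero modules are isomorphic in any
  degree.\<close>

theorem module_iso_GL2_iff:
  assumes W1: "A.submodule W1" and W2: "B.submodule W2" and nz: "x0 \<in> W1" "x0 \<noteq> 0"
  shows "module_iso GL2 W1 A.act W2 B.act \<longleftrightarrow> module_iso SL2 W1 A.act W2 B.act \<and> deg1 = deg2"
proof -
  have A_center: "A.act (mat2 z 0 0 z) x = fscale (z ^ deg1) x" if "x \<in> A.vectors" for x z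
  proof
    fix i
    show "A.act (mat2 z 0 0 z) x i = fscale (z ^ deg1) x i"
      using that A.ht_le[of i] by (cases "i \<in> X1") (auto simp: A.act_diag fscale_def A.vectors_def simp flip: power_add)
  qed
  have B_center: "B.act (mat2 z 0 0 z) x = fscale (z ^ deg2) x" if "x \<in> B.vectors" for x z
  proof
    fix i
    show "B.act (mat2 z 0 0 z) x i = fscale (z ^ deg2) x i"
      using that B.ht_le[of i] by (cases "i \<in> X2") (auto simp: B.act_diag fscale_def B.vectors_def simp flip: power_add)
  qed
  have SL_GL: "g \<in> GL2" if "g \<in> SL2" for g using that by (simp add: SL2_def GL2_def invertible_det_nz)
  show ?thesis
  proof
    assume "module_iso GL2 W1 A.act W2 B.act"
    then obtain f where f: "bij_betw f W1 W2" "\<forall>x\<in>W1. \<forall>y\<in>W1. f (x + y) = f x + f y"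
      "\<forall>c. \<forall>x\<in>W1. f (fscale c x) = fscale c (f x)" "\<forall>g\<in>GL2. \<forall>x\<in>W1. f (A.act g x) = B.act g (f x)"
      unfolding module_iso_def by blast
    have "module_iso SL2 W1 A.act W2 B.act"
      unfolding module_iso_def using f SL_GL by blast
    moreover have "deg1 = deg2"
    proof -
      let ?z = "mat2 2 0 0 2"
      have fx: "f x0 \<in> W2" using f(1) nz(1) by (auto simp: bij_betw_def)
      have "?z \<in> GL2" by (simp add: GL2_def invertible_det_nz det_mat2)
      then have "f (A.act ?z x0) = B.act ?z (f x0)" using f(4) nz(1) by blast
      then have "fscale (2 ^ deg1) (f x0) = fscale (2 ^ deg2) (f x0)"
        unfolding A_center[OF A.submoduleD(2)[OF W1 nz(1)]] B_center[OF B.submoduleD(2)[OF W2 fx]]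
        using f(3) nz(1) by simp
      moreover have "f x0 \<noteq> 0"
      proof
        have W0: "0 \<in> W1" by (rule fun_space.subspace_0[OF A.submoduleD(1)[OF W1]])
        then have "f (fscale 0 0) = fscale 0 (f 0)" using f(3) by blast
        then have "f 0 = 0" by (simp only: fun_space.scale_zero_left)
        moreover assume "f x0 = 0"
        ultimately have "x0 = 0" using inj_onD[OF bij_betw_imp_inj_on[OF f(1)] _ nz(1) W0] by simp
        then show False using nz(2) by simp
      qed
      ultimately have "(2 :: complex) ^ deg1 = 2 ^ deg2"
        by (simp only: fun_space.scale_cancel_right) simp
      then have "cmod (2 ^ deg1) = cmod (2 ^ deg2)" by simp
      then have "(2 :: real) ^ deg1 = 2 ^ deg2" by (simp add: norm_power)
      then show ?thesis by simp
    qed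
    ultimately show "module_iso SL2 W1 A.act W2 B.act \<and> deg1 = deg2" ..
  next
    assume *: "module_iso SL2 W1 A.act W2 B.act \<and> deg1 = deg2"
    then obtain f where f: "bij_betw f W1 W2" "\<forall>x\<in>W1. \<forall>y\<in>W1. f (x + y) = f x + f y"
      "\<forall>c. \<forall>x\<in>W1. f (fscale c x) = fscale c (f x)" "\<forall>g\<in>SL2. \<forall>x\<in>W1. f (A.act g x) = B.act g (f x)"
      unfolding module_iso_def by blast
    have "f (A.act g x) = B.act g (f x)" if g: "g \<in> GL2" and x: "x \<in> W1" for g x
    proof -
      obtain z h where h: "z \<noteq> 0" "h \<in> SL2" "g = mat2 z 0 0 z ** h" by (rule GL2_decomposition[OF g])
      have fx: "f x \<in> W2" using f(1) x by (auto simp: bij_betw_def)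
      have hx: "A.act h x \<in> W1" by (rule A.submoduleD(3)[OF W1 h(2) x])
      have "f (A.act g x) = f (fscale (z ^ deg1) (A.act h x))"
        unfolding h(3) A.act_mult[OF A.submoduleD(2)[OF W1 x]] A_center[OF A.act_vectors] ..
      also have "\<dots> = fscale (z ^ deg1) (B.act h (f x))" using f(3,4) hx h(2) x by simp
      also have "\<dots> = B.act g (f x)"
        unfolding h(3) B.act_mult[OF B.submoduleD(2)[OF W2 fx]] B_center[OF B.act_vectors] using * by simp
      finally show ?thesis .
    qed
    then show "module_iso GL2 W1 A.act W2 B.act"
      unfolding module_iso_def using f(1,2,3) by blast
  qed
qed

end

section \<open>Schur functors and plethysm\<close>

lemma polynomial_rep_std: "polynomial_rep UNIV (\<lambda>i :: 2. if i = 1 then 0 else 1) 1 std_mat"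
proof
  fix g h :: "complex^2^2" and i j k :: 2 and a b t :: complex
  show "std_mat (g ** h) i k = (\<Sum>j\<in>UNIV. std_mat g i j * std_mat h j k)"
    by (simp add: std_mat_def matrix_matrix_mult_def)
  show "std_mat (adjoint2 g) i j = cnj (std_mat g j i)"
    by (simp add: std_mat_def adjoint2_def)
  have two: "x = 1 \<or> x = 2" for x :: 2 by (rule exhaust_2)
  show "std_mat (mat2 a 0 0 b) i j =
      (if i = j then a ^ (1 - (if i = 1 then 0 else 1)) * b ^ (if i = 1 then 0 else 1) else 0)"
    using two[of i] two[of j] by (auto simp: std_mat_def)
  show "std_mat (mat2 1 t 0 1) i j \<noteq> 0 \<Longrightarrow> (if i = 1 then 0 else 1) < (if j = 1 then 0 else 1 :: nat) \<or> i = j"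
    using two[of i] two[of j] by (auto simp: std_mat_def)
  show "std_mat (mat2 1 t 0 1) i i = 1"
    using two[of i] by (auto simp: std_mat_def)
  show "continuous_on UNIV (\<lambda>g. std_mat g i j)"
    unfolding std_mat_def by (intro continuous_intros)
qed auto

lemma listset_replicate: "listset (replicate n X) = {is. length is = n \<and> set is \<subseteq> X}"
  by (auto simp: in_listset_iff subset_eq all_set_conv_all_nth)

lemma sum_list_strict_mono_nth:
  fixes f g :: "nat \<Rightarrow> nat"
  assumes "\<And>k. k < n \<Longrightarrow> f k < g k \<or> a k = b k" "\<And>k. k < n \<Longrightarrow> a k = b k \<Longrightarrow> f k = g k"
    and "\<exists>k<n. a k \<noteq> b k"
  shows "(\<Sum>k<n. f k) < (\<Sum>k<n. g k)"
proof (rule sum_strict_mono_ex1)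
  show "\<forall>k\<in>{..<n}. f k \<le> g k" using assms(1,2) by (metis lessThan_iff less_imp_le order.refl)
  show "\<exists>k\<in>{..<n}. f k < g k" using assms(1,3) by blast
qed simp

text \<open>Entries of the tensor power are products over positions, and sums over index lists
  factor accordingly, so each axiom follows from the one for \<open>R\<close>. In the triangularity
  axiom no position raises \<open>ht\<close>, and lists that differ lose height at some
  position.\<close>

lemma polynomial_rep_tensor:
  assumes "polynomial_rep X ht deg R"
  shows "polynomial_rep {is. length is = n \<and> set is \<subseteq> X} (\<lambda>is. sum_list (map ht is)) (n * deg) (\<lambda>g. tensor_mat n (R g))"
proof -
  interpret polynomial_rep X ht deg R by (rule assms)
  let ?X = "{is. length is = n \<and> set is \<subseteq> X}"
  have fin: "finite ?X" using finite_lists_length_eq[OF finite_X, of n] by (simp add: conj_commute)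
  have nth: "is ! k \<in> X" if "is \<in> ?X" "k < n" for "is" k using that by auto
  have ht_sum: "sum_list (map ht is) = (\<Sum>k<n. ht (is ! k))" if "length is = n" for "is"
    using that by (simp add: sum_list_sum_nth atLeast0LessThan)
  show ?thesis
  proof
    show "finite ?X" by (rule fin)
  next
    fix g "is" js assume nz: "tensor_mat n (R g) is js \<noteq> 0"
    then have len: "length is = n" "length js = n" by (auto simp: tensor_mat_def split: if_splits)
    then have "(\<Prod>k<n. R g (is ! k) (js ! k)) \<noteq> 0" using nz by (simp add: tensor_mat_def)
    then have "R g (is ! k) (js ! k) \<noteq> 0" if "k < n" for k using that by (auto simp: prod_zero_iff)
    then have "is ! k \<in> X \<and> js ! k \<in> X" if "k < n" for k using R_supp that by blast
    then show "is \<in> ?X \<and> js \<in> ?X" using len by (auto simp: set_conv_nth)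
  next
    fix g h :: "complex^2^2" and "is" ks assume *: "is \<in> ?X" "ks \<in> ?X"
    have "(\<Sum>js\<in>?X. tensor_mat n (R g) is js * tensor_mat n (R h) js ks) =
        (\<Sum>js\<in>listset (replicate n X). \<Prod>k<length (replicate n X). R g (is ! k) (js ! k) * R h (js ! k) (ks ! k))"
      unfolding listset_replicate using * by (intro sum.cong refl) (simp add: tensor_mat_def prod.distrib)
    also have "\<dots> = (\<Prod>k<length (replicate n X). \<Sum>j\<in>replicate n X ! k. R g (is ! k) j * R h j (ks ! k))"
      by (rule sum_listset_prod) (use finite_X in auto)
    also have "\<dots> = (\<Prod>k<n. R (g ** h) (is ! k) (ks ! k))"
      using nth[OF *(1)] nth[OF *(2)] by (intro prod.cong) (simp_all add: R_mult)
    also have "\<dots> = tensor_mat n (R (g ** h)) is ks" using * by (simp add: tensor_mat_def)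
    finally show "tensor_mat n (R (g ** h)) is ks = (\<Sum>js\<in>?X. tensor_mat n (R g) is js * tensor_mat n (R h) js ks)"
      by simp
  next
    fix g "is" js
    show "tensor_mat n (R (adjoint2 g)) is js = cnj (tensor_mat n (R g) js is)"
      by (simp add: tensor_mat_def R_adjoint)
  next
    fix "is" assume i: "is \<in> ?X"
    have "(\<Sum>k<n. ht (is ! k)) \<le> (\<Sum>k<n. deg)"
      by (intro sum_mono ht_le nth[OF i]) simp
    then have "sum_list (map ht is) \<le> (\<Sum>k<n. deg)" using ht_sum[of "is"] i by simp
    then show "sum_list (map ht is) \<le> n * deg" by simp
  next
    fix "is" js and a b :: complex assume i: "is \<in> ?X"
    show "tensor_mat n (R (mat2 a 0 0 b)) is js =
        (if is = js then a ^ (n * deg - sum_list (map ht is)) * b ^ sum_list (map ht is) else 0)"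
    proof (cases "length js = n")
      case True
      have "(\<Prod>k<n. R (mat2 a 0 0 b) (is ! k) (js ! k)) =
          (\<Prod>k<n. if is ! k = js ! k then a ^ (deg - ht (is ! k)) * b ^ ht (is ! k) else 0)"
        using nth[OF i] by (intro prod.cong) (simp_all add: R_diag)
      also have "\<dots> = (if is = js then (\<Prod>k<n. a ^ (deg - ht (is ! k)) * b ^ ht (is ! k)) else 0)"
        using i True by (auto simp: list_eq_iff_nth_eq)
      also have "(\<Prod>k<n. a ^ (deg - ht (is ! k)) * b ^ ht (is ! k)) =
          a ^ (\<Sum>k<n. deg - ht (is ! k)) * b ^ (\<Sum>k<n. ht (is ! k))"
        by (simp add: prod.distrib power_sum)
      also have "(\<Sum>k<n. deg - ht (is ! k)) = n * deg - sum_list (map ht is)"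
        using nth[OF i] ht_le i by (subst sum_subtractf_nat) (simp_all add: ht_sum)
      finally show ?thesis using i True by (simp add: tensor_mat_def ht_sum)
    qed (use i in \<open>auto simp: tensor_mat_def\<close>)
  next
    fix t "is" js assume nz: "tensor_mat n (R (mat2 1 t 0 1)) is js \<noteq> 0"
    then have len: "length is = n" "length js = n" by (auto simp: tensor_mat_def split: if_splits)
    then have "(\<Prod>k<n. R (mat2 1 t 0 1) (is ! k) (js ! k)) \<noteq> 0" using nz by (simp add: tensor_mat_def)
    then have "R (mat2 1 t 0 1) (is ! k) (js ! k) \<noteq> 0" if "k < n" for k using that by (auto simp: prod_zero_iff)
    then have up: "ht (is ! k) < ht (js ! k) \<or> is ! k = js ! k" if "k < n" for k using R_upper that by blast
    show "sum_list (map ht is) < sum_list (map ht js) \<or> is = js"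
    proof (cases "is = js")
      case False
      then have "\<exists>k<n. is ! k \<noteq> js ! k" using len by (auto simp: list_eq_iff_nth_eq)
      then have "(\<Sum>k<n. ht (is ! k)) < (\<Sum>k<n. ht (js ! k))"
        by (intro sum_list_strict_mono_nth[where a = "(!) is" and b = "(!) js"] up) simp_all
      then show ?thesis using len by (simp add: ht_sum)
    qed simp
  next
    fix t "is" assume "is \<in> ?X"
    then show "tensor_mat n (R (mat2 1 t 0 1)) is is = 1"
      using nth by (simp add: tensor_mat_def R_upper_diag)
  next
    fix "is" js
    show "continuous_on UNIV (\<lambda>g. tensor_mat n (R g) is js)"
    proof (cases "length is = n \<and> length js = n")
      case True
      then show ?thesis unfolding tensor_mat_def by (simp add: continuous_on_prod R_continuous)
    next
      case False
      then show ?thesis unfolding tensor_mat_def by (simp only: if_False) (rule continuous_on_const)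
    qed
  qed
qed

lemma young_permutation:
  "p \<in> row_group lam \<Longrightarrow> q \<in> col_group lam \<Longrightarrow> (p \<circ> q) permutes {..<part_size lam}"
  unfolding row_group_eq col_group_eq by (rule permutes_compose[OF stab_groupD(1) stab_groupD(1)])

lemma tensor_mat_permute_list:
  assumes s: "s permutes {..<n}" and len: "length is = n" "length js = n"
  shows "tensor_mat n A (permute_list s is) (permute_list s js) = tensor_mat n A is js"
proof -
  have "(\<Prod>k<n. A (permute_list s is ! k) (permute_list s js ! k)) = (\<Prod>k<n. A (is ! s k) (js ! s k))"
    using s len by (intro prod.cong refl) (simp add: permute_list_nth)
  also have "\<dots> = (\<Prod>k<n. A (is ! k) (js ! k))"
    using prod.permute[OF s, of "\<lambda>k. A (is ! k) (js ! k)"] by (simp add: o_def)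
  finally show ?thesis using len by (simp add: tensor_mat_def)
qed

text \<open>The group acts by the same matrix on all tensor factors, so its action commutes with
  permutations of positions and hence with the Young symmetrizer.\<close>

lemma (in polynomial_rep) submodule_schur:
  assumes V: "submodule V"
  shows "polynomial_rep.submodule {is. length is = part_size lam \<and> set is \<subseteq> X}
    (\<lambda>g. tensor_mat (part_size lam) (R g)) (schur lam V)"
proof -
  let ?n = "part_size lam"
  let ?X = "{is. length is = ?n \<and> set is \<subseteq> X}"
  interpret T: polynomial_rep ?X "\<lambda>is. sum_list (map ht is)" "?n * deg" "\<lambda>g. tensor_mat ?n (R g)"
    by (rule polynomial_rep_tensor) (rule polynomial_rep_axioms)
  note VD = submoduleD[OF V]
  have pure: "pure_tensor vs \<in> T.vectors" if "length vs = ?n" "set vs \<subseteq> V" for vs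
  proof -
    have "pure_tensor vs is = 0" if notin: "is \<notin> ?X" for "is"
    proof (cases "length is = ?n")
      case True
      then obtain k where k: "k < ?n" "is ! k \<notin> X" using notin by (auto simp: set_conv_nth)
      have "vs ! k \<in> V" using k(1) \<open>length vs = ?n\<close> \<open>set vs \<subseteq> V\<close> by auto
      then have "(vs ! k) (is ! k) = 0" using VD(2) k(2) by (simp add: vectors_def)
      then have "(\<Prod>k<?n. (vs ! k) (is ! k)) = 0" using k(1) by (auto simp: prod_zero_iff)
      then show ?thesis using \<open>length vs = ?n\<close> by (simp add: pure_tensor_def)
    qed (use \<open>length vs = ?n\<close> in \<open>simp add: pure_tensor_def\<close>)
    then show ?thesis by (simp add: T.vectors_def)
  qed
  have tp_vec: "tensor_power ?n V \<subseteq> T.vectors"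
    unfolding tensor_power_def using pure by (intro fun_space.span_minimal T.subspace_vectors) auto
  have act_pure: "T.act g (pure_tensor vs) = pure_tensor (map (act g) vs)"
    if "length vs = ?n" "set vs \<subseteq> V" for g vs
  proof -
    have "finite {i. v i \<noteq> 0}" if "v \<in> set vs" for v
    proof (rule finite_subset[OF _ finite_X])
      have "v \<in> vectors" using VD(2) \<open>set vs \<subseteq> V\<close> that by blast
      then show "{i. v i \<noteq> 0} \<subseteq> X" by (auto simp: vectors_def)
    qed
    then show ?thesis
      using mat_app_tensor_mat_pure_tensor[of vs "R g"] that(1) by (simp add: T.act_def act_def)
  qed
  have act_tp: "T.act g x \<in> tensor_power ?n V" if g: "g \<in> SL2" and x: "x \<in> tensor_power ?n V" for g x
  proof -
    have "x \<in> T.vectors \<and> T.act g x \<in> tensor_power ?n V"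
      using x unfolding tensor_power_def
    proof (induction rule: fun_space.span_induct_alt)
      case base
      show ?case unfolding T.act_zero by (intro conjI fun_space.span_zero fun_space.subspace_0[OF T.subspace_vectors])
    next
      case (step c x y)
      let ?S = "{pure_tensor vs |vs. length vs = ?n \<and> set vs \<subseteq> V}"
      obtain vs where vs: "x = pure_tensor vs" "length vs = ?n" "set vs \<subseteq> V" using step(1) by blast
      have xv: "x \<in> T.vectors" unfolding vs(1) by (rule pure[OF vs(2,3)])
      have cxv: "fscale c x \<in> T.vectors" by (rule fun_space.subspace_scale[OF T.subspace_vectors xv])
      note y = conjunct1[OF step(2)] conjunct2[OF step(2)]
      have "set (map (act g) vs) \<subseteq> V" using vs(3) VD(3)[OF g] by auto
      then have "T.act g x \<in> ?S" unfolding vs(1) act_pure[OF vs(2,3)] using vs(2) by (auto intro!: exI[of _ "map (act g) vs"])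
      then have "T.act g (fscale c x + y) \<in> fun_space.span ?S"
        unfolding T.act_add[OF cxv y(1)] T.act_scale[OF xv]
        by (intro fun_space.span_add fun_space.span_scale y(2) fun_space.span_base)
      with fun_space.subspace_add[OF T.subspace_vectors cxv y(1)] show ?case by (rule conjI)
    qed
    then show ?thesis by (rule conjunct2)
  qed
  have len_iff: "permute_list s is \<in> ?X \<longleftrightarrow> is \<in> ?X" if "s permutes {..<?n}" for s and "is" :: "'i list"
    using that by (cases "length is = ?n") auto
  have ys_vec: "young_symmetrizer lam x \<in> T.vectors" if x: "x \<in> T.vectors" for x
  proof -
    have "young_symmetrizer lam x is = 0" if "is \<notin> ?X" for "is"
      unfolding young_symmetrizer_def
    proof (intro sum.neutral ballI)
      fix p q assume "p \<in> row_group lam" "q \<in> col_group lam"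
      then have "permute_list (p \<circ> q) is \<notin> ?X" using len_iff[OF young_permutation] that by blast
      then show "of_int (sign q) * x (permute_list (p \<circ> q) is) = 0" using x by (simp add: T.vectors_def)
    qed
    then show ?thesis by (simp add: T.vectors_def)
  qed
  \<comment> \<open>Permuting both index lists simultaneously leaves \<open>tensor_mat\<close>
    unchanged, so reindexing the sum moves the permutation from the output index into the
    argument.\<close>
  have act_permute: "T.act g x (permute_list s is) = (\<Sum>js\<in>?X. tensor_mat ?n (R g) is js * x (permute_list s js))"
    if s: "s permutes {..<?n}" and x: "x \<in> T.vectors" and i: "is \<in> ?X" for g x s "is"
  proof -
    have bij: "bij_betw (permute_list s) ?X ?X"
    proof (rule bij_betw_byWitness[where f' = "permute_list (Hilbert_Choice.inv s)"])
      have *: "permute_list (Hilbert_Choice.inv s) (permute_list s js) = js" "permute_list s (permute_list (Hilbert_Choice.inv s) js) = js"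
        if "js \<in> ?X" for js
        using that permute_list_compose[of "Hilbert_Choice.inv s" js s] permute_list_compose[of s js "Hilbert_Choice.inv s"]
          permutes_inv[OF s] s permutes_inv_o[OF s] by simp_all
      then show "\<forall>js\<in>?X. permute_list (Hilbert_Choice.inv s) (permute_list s js) = js"
        "\<forall>js\<in>?X. permute_list s (permute_list (Hilbert_Choice.inv s) js) = js" by blast+
      show "permute_list s ` ?X \<subseteq> ?X" "permute_list (Hilbert_Choice.inv s) ` ?X \<subseteq> ?X"
        using len_iff[OF s] len_iff[OF permutes_inv[OF s]] by blast+
    qed
    have "T.act g x (permute_list s is) = (\<Sum>js\<in>?X. tensor_mat ?n (R g) (permute_list s is) js * x js)"
      by (rule T.act_eq[OF x])
    also have "\<dots> = (\<Sum>js\<in>?X. tensor_mat ?n (R g) (permute_list s is) (permute_list s js) * x (permute_list s js))"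
      by (rule sum.reindex_bij_betw[OF bij, symmetric])
    also have "\<dots> = (\<Sum>js\<in>?X. tensor_mat ?n (R g) is js * x (permute_list s js))"
      using i by (intro sum.cong refl arg_cong2[where f = "(*)"] tensor_mat_permute_list[OF s]) auto
    finally show ?thesis .
  qed
  have act_ys: "T.act g (young_symmetrizer lam x) = young_symmetrizer lam (T.act g x)" if x: "x \<in> T.vectors" for g x
  proof
    fix "is"
    show "T.act g (young_symmetrizer lam x) is = young_symmetrizer lam (T.act g x) is"
    proof (cases "is \<in> ?X")
      case True
      have "T.act g (young_symmetrizer lam x) is =
          (\<Sum>js\<in>?X. \<Sum>p\<in>row_group lam. \<Sum>q\<in>col_group lam. of_int (sign q) * (tensor_mat ?n (R g) is js * x (permute_list (p \<circ> q) js)))"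
        by (subst T.act_eq[OF ys_vec[OF x]]) (simp add: young_symmetrizer_def sum_distrib_left ac_simps)
      also have "\<dots> = (\<Sum>p\<in>row_group lam. \<Sum>q\<in>col_group lam. of_int (sign q) * (\<Sum>js\<in>?X. tensor_mat ?n (R g) is js * x (permute_list (p \<circ> q) js)))"
        unfolding sum_distrib_left by (subst sum.swap, rule sum.cong[OF refl], rule sum.swap)
      also have "\<dots> = young_symmetrizer lam (T.act g x) is"
        unfolding young_symmetrizer_def
        by (intro sum.cong refl arg_cong2[where f = "(*)"] act_permute[OF young_permutation x True, symmetric])
      finally show ?thesis .
    next
      case False
      have "T.act g (young_symmetrizer lam x) \<in> T.vectors" by (rule T.act_vectors)
      moreover have "young_symmetrizer lam (T.act g x) \<in> T.vectors" by (rule ys_vec[OF T.act_vectors])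
      ultimately show ?thesis using False unfolding T.vectors_def by simp
    qed
  qed
  have "fun_space.subspace (tensor_power ?n V)" unfolding tensor_power_def by (rule fun_space.subspace_span)
  then have "fun_space.subspace (schur lam V)"
    unfolding schur_def by (rule fun_pair.linear_subspace_image[OF linear_young_symmetrizer])
  moreover have "schur lam V \<subseteq> T.vectors"
    unfolding schur_def using ys_vec tp_vec by blast
  moreover have "T.act g x \<in> schur lam V" if "g \<in> SL2" "x \<in> schur lam V" for g x
  proof -
    obtain y where y: "y \<in> tensor_power ?n V" "x = young_symmetrizer lam y" using \<open>x \<in> schur lam V\<close> by (auto simp: schur_def)
    have "T.act g x = young_symmetrizer lam (T.act g y)" unfolding y(2) using tp_vec y(1) by (intro act_ys) blast
    then show ?thesis using act_tp[OF \<open>g \<in> SL2\<close> y(1)] by (auto simp: schur_def)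
  qed
  ultimately show ?thesis by (simp add: T.submodule_def)
qed

text \<open>Projection to a weight component keeps the generators of that weight and kills all
  others, so a spanning family of weight vectors restricts to a spanning family of each weight
  space.\<close>

lemma (in polynomial_rep) dim_weight_space_basis:
  fixes y :: "'t \<Rightarrow> 'i \<Rightarrow> complex" and \<kappa> :: "'t \<Rightarrow> int"
  assumes W: "submodule W" and span: "W = fun_space.span (y ` I)" and fin: "finite I"
    and wt: "\<And>T i. T \<in> I \<Longrightarrow> y T i \<noteq> 0 \<Longrightarrow> wt i = \<kappa> T"
    and indep: "\<And>A a T. A \<subseteq> I \<Longrightarrow> (\<Sum>T\<in>A. fscale (a T) (y T)) = 0 \<Longrightarrow> T \<in> A \<Longrightarrow> a T = 0"
  shows "fun_space.dim (weight_space W k) = card {T \<in> I. \<kappa> T = k}"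
proof -
  let ?J = "{T \<in> I. \<kappa> T = k}"
  \<comment> \<open>Independence is stated for indexed families: two indices with the same vector
    would give a relation with coefficients 1 and -1.\<close>
  have inj: "inj_on y I"
  proof (rule inj_onI, rule ccontr)
    fix S T assume ST: "S \<in> I" "T \<in> I" "y S = y T" "S \<noteq> T"
    have "(\<Sum>U\<in>{S, T}. fscale (if U = S then 1 else -1) (y U)) = 0"
      using ST(3,4) by (simp add: fscale_def fun_eq_iff)
    from indep[OF _ this, of S] ST(1,2) show False by simp
  qed
  have indep': "fun_space.independent (y ` ?J)"
  proof (rule fun_space.independent_if_scalars_zero)
    show "finite (y ` ?J)" using fin by simp
    fix f x assume sum: "(\<Sum>x\<in>y ` ?J. fscale (f x) x) = 0" and x: "x \<in> y ` ?J"
    have "(\<Sum>T\<in>?J. fscale (f (y T)) (y T)) = 0"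
      using sum sum.reindex[OF inj_on_subset[OF inj], of ?J "\<lambda>x. fscale (f x) x"] by (simp add: o_def)
    moreover obtain T where T: "T \<in> ?J" "x = y T" using x by blast
    ultimately show "f x = 0" using indep[of ?J "\<lambda>T. f (y T)" T] by blast
  qed
  have comp_y: "component m (y T) = (if \<kappa> T = m then y T else 0)" if "T \<in> I" for T m
  proof
    fix i
    show "component m (y T) i = (if \<kappa> T = m then y T else 0) i"
      using wt[OF that, of i] by (cases "y T i = 0") (simp_all add: component_def)
  qed
  have sub: "y ` ?J \<subseteq> weight_space W k"
  proof (rule image_subsetI)
    fix T assume "T \<in> ?J"
    then show "y T \<in> weight_space W k"
      using comp_y[of T k] span fun_space.span_base[of "y T" "y ` I"] by (simp add: weight_space_def)
  qed
  have "component k x \<in> fun_space.span (y ` ?J)" if "x \<in> fun_space.span (y ` I)" for x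
    using that
  proof (induction rule: fun_space.span_induct_alt)
    case base
    have "component k 0 = 0" by (simp add: component_def fun_eq_iff)
    then show ?case by (simp only: fun_space.span_zero)
  next
    case (step c x z)
    obtain T where T: "T \<in> I" "x = y T" using step(1) by blast
    have "component k x \<in> fun_space.span (y ` ?J)"
    proof (cases "\<kappa> T = k")
      case True
      then show ?thesis using comp_y[OF T(1), of k] T by (auto intro: fun_space.span_base)
    next
      case False
      then show ?thesis unfolding T(2) comp_y[OF T(1)] by (simp only: if_False fun_space.span_zero)
    qed
    moreover have "component k (fscale c x + z) = fscale c (component k x) + component k z"
      by (simp add: component_def fun_eq_iff fscale_def)
    ultimately show ?case using step(2) by (simp only: fun_space.span_add fun_space.span_scale)
  qed
  then have "x \<in> fun_space.span (y ` ?J)" if "x \<in> weight_space W k" for x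
    using that unfolding weight_space_def span by fastforce
  then have "weight_space W k \<subseteq> fun_space.span (y ` ?J)" by blast
  then have "card (y ` ?J) = fun_space.dim (weight_space W k)"
    by (rule fun_space.basis_card_eq_dim[OF sub _ indep'])
  moreover have "card (y ` ?J) = card ?J" by (rule card_image[OF inj_on_subset[OF inj]]) auto
  ultimately show ?thesis by simp
qed

text \<open>Permuting positions does not change the total of \<open>ht\<close> over a list, and the
  factor at position \<open>k\<close> lives in height \<open>c + T ! k\<close>. The offset
  \<open>c\<close> is 0 for the standard basis and \<open>\<delta> 1\<close> for the basis of the
  inner Schur module.\<close>

lemma young_tensor_support:
  assumes v: "\<And>j i. j < N \<Longrightarrow> v j i \<noteq> 0 \<Longrightarrow> ht i = c + j"
    and T: "T \<in> fillings lam N" and nz: "young_tensor lam v T is \<noteq> 0"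
  shows "sum_list (map ht is) = part_size lam * c + sum_list T"
proof -
  let ?n = "part_size lam"
  have "\<exists>p\<in>row_group lam. \<exists>q\<in>col_group lam. pure_tensor (map v T) (permute_list (p \<circ> q) is) \<noteq> 0"
  proof (rule ccontr)
    assume "\<not> ?thesis"
    then have "young_tensor lam v T is = 0"
      unfolding young_tensor_def young_symmetrizer_def by (intro sum.neutral ballI) simp
    then show False using nz by simp
  qed
  then obtain s where s: "s permutes {..<?n}" "pure_tensor (map v T) (permute_list s is) \<noteq> 0"
    using young_permutation by blast
  define js where "js = permute_list s is"
  have T': "length T = ?n" by (rule fillingsD(1)[OF T])
  have len: "length js = ?n" and prod: "(\<Prod>k<?n. v (T ! k) (js ! k)) \<noteq> 0"
    using s(2) T' by (auto simp: pure_tensor_def js_def split: if_splits)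
  have ht: "ht (js ! k) = c + T ! k" if "k < ?n" for k
  proof -
    have "v (T ! k) (js ! k) \<noteq> 0" using prod that by (auto simp: prod_zero_iff)
    then show ?thesis by (rule v[OF fillingsD(2)[OF T that]])
  qed
  have "mset js = mset is" using s(1) len unfolding js_def by (intro mset_permute_list) simp
  then have "sum_list (map ht is) = sum_list (map ht js)"
    by (metis mset_map sum_mset_sum_list)
  also have "\<dots> = (\<Sum>k<?n. c + T ! k)"
    using len ht by (simp add: sum_list_sum_nth atLeast0LessThan)
  also have "\<dots> = ?n * c + sum_list T"
    using T' by (simp add: sum.distrib sum_list_sum_nth atLeast0LessThan)
  finally show ?thesis .
qed

text \<open>For two variables the bialternant formula gives
  \<open>q ^ \<delta> 1 * [\<delta> 0 - \<delta> 1 + 1]_q\<close>, all of whose coefficients are 0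
  or 1. This reflects that the inner module is a symmetric power twisted by a power of the
  determinant.\<close>

lemma tableaux_two_rows:
  assumes \<delta>: "is_partition \<delta>" "part_length \<delta> \<le> 2"
  shows "card {T \<in> tableaux \<delta> 2. sum_list T = m} = (if \<delta> 1 \<le> m \<and> m \<le> \<delta> 0 then 1 else 0)"
proof -
  let ?q = "monom 1 1 :: rat poly"
  have anti: "antimono \<delta>" using \<delta>(1) by (simp add: is_partition_def)
  have size: "part_size \<delta> = \<delta> 0 + \<delta> 1"
    using part_size_eq_sum[OF \<delta>] by (simp add: numeral_2_eq_2)
  have le: "\<delta> 1 \<le> \<delta> 0" using antimonoD[OF anti, of 0 1] by simp
  have "ssyt_gf ?q \<delta> 2 * vandermonde 2 (\<lambda>i. ?q ^ (2 - 1 - i)) = vandermonde 2 (\<lambda>i. ?q ^ (\<delta> i + 2 - 1 - i))"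
    by (rule ssyt_gf_vandermonde[OF anti]) (rule partition_eq_0[OF \<delta>])
  then have "ssyt_gf ?q \<delta> 2 * (?q - 1) = ?q ^ Suc (\<delta> 0) - ?q ^ \<delta> 1"
    by (simp add: vandermonde_def numeral_2_eq_2)
  also have "\<dots> = ?q ^ \<delta> 1 * (?q ^ (\<delta> 0 - \<delta> 1 + 1) - 1)"
    using le by (simp add: algebra_simps flip: power_add power_Suc)
  also have "?q ^ (\<delta> 0 - \<delta> 1 + 1) - 1 = (?q - 1) * qint (\<delta> 0 - \<delta> 1 + 1)" by (rule qint_mult[symmetric])
  also have "?q ^ \<delta> 1 * ((?q - 1) * qint (\<delta> 0 - \<delta> 1 + 1)) = (?q ^ \<delta> 1 * qint (\<delta> 0 - \<delta> 1 + 1)) * (?q - 1)"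
    by (simp only: ac_simps)
  finally have eq: "ssyt_gf ?q \<delta> 2 * (?q - 1) = (?q ^ \<delta> 1 * qint (\<delta> 0 - \<delta> 1 + 1)) * (?q - 1)" .
  have "coeff (?q - 1) 1 \<noteq> 0" by simp
  then have "?q - 1 \<noteq> 0" by (metis coeff_0)
  with eq have gf: "ssyt_gf ?q \<delta> 2 = monom 1 (\<delta> 1) * qint (\<delta> 0 - \<delta> 1 + 1)"
    by (simp only: mult_cancel_right) (simp add: monom_power)
  show ?thesis
  proof (cases "m \<le> part_size \<delta>")
    case True
    define m' where "m' = part_size \<delta> - m"
    have mm: "int (part_size \<delta>) - 2 * int s = 2 * int m' - int (part_size \<delta>) \<longleftrightarrow> s = m" for s
      using True unfolding m'_def by (simp add: of_nat_diff)
    have "card {T \<in> tableaux \<delta> 2. sum_list T = m} = ssyt_mult \<delta> 1 (2 * int m' - int (part_size \<delta>))"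
      using card_tableaux_weight[OF \<delta>(1), of 1 "2 * int m' - int (part_size \<delta>)"]
      by (simp add: mm numeral_2_eq_2[symmetric])
    also have "(of_nat \<dots> :: rat) = coeff (ssyt_gf ?q \<delta> 2) m'"
      using coeff_ssyt_gf[OF \<delta>(1), of 1 m'] \<delta>(2) by (simp add: numeral_2_eq_2)
    also have "\<dots> = (if \<delta> 1 \<le> m \<and> m \<le> \<delta> 0 then 1 else 0)"
      unfolding gf coeff_monom_mult coeff_qint m'_def using le True by (auto simp: size)
    finally have "rat_of_nat (card {T \<in> tableaux \<delta> 2. sum_list T = m}) = of_nat (if \<delta> 1 \<le> m \<and> m \<le> \<delta> 0 then 1 else 0)"
      by simp
    then show ?thesis by (simp only: of_nat_eq_iff)
  next
    case False
    have "sum_list T \<le> part_size \<delta>" if "T \<in> tableaux \<delta> 2" for T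
    proof -
      have T: "T \<in> fillings \<delta> 2" using that by (simp add: tableaux_def)
      have "sum_list T = (\<Sum>k<part_size \<delta>. T ! k)"
        using fillingsD(1)[OF T] by (simp add: sum_list_sum_nth atLeast0LessThan)
      also have "\<dots> \<le> (\<Sum>k<part_size \<delta>. 1)"
        using fillingsD(2)[OF T] by (intro sum_mono) (simp add: less_2_cases_iff le_less)
      finally show ?thesis by simp
    qed
    then have "{T \<in> tableaux \<delta> 2. sum_list T = m} = {}" using False by auto
    then have "card {T \<in> tableaux \<delta> 2. sum_list T = m} = 0" by (simp only: card.empty)
    then show ?thesis using False by (simp add: size)
  qed
qed

abbreviation ht2 :: "2 \<Rightarrow> nat" where
  "ht2 i \<equiv> if i = 1 then 0 else 1"

text \<open>With one tableau per weight, evaluation at the tableau of another weight vanishes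
  because supports of different weights are disjoint. The evaluation matrix is thus diagonal, not
  merely triangular, and rescaling gives the dual points needed for the outer functor.\<close>

lemma schur_two_basis:
  assumes \<delta>: "is_partition \<delta>" "part_length \<delta> \<le> 2"
  obtains v :: "nat \<Rightarrow> 2 list \<Rightarrow> complex" and s :: "nat \<Rightarrow> 2 list"
  where "schur \<delta> std_space = fun_space.span (v ` {..<\<delta> 0 - \<delta> 1 + 1})"
    and "\<And>i j. i < \<delta> 0 - \<delta> 1 + 1 \<Longrightarrow> j < \<delta> 0 - \<delta> 1 + 1 \<Longrightarrow> v j (s i) = (if i = j then 1 else 0)"
    and "\<And>j is. j < \<delta> 0 - \<delta> 1 + 1 \<Longrightarrow> v j is \<noteq> 0 \<Longrightarrow> sum_list (map ht2 is) = \<delta> 1 + j"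
proof -
  let ?d = "\<delta> 0 - \<delta> 1"
  \<comment> \<open>The entries 0 and 1 of a tableau name the first and the second basis vector,
    whose indices in the type \<open>2\<close> are written 1 and 2.\<close>
  define idx :: "nat \<Rightarrow> 2" where "idx k = (if k = 0 then 1 else 2)" for k
  define e :: "nat \<Rightarrow> 2 \<Rightarrow> complex" where "e j = (\<lambda>i. if i = idx j then 1 else 0)" for j
  have dual: "e j (idx i) = (if i = j then 1 else 0)" if "i < 2" "j < 2" for i j
    using that by (auto simp: e_def idx_def less_2_cases_iff)
  have span_e: "std_space = fun_space.span (e ` {..<2})"
  proof -
    have "x \<in> fun_space.span (e ` {..<2})" for x
    proof -
      have "fscale (x 1) (e 0) + fscale (x 2) (e 1) \<in> fun_space.span (e ` {..<2})"
        by (intro fun_space.span_add fun_space.span_scale fun_space.span_base) auto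
      moreover have "x = fscale (x 1) (e 0) + fscale (x 2) (e 1)"
      proof
        fix i :: 2
        show "x i = (fscale (x 1) (e 0) + fscale (x 2) (e 1)) i"
          using exhaust_2[of i] by (auto simp: fscale_def e_def idx_def)
      qed
      ultimately show ?thesis by simp
    qed
    then show ?thesis by (auto simp: std_space_def)
  qed
  have supp: "sum_list (map ht2 is) = sum_list T" if "T \<in> tableaux \<delta> 2" "young_tensor \<delta> e T is \<noteq> 0" for T "is"
  proof -
    have "ht2 i = 0 + j" if "j < 2" "e j i \<noteq> 0" for j i
      using that by (auto simp: e_def idx_def less_2_cases_iff split: if_splits)
    moreover have "T \<in> fillings \<delta> 2" using that(1) by (simp add: tableaux_def)
    ultimately have "sum_list (map ht2 is) = part_size \<delta> * 0 + sum_list T"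
      using that(2) by (rule young_tensor_support[where ht = ht2 and N = 2 and c = 0 and v = e])
    then show ?thesis by (simp only: mult_0_right add_0)
  qed
  have le: "\<delta> 1 \<le> \<delta> 0" using \<delta>(1) by (simp add: is_partition_def antimono_def)
  have "\<exists>T. {T \<in> tableaux \<delta> 2. sum_list T = \<delta> 1 + j} = {T}" if "j < ?d + 1" for j
  proof -
    have "card {T \<in> tableaux \<delta> 2. sum_list T = \<delta> 1 + j} = 1"
      unfolding tableaux_two_rows[OF \<delta>] using that le by simp
    then show ?thesis by (rule card_1_singletonE) blast
  qed
  then have "\<forall>j. \<exists>T. j < ?d + 1 \<longrightarrow> {T \<in> tableaux \<delta> 2. sum_list T = \<delta> 1 + j} = {T}" by blast
  from choice[OF this] obtain t where t: "\<And>j. j < ?d + 1 \<Longrightarrow> {T \<in> tableaux \<delta> 2. sum_list T = \<delta> 1 + j} = {t j}" by blast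
  have tD: "t j \<in> tableaux \<delta> 2" "sum_list (t j) = \<delta> 1 + j" if "j < ?d + 1" for j
    using t[OF that] by blast+
  have tableaux_t: "tableaux \<delta> 2 = t ` {..<?d + 1}"
  proof
    show "tableaux \<delta> 2 \<subseteq> t ` {..<?d + 1}"
    proof
      fix T assume T: "T \<in> tableaux \<delta> 2"
      have "{U \<in> tableaux \<delta> 2. sum_list U = sum_list T} \<noteq> {}" using T by blast
      then have "card {U \<in> tableaux \<delta> 2. sum_list U = sum_list T} \<noteq> 0" using finite_tableaux[of \<delta> 2] by simp
      then have "\<delta> 1 \<le> sum_list T" "sum_list T \<le> \<delta> 0"
        unfolding tableaux_two_rows[OF \<delta>] by (auto split: if_splits)
      then have j: "sum_list T - \<delta> 1 < ?d + 1" "sum_list T = \<delta> 1 + (sum_list T - \<delta> 1)" by simp_all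
      have "T \<in> {U \<in> tableaux \<delta> 2. sum_list U = \<delta> 1 + (sum_list T - \<delta> 1)}" using T j(2) by simp
      then have "T = t (sum_list T - \<delta> 1)" unfolding t[OF j(1)] by simp
      then show "T \<in> t ` {..<?d + 1}" using j(1) by blast
    qed
    show "t ` {..<?d + 1} \<subseteq> tableaux \<delta> 2" using tD(1) by blast
  qed
  define r where "r j = young_tensor \<delta> e (t j) (map idx (t j))" for j
  have r: "r j \<noteq> 0" if "j < ?d + 1" for j
    unfolding r_def by (rule young_tensor_eval_diagonal[where N = 2 and v = e and s = idx, OF \<delta>(1) dual tD(1)[OF that]])
  \<comment> \<open>Division by the nonzero diagonal value normalises the evaluation at the dual
    point to 1.\<close>
  define v where "v j = fscale (1 / r j) (young_tensor \<delta> e (t j))" for j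
  show ?thesis
  proof
    show v_supp: "sum_list (map ht2 is) = \<delta> 1 + j" if "j < ?d + 1" "v j is \<noteq> 0" for j "is"
    proof -
      have "young_tensor \<delta> e (t j) is \<noteq> 0" using that(2) by (auto simp: v_def fscale_def)
      then show ?thesis using supp[OF tD(1)[OF that(1)]] tD(2)[OF that(1)] by simp
    qed
    show "v j (map idx (t i)) = (if i = j then 1 else 0)" if ij: "i < ?d + 1" "j < ?d + 1" for i j
    proof (cases "i = j")
      case True
      then show ?thesis using r[OF ij(2)] by (simp add: v_def fscale_def r_def)
    next
      case False
      have "young_tensor \<delta> e (t i) (map idx (t i)) \<noteq> 0" using r[OF ij(1)] unfolding r_def .
      then have "sum_list (map ht2 (map idx (t i))) = sum_list (t i)" by (rule supp[OF tD(1)[OF ij(1)]])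
      also have "\<dots> = \<delta> 1 + i" by (rule tD(2)[OF ij(1)])
      finally have "sum_list (map ht2 (map idx (t i))) = \<delta> 1 + i" .
      then have "v j (map idx (t i)) = 0" using v_supp[OF ij(2), of "map idx (t i)"] False by fastforce
      then show ?thesis using False by simp
    qed
    have "schur \<delta> std_space = fun_space.span (young_tensor \<delta> e ` t ` {..<?d + 1})"
      unfolding span_e schur_span[OF \<delta>(1)] tableaux_t ..
    also have "\<dots> = fun_space.span (v ` {..<?d + 1})"
    proof
      show "fun_space.span (young_tensor \<delta> e ` t ` {..<?d + 1}) \<subseteq> fun_space.span (v ` {..<?d + 1})"
      proof (intro fun_space.span_minimal fun_space.subspace_span, unfold image_image, rule image_subsetI)
        fix j assume j: "j \<in> {..<?d + 1}"
        have "fscale (1 / r j) (young_tensor \<delta> e (t j)) \<in> fun_space.span (v ` {..<?d + 1})"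
          unfolding v_def[symmetric] using j by (intro fun_space.span_base imageI)
        then show "young_tensor \<delta> e (t j) \<in> fun_space.span (v ` {..<?d + 1})"
          by (rule span_fscale_cancel[rotated]) (use r j in simp)
      qed
      show "fun_space.span (v ` {..<?d + 1}) \<subseteq> fun_space.span (young_tensor \<delta> e ` t ` {..<?d + 1})"
        unfolding v_def by (intro fun_space.span_minimal fun_space.subspace_span image_subsetI fun_space.span_scale fun_space.span_base imageI)
    qed
    finally show "schur \<delta> std_space = fun_space.span (v ` {..<?d + 1})" .
  qed
qed

definition lists_over :: "nat \<Rightarrow> 'a set \<Rightarrow> 'a list set" where
  "lists_over n X = {is. length is = n \<and> set is \<subseteq> X}"

lemma plethysm_rep:
  fixes lam \<delta> :: "nat \<Rightarrow> nat"
  defines "X \<equiv> lists_over (part_size lam) (lists_over (part_size \<delta>) (UNIV :: 2 set))"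
    and "ht \<equiv> \<lambda>is. sum_list (map (\<lambda>js. sum_list (map ht2 js)) is)"
    and "R \<equiv> \<lambda>g. schur_mat lam (schur_mat \<delta> (std_mat g))"
  shows "polynomial_rep X ht (part_size lam * part_size \<delta>) R"
    and "polynomial_rep.submodule X R (plethysm_space lam \<delta>)"
proof -
  interpret S: polynomial_rep UNIV ht2 1 std_mat by (rule polynomial_rep_std)
  interpret D: polynomial_rep "lists_over (part_size \<delta>) UNIV" "\<lambda>js. sum_list (map ht2 js)" "part_size \<delta>"
      "\<lambda>g. schur_mat \<delta> (std_mat g)"
    using polynomial_rep_tensor[OF polynomial_rep_std, of "part_size \<delta>"]
    unfolding lists_over_def schur_mat_def by simp
  have "S.submodule std_space"
    by (auto simp: S.submodule_def S.vectors_def std_space_def fun_space.subspace_UNIV)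
  from S.submodule_schur[where lam = \<delta>, OF this]
  have "D.submodule (schur \<delta> std_space)"
    unfolding lists_over_def schur_mat_def .
  from D.submodule_schur[where lam = lam, OF this]
  show "polynomial_rep.submodule X R (plethysm_space lam \<delta>)"
    unfolding X_def R_def lists_over_def[of "part_size lam"] plethysm_space_def schur_mat_def[of lam] .
  show "polynomial_rep X ht (part_size lam * part_size \<delta>) R"
    using polynomial_rep_tensor[OF D.polynomial_rep_axioms, of "part_size lam"]
    unfolding X_def ht_def R_def lists_over_def[of "part_size lam"] schur_mat_def[of lam] .
qed

text \<open>The height of a tableau vector is
  \<open>part_size lam * \<delta> 1 + sum_list T\<close>, and the total degree is
  \<open>part_size lam * (d + 2 * \<delta> 1)\<close>. In the difference defining the weight
  \<open>\<delta> 1\<close> cancels, so as far as \<open>SL2\<close> is concerned only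
  \<open>d\<close> remains.\<close>

lemma plethysm_weights:
  fixes lam \<delta> :: "nat \<Rightarrow> nat"
  defines "X \<equiv> lists_over (part_size lam) (lists_over (part_size \<delta>) (UNIV :: 2 set))"
    and "ht \<equiv> \<lambda>is. sum_list (map (\<lambda>js. sum_list (map ht2 js)) is)"
    and "R \<equiv> \<lambda>g. schur_mat lam (schur_mat \<delta> (std_mat g))"
  assumes \<delta>: "is_partition \<delta>" "part_length \<delta> \<le> 2" and d: "d = \<delta> 0 - \<delta> 1"
    and lam: "is_partition lam" "part_length lam \<le> d + 1"
  shows "fun_space.dim (polynomial_rep.weight_space ht (part_size lam * part_size \<delta>) (plethysm_space lam \<delta>) k) = ssyt_mult lam d k"
    and "\<exists>x\<in>plethysm_space lam \<delta>. x \<noteq> 0"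
proof -
  interpret polynomial_rep X ht "part_size lam * part_size \<delta>" R
    unfolding X_def ht_def R_def by (rule plethysm_rep(1))
  have W: "submodule (plethysm_space lam \<delta>)"
    unfolding X_def R_def by (rule plethysm_rep(2))
  obtain v s where v: "schur \<delta> std_space = fun_space.span (v ` {..<d + 1})"
    "\<And>i j. i < d + 1 \<Longrightarrow> j < d + 1 \<Longrightarrow> v j (s i) = (if i = j then 1 else 0)"
    "\<And>j is. j < d + 1 \<Longrightarrow> v j is \<noteq> 0 \<Longrightarrow> sum_list (map ht2 is) = \<delta> 1 + j"
    by (rule schur_two_basis[OF \<delta>, folded d]) blast
  have span: "plethysm_space lam \<delta> = fun_space.span (young_tensor lam v ` tableaux lam (d + 1))"
    unfolding plethysm_space_def v(1) by (rule schur_span[OF lam(1)])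
  have size: "part_size \<delta> = d + 2 * \<delta> 1"
  proof -
    have "\<delta> 1 \<le> \<delta> 0" using \<delta>(1) by (simp add: is_partition_def antimono_def)
    then show ?thesis using part_size_eq_sum[OF \<delta>] by (simp add: numeral_2_eq_2 d)
  qed
  have "fun_space.dim (weight_space (plethysm_space lam \<delta>) k) =
      card {T \<in> tableaux lam (d + 1). int (part_size lam * d) - 2 * int (sum_list T) = k}"
  proof (rule dim_weight_space_basis[OF W span finite_tableaux])
    fix T "is" assume T: "T \<in> tableaux lam (d + 1)" "young_tensor lam v T is \<noteq> 0"
    have "ht is = part_size lam * \<delta> 1 + sum_list T"
      unfolding ht_def using T by (intro young_tensor_support[OF v(3)]) (auto simp: tableaux_def)
    then show "wt is = int (part_size lam * d) - 2 * int (sum_list T)"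
      unfolding wt_def by (simp add: size algebra_simps)
  next
    fix A a T assume A: "A \<subseteq> tableaux lam (d + 1)" "(\<Sum>T\<in>A. fscale (a T) (young_tensor lam v T)) = 0" "T \<in> A"
    show "a T = 0"
      by (rule young_tensor_independent[where N = "d + 1" and v = v and s = s, OF lam(1) v(2) finite_subset[OF A(1) finite_tableaux] A])
  qed
  then show "fun_space.dim (weight_space (plethysm_space lam \<delta>) k) = ssyt_mult lam d k"
    by (simp only: card_tableaux_weight[OF lam(1)])
  \<comment> \<open>Existence of a tableau is read off from the generating function, which is a
    monomial times the nonzero polynomial \<open>P\<close>. This is where the bound on the length of
    \<open>lam\<close> keeps the module from vanishing.\<close>
  have "tableaux lam (d + 1) \<noteq> {}"
  proof
    assume "tableaux lam (d + 1) = {}"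
    then have "ssyt lam (d + 1) = {}"
      using bij_betw_tableau_of[OF lam(1), of "d + 1"] by (simp add: bij_betw_def)
    then have "ssyt_gf (monom 1 1 :: rat poly) lam (d + 1) = 0" by (simp add: ssyt_gf_def)
    moreover obtain P :: "rat poly" and n where "ssyt_gf (monom 1 1) lam (d + 1) = monom 1 n * P" "P \<noteq> 0"
      by (rule P_frac_ssyt_gf[OF lam])
    ultimately show False by simp
  qed
  then obtain T where T: "T \<in> tableaux lam (d + 1)" by blast
  have "young_tensor lam v T (map s T) \<noteq> 0" by (rule young_tensor_eval_diagonal[where N = "d + 1" and v = v and s = s, OF lam(1) v(2) T])
  then have "young_tensor lam v T \<noteq> 0" by auto
  moreover have "young_tensor lam v T \<in> plethysm_space lam \<delta>"
    unfolding span using T by (intro fun_space.span_base imageI)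
  ultimately show "\<exists>x\<in>plethysm_space lam \<delta>. x \<noteq> 0" by blast
qed

theorem theorem3p1:
  fixes \<delta> \<epsilon> lam \<mu> :: "nat \<Rightarrow> nat" and d e :: nat
  assumes "is_partition \<delta>" and "part_length \<delta> \<le> 2"
    and "is_partition \<epsilon>" and "part_length \<epsilon> \<le> 2"
    and "d = \<delta> 0 - \<delta> 1" and "e = \<epsilon> 0 - \<epsilon> 1"
    and "is_partition lam" and "part_length lam \<le> d + 1"
    and "is_partition \<mu>" and "part_length \<mu> \<le> e + 1"
  shows "((plethysm_iso SL2 lam \<delta> \<mu> \<epsilon> \<longleftrightarrow> P_frac d lam = P_frac e \<mu>) \<and>
          (P_frac d lam = P_frac e \<mu> \<longrightarrow> even (int (part_size lam * d) - int (part_size \<mu> * e)))) \<and>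
         (plethysm_iso GL2 lam \<delta> \<mu> \<epsilon> \<longleftrightarrow>
            P_frac d lam = P_frac e \<mu> \<and> part_size \<delta> * part_size lam = part_size \<epsilon> * part_size \<mu>)"
proof -
  let ?ht = "\<lambda>is :: 2 list list. sum_list (map (\<lambda>js. sum_list (map ht2 js)) is)"
  interpret rep_pair
    "lists_over (part_size lam) (lists_over (part_size \<delta>) UNIV)" ?ht "part_size lam * part_size \<delta>" "\<lambda>g. schur_mat lam (schur_mat \<delta> (std_mat g))"
    "lists_over (part_size \<mu>) (lists_over (part_size \<epsilon>) UNIV)" ?ht "part_size \<mu> * part_size \<epsilon>" "\<lambda>g. schur_mat \<mu> (schur_mat \<epsilon> (std_mat g))"
    by (rule rep_pair.intro[OF plethysm_rep(1)[of lam \<delta>] plethysm_rep(1)[of \<mu> \<epsilon>]])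
  have actA: "plethysm_action lam \<delta> = A.act" and actB: "plethysm_action \<mu> \<epsilon> = B.act"
    by (rule ext, simp only: plethysm_action_def A.act_def B.act_def)+
  note W1 = plethysm_rep(2)[of lam \<delta>] and W2 = plethysm_rep(2)[of \<mu> \<epsilon>]
  note dim1 = plethysm_weights(1)[OF assms(1,2,5,7,8)] and dim2 = plethysm_weights(1)[OF assms(3,4,6,9,10)]
  obtain x0 where x0: "x0 \<in> plethysm_space lam \<delta>" "x0 \<noteq> 0"
    using plethysm_weights(2)[OF assms(1,2,5,7,8)] by blast
  have SL: "plethysm_iso SL2 lam \<delta> \<mu> \<epsilon> \<longleftrightarrow> P_frac d lam = P_frac e \<mu>"
    unfolding plethysm_iso_def actA actB module_iso_SL2_iff[OF W1 W2] dim1 dim2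
    by (rule ssyt_mult_eq_iff(1)[OF assms(7-10)])
  have GL: "plethysm_iso GL2 lam \<delta> \<mu> \<epsilon> \<longleftrightarrow> plethysm_iso SL2 lam \<delta> \<mu> \<epsilon> \<and> part_size lam * part_size \<delta> = part_size \<mu> * part_size \<epsilon>"
    unfolding plethysm_iso_def actA actB by (rule module_iso_GL2_iff[OF W1 W2 x0])
  show ?thesis
    using SL GL ssyt_mult_eq_iff(2)[OF assms(7-10)] by (simp add: mult.commute)
qed

end
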